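(* Let $\pi$ be a Clairaut anti-invariant submersion from a nearly Kaehler manifold $(M,\varphi,g)$ onto a Riemannian manifold $(N,g_n)$ with $r=e^f$ and $\mathrm{grad}f\in\varphi\ker\pi_*$. Then either $f$ is constant on $\varphi\ker\pi_*$ or the fibres of $\pi$ are $1$-dimensional.
   Context: An almost Hermitian manifold $(M,\varphi,g)$ is a smooth manifold with a $(1,1)$-tensor field $\varphi$, $\varphi^2=-I$, and a Riemannian metric $g$ with $g(\varphi E,\varphi F)=g(E,F)$. It is nearly Kaehler if $(\nabla_E\varphi)F+(\nabla_F\varphi)E=0$ for all vector fields $E,F$, where $\nabla$ is the Levi-Civita connection of $g$. A Riemannian submersion $\pi:(M,g)\to(N,g_n)$ (with $\dim M>\dim N$) is a smooth surjective map of maximal rank whose differential $\pi_*$ preserves lengths of horizontal vectors; vertical vectors are those in $\ker\pi_*$ (tangent to the fibres), horizontal vectors are those in $(\ker\pi_* )^\perp$. The submersion is anti-invariant if $\varphi(\ker\pi_* )\subseteq(\ker\pi_* )^\perp$. The Riemannian submersion $\pi$ is a Clairaut submersion with $r=e^f$ ($f$ a smooth function on $M$) if for every geodesic $h$ on $M$ the function $(r\circ h)\sin\theta$ is constant, where $\theta(s)$ is the angle between $\dot h(s)$ and the horizontal space at $h(s)$. "$\mathrm{grad}f\in\varphi\ker\pi_*$" means that the gradient of $f$ with respect to $g$ is a section of the distribution $\varphi\ker\pi_*$. "$f$ is constant on $\varphi\ker\pi_*$" means $g(\mathrm{grad}f,\varphi V)=(\varphi V)(f)=0$ for all $V\in\Gamma(\ker\pi_*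 )$. *)

theory Defs
  imports "HOL-Analysis.Analysis" "HOL-Library.Function_Algebras"
begin

section \<open>Pointwise real vector space structure on functions\<close>

instantiation "fun" :: (type, real_vector) real_vector
begin

definition scaleR_fun :: "real \<Rightarrow> ('a \<Rightarrow> 'b) \<Rightarrow> 'a \<Rightarrow> 'b"
  where "scaleR_fun a f = (\<lambda>x. a *\<^sub>R f x)"

instance
  by standard
    (auto simp: scaleR_fun_def fun_eq_iff plus_fun_def scaleR_add_right scaleR_add_left)

end

section \<open>Smooth maps between open subsets of Euclidean spaces\<close>

primrec Ck_on :: "nat \<Rightarrow> 'a::real_normed_vector set \<Rightarrow> ('a \<Rightarrow> 'b::real_normed_vector) \<Rightarrow> bool" where
  "Ck_on 0 S f \<longleftrightarrow> continuous_on S f"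
| "Ck_on (Suc k) S f \<longleftrightarrow>
     (\<forall>x\<in>S. f differentiable (at x)) \<and> (\<forall>v. Ck_on k S (\<lambda>x. frechet_derivative f (at x) v))"

text \<open>Meant for open \<open>S\<close> only.\<close>

definition smooth_on :: "'a::real_normed_vector set \<Rightarrow> ('a \<Rightarrow> 'b::real_normed_vector) \<Rightarrow> bool" where
  "smooth_on S f \<longleftrightarrow> (\<forall>k. Ck_on k S f)"

section \<open>Smooth manifolds\<close>

text \<open>A manifold is a whole type \<open>'m\<close> (Hausdorff and second countable by its sort) together
  with a smooth atlas modelled on a Euclidean space \<open>'e\<close>, whose dimension \<open>DIM('e)\<close> is the
  dimension of the manifold. A chart is a pair of its domain and its coordinate map; values of
  the coordinate map outside the domain are irrelevant.\<close>

type_synonym ('m, 'e) chart = "'m set \<times> ('m \<Rightarrow> 'e)"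

abbreviation cdom :: "('m, 'e) chart \<Rightarrow> 'm set" where "cdom c \<equiv> fst c"
abbreviation cmap :: "('m, 'e) chart \<Rightarrow> 'm \<Rightarrow> 'e" where "cmap c \<equiv> snd c"
abbreviation crange :: "('m, 'e) chart \<Rightarrow> 'e set" where "crange c \<equiv> cmap c ` cdom c"
abbreviation cinv :: "('m, 'e) chart \<Rightarrow> 'e \<Rightarrow> 'm" where "cinv c \<equiv> inv_into (cdom c) (cmap c)"

definition smooth_atlas ::
  "('m::{t2_space,second_countable_topology}, 'e::euclidean_space) chart set \<Rightarrow> bool" where
  "smooth_atlas A \<longleftrightarrow>
     (\<forall>c\<in>A. open (cdom c) \<and> open (crange c) \<and>
        homeomorphism (cdom c) (crange c) (cmap c) (cinv c)) \<and>
     (\<Union>c\<in>A. cdom c) = UNIV \<and>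
     (\<forall>c\<in>A. \<forall>c'\<in>A. smooth_on (cmap c ` (cdom c \<inter> cdom c')) (cmap c' \<circ> cinv c))"

text \<open>Objects that do not depend on the choice of coordinates are evaluated in this chart.\<close>

definition chart_at :: "('m, 'e) chart set \<Rightarrow> 'm \<Rightarrow> ('m, 'e) chart" where
  "chart_at A p = (SOME c. c \<in> A \<and> p \<in> cdom c)"

definition smooth_fun :: "('m, 'e::euclidean_space) chart set \<Rightarrow> ('m \<Rightarrow> real) \<Rightarrow> bool" where
  "smooth_fun A f \<longleftrightarrow> (\<forall>c\<in>A. smooth_on (crange c) (f \<circ> cinv c))"

definition smooth_map ::
  "('m::topological_space, 'e::euclidean_space) chart set \<Rightarrow>
   ('n::topological_space, 'k::euclidean_space) chart set \<Rightarrow> ('m \<Rightarrow> 'n) \<Rightarrow> bool" where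
  "smooth_map A B F \<longleftrightarrow> continuous_on UNIV F \<and>
     (\<forall>c\<in>A. \<forall>d\<in>B. smooth_on (cmap c ` (cdom c \<inter> F -` cdom d)) (cmap d \<circ> F \<circ> cinv c))"

section \<open>Tangent vectors and vector fields\<close>

text \<open>A tangent vector at \<open>p\<close> is the family of its coordinate representations in all charts
  around \<open>p\<close>, related by the Jacobians of the coordinate changes. The entries at all other
  charts are set to zero, so that equality of tangent vectors is equality of functions.\<close>

type_synonym ('m, 'e) tvec = "('m, 'e) chart \<Rightarrow> 'e"

definition tangent_space ::
  "('m, 'e::euclidean_space) chart set \<Rightarrow> 'm \<Rightarrow> ('m, 'e) tvec set" where
  "tangent_space A p = {v.
     (\<forall>c\<in>A. \<forall>c'\<in>A. p \<in> cdom c \<inter> cdom c' \<longrightarrow>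
        v c' = frechet_derivative (cmap c' \<circ> cinv c) (at (cmap c p)) (v c)) \<and>
     (\<forall>c. \<not> (c \<in> A \<and> p \<in> cdom c) \<longrightarrow> v c = 0)}"

text \<open>The tangent vector at \<open>p\<close> whose representation in the chart \<open>c\<close> is \<open>u\<close>; for a basis
  vector \<open>u\<close> this is a coordinate vector field of \<open>c\<close>, evaluated at \<open>p\<close>.\<close>

definition coord_vec ::
  "('m, 'e::euclidean_space) chart set \<Rightarrow> ('m, 'e) chart \<Rightarrow> 'm \<Rightarrow> 'e \<Rightarrow> ('m, 'e) tvec" where
  "coord_vec A c p u = (\<lambda>c'. if c' \<in> A \<and> p \<in> cdom c'
     then frechet_derivative (cmap c' \<circ> cinv c) (at (cmap c p)) u else 0)"

definition vector_field ::
  "('m, 'e::euclidean_space) chart set \<Rightarrow> ('m \<Rightarrow> ('m, 'e) tvec) \<Rightarrow> bool" where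
  "vector_field A E \<longleftrightarrow> (\<forall>p. E p \<in> tangent_space A p) \<and>
     (\<forall>c\<in>A. smooth_on (crange c) (\<lambda>x. E (cinv c x) c))"

definition dir_deriv ::
  "('m, 'e::euclidean_space) chart set \<Rightarrow> 'm \<Rightarrow> ('m, 'e) tvec \<Rightarrow> ('m \<Rightarrow> real) \<Rightarrow> real" where
  "dir_deriv A p v f =
     (let c = chart_at A p in frechet_derivative (f \<circ> cinv c) (at (cmap c p)) (v c))"

definition differential ::
  "('m, 'e::euclidean_space) chart set \<Rightarrow> ('n, 'k::euclidean_space) chart set \<Rightarrow>
   ('m \<Rightarrow> 'n) \<Rightarrow> 'm \<Rightarrow> ('m, 'e) tvec \<Rightarrow> ('n, 'k) tvec" where
  "differential A B F p v = (let c = chart_at A p in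
     (\<lambda>d. if d \<in> B \<and> F p \<in> cdom d
        then frechet_derivative (cmap d \<circ> F \<circ> cinv c) (at (cmap c p)) (v c) else 0))"

section \<open>Riemannian metrics\<close>

type_synonym ('m, 'e) metric = "'m \<Rightarrow> ('m, 'e) tvec \<Rightarrow> ('m, 'e) tvec \<Rightarrow> real"

definition metric_coord ::
  "('m, 'e::euclidean_space) chart set \<Rightarrow> ('m, 'e) metric \<Rightarrow> ('m, 'e) chart \<Rightarrow>
   'e \<Rightarrow> 'e \<Rightarrow> 'e \<Rightarrow> real" where
  "metric_coord A g c x u v =
     g (cinv c x) (coord_vec A c (cinv c x) u) (coord_vec A c (cinv c x) v)"

definition riemannian_metric ::
  "('m, 'e::euclidean_space) chart set \<Rightarrow> ('m, 'e) metric \<Rightarrow> bool" where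
  "riemannian_metric A g \<longleftrightarrow>
     (\<forall>p. \<forall>u\<in>tangent_space A p. \<forall>v\<in>tangent_space A p. \<forall>w\<in>tangent_space A p. \<forall>a.
        g p u v = g p v u \<and>
        g p (u + v) w = g p u w + g p v w \<and>
        g p (a *\<^sub>R u) w = a * g p u w \<and>
        (u \<noteq> 0 \<longrightarrow> g p u u > 0)) \<and>
     (\<forall>c\<in>A. \<forall>u v. smooth_on (crange c) (\<lambda>x. metric_coord A g c x u v))"

definition riemannian_manifold ::
  "('m::{t2_space,second_countable_topology}, 'e::euclidean_space) chart set \<Rightarrow>
   ('m, 'e) metric \<Rightarrow> bool" where
  "riemannian_manifold A g \<longleftrightarrow> smooth_atlas A \<and> riemannian_metric A g"

definition tnorm :: "('m, 'e) metric \<Rightarrow> 'm \<Rightarrow> ('m, 'e) tvec \<Rightarrow> real" where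
  "tnorm g p v = sqrt (g p v v)"

definition grad ::
  "('m, 'e::euclidean_space) chart set \<Rightarrow> ('m, 'e) metric \<Rightarrow> ('m \<Rightarrow> real) \<Rightarrow> 'm \<Rightarrow> ('m, 'e) tvec" where
  "grad A g f p = (THE u. u \<in> tangent_space A p \<and>
     (\<forall>v\<in>tangent_space A p. g p u v = dir_deriv A p v f))"

section \<open>The Levi-Civita connection and geodesics\<close>

text \<open>The coefficients, at the point with coordinates \<open>x\<close> in the chart \<open>c\<close>, of the unique
  connection that is torsion-free (the coefficients are symmetric, as coordinate fields
  commute) and compatible with the metric: \<open>\<Gamma> u v\<close> represents the covariant derivative, in
  direction \<open>u\<close>, of the vector field with constant representation \<open>v\<close>.\<close>

definition levi_civita_coeff ::
  "('m, 'e::euclidean_space) chart set \<Rightarrow> ('m, 'e) metric \<Rightarrow> ('m, 'e) chart \<Rightarrow>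
   'e \<Rightarrow> 'e \<Rightarrow> 'e \<Rightarrow> 'e" where
  "levi_civita_coeff A g c x = (THE \<Gamma>. bilinear \<Gamma> \<and> (\<forall>u v. \<Gamma> u v = \<Gamma> v u) \<and>
     (\<forall>u v w. frechet_derivative (\<lambda>y. metric_coord A g c y v w) (at x) u =
        metric_coord A g c x (\<Gamma> u v) w + metric_coord A g c x v (\<Gamma> u w)))"

text \<open>The vector field \<open>\<nabla>\<^sub>E F\<close>; the result does not depend on the chart around \<open>p\<close>.\<close>

definition nabla ::
  "('m, 'e::euclidean_space) chart set \<Rightarrow> ('m, 'e) metric \<Rightarrow>
   ('m \<Rightarrow> ('m, 'e) tvec) \<Rightarrow> ('m \<Rightarrow> ('m, 'e) tvec) \<Rightarrow> 'm \<Rightarrow> ('m, 'e) tvec" where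
  "nabla A g E F p = (let c = chart_at A p; x = cmap c p in
     coord_vec A c p
       (frechet_derivative (\<lambda>y. F (cinv c y) c) (at x) (E p c) +
        levi_civita_coeff A g c x (E p c) (F p c)))"

definition smooth_curve ::
  "('m::topological_space, 'e::euclidean_space) chart set \<Rightarrow> real set \<Rightarrow> (real \<Rightarrow> 'm) \<Rightarrow> bool" where
  "smooth_curve A I h \<longleftrightarrow> continuous_on I h \<and>
     (\<forall>c\<in>A. smooth_on {s \<in> I. h s \<in> cdom c} (cmap c \<circ> h))"

definition velocity ::
  "('m, 'e::euclidean_space) chart set \<Rightarrow> (real \<Rightarrow> 'm) \<Rightarrow> real \<Rightarrow> ('m, 'e) tvec" where
  "velocity A h s = (\<lambda>c. if c \<in> A \<and> h s \<in> cdom c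
     then vector_derivative (cmap c \<circ> h) (at s) else 0)"

text \<open>Geodesics are parametrised by open intervals \<open>I\<close> and need not be complete. The equation
  expresses that the covariant derivative of the velocity along \<open>h\<close> vanishes at \<open>s\<close>; it holds
  in one chart around \<open>h s\<close> if and only if it holds in all of them.\<close>

definition geodesic ::
  "('m::topological_space, 'e::euclidean_space) chart set \<Rightarrow> ('m, 'e) metric \<Rightarrow>
   real set \<Rightarrow> (real \<Rightarrow> 'm) \<Rightarrow> bool" where
  "geodesic A g I h \<longleftrightarrow> open I \<and> is_interval I \<and> smooth_curve A I h \<and>
     (\<forall>s\<in>I. \<exists>c\<in>A. h s \<in> cdom c \<and>
        vector_derivative (\<lambda>t. velocity A h t c) (at s) +
        levi_civita_coeff A g c (cmap c (h s)) (velocity A h s c) (velocity A h s c) = 0)"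

section \<open>Nearly Kaehler manifolds\<close>

definition almost_hermitian ::
  "('m::{t2_space,second_countable_topology}, 'e::euclidean_space) chart set \<Rightarrow>
   ('m \<Rightarrow> ('m, 'e) tvec \<Rightarrow> ('m, 'e) tvec) \<Rightarrow> ('m, 'e) metric \<Rightarrow> bool" where
  "almost_hermitian A \<phi> g \<longleftrightarrow> riemannian_manifold A g \<and>
     (\<forall>p. \<forall>u\<in>tangent_space A p. \<forall>v\<in>tangent_space A p. \<forall>a.
        \<phi> p u \<in> tangent_space A p \<and>
        \<phi> p (u + v) = \<phi> p u + \<phi> p v \<and>
        \<phi> p (a *\<^sub>R u) = a *\<^sub>R \<phi> p u \<and>
        \<phi> p (\<phi> p u) = - u \<and>
        g p (\<phi> p u) (\<phi> p v) = g p u v) \<and>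
     (\<forall>c\<in>A. \<forall>u. smooth_on (crange c) (\<lambda>x. \<phi> (cinv c x) (coord_vec A c (cinv c x) u) c))"

definition nabla_endo ::
  "('m, 'e::euclidean_space) chart set \<Rightarrow> ('m, 'e) metric \<Rightarrow>
   ('m \<Rightarrow> ('m, 'e) tvec \<Rightarrow> ('m, 'e) tvec) \<Rightarrow>
   ('m \<Rightarrow> ('m, 'e) tvec) \<Rightarrow> ('m \<Rightarrow> ('m, 'e) tvec) \<Rightarrow> 'm \<Rightarrow> ('m, 'e) tvec" where
  "nabla_endo A g \<phi> E F p = nabla A g E (\<lambda>q. \<phi> q (F q)) p - \<phi> p (nabla A g E F p)"

definition nearly_kaehler ::
  "('m::{t2_space,second_countable_topology}, 'e::euclidean_space) chart set \<Rightarrow>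
   ('m \<Rightarrow> ('m, 'e) tvec \<Rightarrow> ('m, 'e) tvec) \<Rightarrow> ('m, 'e) metric \<Rightarrow> bool" where
  "nearly_kaehler A \<phi> g \<longleftrightarrow> almost_hermitian A \<phi> g \<and>
     (\<forall>E F. vector_field A E \<and> vector_field A F \<longrightarrow>
        (\<forall>p. nabla_endo A g \<phi> E F p + nabla_endo A g \<phi> F E p = 0))"

section \<open>Riemannian submersions\<close>

definition vertical ::
  "('m, 'e::euclidean_space) chart set \<Rightarrow> ('n, 'k::euclidean_space) chart set \<Rightarrow>
   ('m \<Rightarrow> 'n) \<Rightarrow> 'm \<Rightarrow> ('m, 'e) tvec set" where
  "vertical A B \<pi> p = {v \<in> tangent_space A p. differential A B \<pi> p v = 0}"

definition horizontal ::
  "('m, 'e::euclidean_space) chart set \<Rightarrow> ('m, 'e) metric \<Rightarrow>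
   ('n, 'k::euclidean_space) chart set \<Rightarrow> ('m \<Rightarrow> 'n) \<Rightarrow> 'm \<Rightarrow> ('m, 'e) tvec set" where
  "horizontal A g B \<pi> p = {u \<in> tangent_space A p. \<forall>v\<in>vertical A B \<pi> p. g p u v = 0}"

definition riemannian_submersion ::
  "('m::{t2_space,second_countable_topology}, 'e::euclidean_space) chart set \<Rightarrow> ('m, 'e) metric \<Rightarrow>
   ('n::{t2_space,second_countable_topology}, 'k::euclidean_space) chart set \<Rightarrow> ('n, 'k) metric \<Rightarrow>
   ('m \<Rightarrow> 'n) \<Rightarrow> bool" where
  "riemannian_submersion A g B g\<^sub>n \<pi> \<longleftrightarrow>
     riemannian_manifold A g \<and> riemannian_manifold B g\<^sub>n \<and> DIM('e) > DIM('k) \<and>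
     smooth_map A B \<pi> \<and> surj \<pi> \<and>
     (\<forall>p. differential A B \<pi> p ` tangent_space A p = tangent_space B (\<pi> p)) \<and>
     (\<forall>p. \<forall>u\<in>horizontal A g B \<pi> p. tnorm g\<^sub>n (\<pi> p) (differential A B \<pi> p u) = tnorm g p u)"

definition anti_invariant ::
  "('m, 'e::euclidean_space) chart set \<Rightarrow> ('m \<Rightarrow> ('m, 'e) tvec \<Rightarrow> ('m, 'e) tvec) \<Rightarrow>
   ('m, 'e) metric \<Rightarrow> ('n, 'k::euclidean_space) chart set \<Rightarrow> ('m \<Rightarrow> 'n) \<Rightarrow> bool" where
  "anti_invariant A \<phi> g B \<pi> \<longleftrightarrow> (\<forall>p. \<phi> p ` vertical A B \<pi> p \<subseteq> horizontal A g B \<pi> p)"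

definition hor_proj ::
  "('m, 'e::euclidean_space) chart set \<Rightarrow> ('m, 'e) metric \<Rightarrow>
   ('n, 'k::euclidean_space) chart set \<Rightarrow> ('m \<Rightarrow> 'n) \<Rightarrow> 'm \<Rightarrow> ('m, 'e) tvec \<Rightarrow> ('m, 'e) tvec" where
  "hor_proj A g B \<pi> p v = (THE u. u \<in> horizontal A g B \<pi> p \<and> v - u \<in> vertical A B \<pi> p)"

text \<open>The non-obtuse angle between a nonzero vector and the horizontal space, i.e. the angle
  between the vector and its orthogonal projection. The value at the zero vector is immaterial.\<close>

definition hor_angle ::
  "('m, 'e::euclidean_space) chart set \<Rightarrow> ('m, 'e) metric \<Rightarrow>
   ('n, 'k::euclidean_space) chart set \<Rightarrow> ('m \<Rightarrow> 'n) \<Rightarrow> 'm \<Rightarrow> ('m, 'e) tvec \<Rightarrow> real" where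
  "hor_angle A g B \<pi> p v = arccos (tnorm g p (hor_proj A g B \<pi> p v) / tnorm g p v)"

text \<open>Constant geodesics, whose velocity is zero, satisfy the condition trivially.\<close>

definition clairaut_submersion ::
  "('m::{t2_space,second_countable_topology}, 'e::euclidean_space) chart set \<Rightarrow> ('m, 'e) metric \<Rightarrow>
   ('n::{t2_space,second_countable_topology}, 'k::euclidean_space) chart set \<Rightarrow> ('n, 'k) metric \<Rightarrow>
   ('m \<Rightarrow> 'n) \<Rightarrow> ('m \<Rightarrow> real) \<Rightarrow> bool" where
  "clairaut_submersion A g B g\<^sub>n \<pi> r \<longleftrightarrow> riemannian_submersion A g B g\<^sub>n \<pi> \<and>
     (\<forall>I h. geodesic A g I h \<longrightarrow>
        (\<lambda>s. r (h s) * sin (hor_angle A g B \<pi> (h s) (velocity A h s))) constant_on I)"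

definition vertical_field ::
  "('m, 'e::euclidean_space) chart set \<Rightarrow> ('n, 'k::euclidean_space) chart set \<Rightarrow>
   ('m \<Rightarrow> 'n) \<Rightarrow> ('m \<Rightarrow> ('m, 'e) tvec) \<Rightarrow> bool" where
  "vertical_field A B \<pi> V \<longleftrightarrow> vector_field A V \<and> (\<forall>p. V p \<in> vertical A B \<pi> p)"

definition constant_on_phi_vertical ::
  "('m, 'e::euclidean_space) chart set \<Rightarrow> ('m \<Rightarrow> ('m, 'e) tvec \<Rightarrow> ('m, 'e) tvec) \<Rightarrow>
   ('m, 'e) metric \<Rightarrow> ('n, 'k::euclidean_space) chart set \<Rightarrow> ('m \<Rightarrow> 'n) \<Rightarrow> ('m \<Rightarrow> real) \<Rightarrow> bool" where
  "constant_on_phi_vertical A \<phi> g B \<pi> f \<longleftrightarrow>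
     (\<forall>V. vertical_field A B \<pi> V \<longrightarrow> (\<forall>p. g p (grad A g f p) (\<phi> p (V p)) = 0))"

text \<open>The fibre through \<open>p\<close> has tangent space \<open>vertical A B \<pi> p\<close> at \<open>p\<close>.\<close>

definition fibres_of_dim ::
  "('m, 'e::euclidean_space) chart set \<Rightarrow> ('n, 'k::euclidean_space) chart set \<Rightarrow>
   ('m \<Rightarrow> 'n) \<Rightarrow> nat \<Rightarrow> bool" where
  "fibres_of_dim A B \<pi> k \<longleftrightarrow> (\<forall>q. \<forall>p \<in> \<pi> -` {q}. dim (vertical A B \<pi> p) = k)"

end

theory Submission
  imports Defs
begin

text \<open>Everything happens in one chart of \<open>M\<close> and one of \<open>N\<close>. Along a geodesic the Clairaut condition says
  that \<open>exp (2 f)\<close> times the squared length of the vertical part of the velocity is constant.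
  Differentiating this at time \<open>0\<close> for the initial velocities \<open>v + e u\<close> with \<open>v\<close> vertical and \<open>u\<close> horizontal and
  comparing the terms linear in \<open>e\<close> shows that the fibres are totally umbilical: the
  horizontal part of \<open>\<nabla>\<^sub>V W\<close> is \<open>- g(V, W) grad f\<close>. Pairing \<open>(\<nabla>\<^sub>V \<phi>) V = 0\<close> with a vertical \<open>W\<close>
  then gives \<open>g(V, W) g(grad f, \<phi> V) = g(V, V) g(grad f, \<phi> W)\<close>. Write \<open>grad f = \<phi> X\<close> with \<open>X\<close> vertical. If the
  fibres have dimension at least \<open>2\<close>, take \<open>W = X\<close> and \<open>V \<noteq> 0\<close> orthogonal to \<open>X\<close> to get \<open>X = 0\<close>.
  The analytic input is the local existence of geodesics (Picard iteration) and of global vector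
  fields with a prescribed value at a point (bump functions).\<close>

section \<open>Calculus of continuously differentiable maps\<close>

text \<open>The dichotomy is global although the argument is pointwise. Every vertical space has
  dimension \<open>DIM('e) - DIM('k)\<close>, which is positive, so if it is not \<open>1\<close> it
  is at least \<open>2\<close> at every point, and then \<open>grad f\<close> vanishes everywhere.
  In the comparison of coefficients, a vertical starting velocity \<open>v\<close> alone would give
  only that \<open>f\<close> has derivative \<open>0\<close> along \<open>v\<close>; the derivative
  of \<open>f\<close> in horizontal directions first appears at order \<open>e\<close>. Two features
  of the definitions shape the proof. The angle is an \<open>arccos\<close> of a quotient of norms
  and need not be differentiable at vertical velocities, so the squared sine times the squared speed
  takes its place; this is a smooth expression because the squared length of the horizontal part is
  measured in \<open>N\<close>. The nearly Kaehler identity is stated for globally defined fields,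
  whereas a chart offers only fields near a point, hence the cut-offs.\<close>

lemma Ck_on_subset: "Ck_on k S f \<Longrightarrow> T \<subseteq> S \<Longrightarrow> Ck_on k T f"
  by (induction k arbitrary: f) (auto intro: continuous_on_subset)

text \<open>Derivatives in \<open>Ck_on\<close> are taken over full neighbourhoods, so agreement on
  \<open>S\<close> alone carries over to them only because \<open>S\<close> is open.\<close>

lemma Ck_on_cong:
  assumes "open S" "Ck_on k S f" "\<And>x. x \<in> S \<Longrightarrow> f x = g x"
  shows "Ck_on k S g"
  using assms(2,3)
proof (induction k arbitrary: f g)
  case 0
  then show ?case by (simp cong: continuous_on_cong)
next
  case (Suc k)
  have fr: "frechet_derivative f (at x) = frechet_derivative g (at x)" if "x \<in> S" for x
    using Suc.prems that assms(1) by (intro frechet_derivative_transform_within_open) auto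
  have "g differentiable at x" if "x \<in> S" for x
    using Suc.prems that assms(1)
    by (metis (no_types, lifting) Ck_on.simps(2) differentiable_def has_derivative_transform_within_open)
  moreover have "Ck_on k S (\<lambda>x. frechet_derivative g (at x) v)" for v
    by (rule Suc.IH[of "\<lambda>x. frechet_derivative f (at x) v"]) (use Suc.prems fr in auto)
  ultimately show ?case by simp
qed

text \<open>Needed for gluing: a cut-off vector field is smooth for different reasons near its
  support and away from it.\<close>

lemma Ck_on_local:
  assumes "\<And>x. x \<in> S \<Longrightarrow> \<exists>N. open N \<and> x \<in> N \<and> Ck_on k N f"
  shows "Ck_on k S f"
  using assms
proof (induction k arbitrary: f)
  case 0
  then show ?case
    by (metis Ck_on.simps(1) continuous_at_imp_continuous_on continuous_on_eq_continuous_at)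
next
  case (Suc k)
  have "Ck_on k S (\<lambda>x. frechet_derivative f (at x) v)" for v
    by (rule Suc.IH) (use Suc.prems in fastforce)
  then show ?case using Suc.prems by fastforce
qed

lemma Ck_on_SucD: "Ck_on (Suc k) S f \<Longrightarrow> Ck_on k S f"
proof (induction k arbitrary: f)
  case 0
  then show ?case
    by (auto intro!: continuous_at_imp_continuous_on differentiable_imp_continuous_within)
next
  case (Suc k)
  then show ?case by (metis Ck_on.simps(2))
qed

lemma Ck_on_SucI:
  assumes "open S" "\<And>x. x \<in> S \<Longrightarrow> (f has_derivative D x) (at x)"
    "\<And>v. Ck_on k S (\<lambda>x. D x v)"
  shows "Ck_on (Suc k) S f"
proof -
  have "frechet_derivative f (at x) = D x" if "x \<in> S" for x
    using assms(2)[OF that] by (simp add: frechet_derivative_at[symmetric])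
  then have "Ck_on k S (\<lambda>x. frechet_derivative f (at x) v)" for v
    by (intro Ck_on_cong[OF assms(1) assms(3)]) auto
  then show ?thesis using assms(2) by (auto simp: differentiable_def)
qed

lemma Ck_on_Suc_has_derivative:
  "Ck_on (Suc k) S f \<Longrightarrow> x \<in> S \<Longrightarrow> (f has_derivative frechet_derivative f (at x)) (at x)"
  by (auto simp: frechet_derivative_works[symmetric])

lemma Ck_on_const: "open S \<Longrightarrow> Ck_on k S (\<lambda>x. c)"
proof (induction k arbitrary: c)
  case (Suc k)
  then show ?case by (intro Ck_on_SucI[where D="\<lambda>x h. 0"]) auto
qed auto

lemma Ck_on_bounded_linear: "bounded_linear h \<Longrightarrow> open S \<Longrightarrow> Ck_on k S h"
proof (induction k)
  case 0 then show ?case by (auto intro: linear_continuous_on)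
next
  case (Suc k)
  then show ?case
    by (intro Ck_on_SucI[where D="\<lambda>x. h"] Ck_on_const) (auto intro: bounded_linear_imp_has_derivative)
qed

lemma Ck_on_linear_compose:
  assumes "bounded_linear h" "open S" "Ck_on k S f"
  shows "Ck_on k S (\<lambda>x. h (f x))"
  using assms(3)
proof (induction k arbitrary: f)
  case 0 then show ?case using assms(1) by (auto intro: linear_continuous_on_compose bounded_linear.continuous_on)
next
  case (Suc k)
  show ?case
    by (intro Ck_on_SucI[where D="\<lambda>x v. h (frechet_derivative f (at x) v)"] assms(2)
        bounded_linear.has_derivative[OF assms(1)] Ck_on_Suc_has_derivative[OF Suc.prems] Suc.IH)
      (use Suc.prems in auto)
qed

lemma Ck_on_add:
  assumes "open S" "Ck_on k S f" "Ck_on k S g"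
  shows "Ck_on k S (\<lambda>x. f x + g x)"
  using assms(2,3)
proof (induction k arbitrary: f g)
  case 0 then show ?case by (auto intro: continuous_intros)
next
  case (Suc k)
  show ?case
    by (intro Ck_on_SucI[where D="\<lambda>x v. frechet_derivative f (at x) v + frechet_derivative g (at x) v"]
        assms(1) has_derivative_add Ck_on_Suc_has_derivative[OF Suc.prems(1)]
        Ck_on_Suc_has_derivative[OF Suc.prems(2)] Suc.IH)
      (use Suc.prems in auto)
qed

lemma Ck_on_sum:
  assumes "open S" "\<And>i. i \<in> I \<Longrightarrow> Ck_on k S (f i)"
  shows "Ck_on k S (\<lambda>x. \<Sum>i\<in>I. f i x)"
  using assms(2)
  by (induction I rule: infinite_finite_induct) (auto intro!: Ck_on_add Ck_on_const assms(1))

lemma (in bounded_bilinear) Ck_on: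
  assumes "open S" "Ck_on k S f" "Ck_on k S g"
  shows "Ck_on k S (\<lambda>x. prod (f x) (g x))"
  using assms(2,3)
proof (induction k arbitrary: f g)
  case 0 then show ?case by (auto intro: continuous_on)
next
  case (Suc k)
  have fg: "Ck_on k S f" "Ck_on k S g" using Suc.prems Ck_on_SucD by blast+
  show ?case
    by (intro Ck_on_SucI[where D="\<lambda>x v. prod (f x) (frechet_derivative g (at x) v)
          + prod (frechet_derivative f (at x) v) (g x)"]
        assms(1) FDERIV Ck_on_Suc_has_derivative[OF Suc.prems(1)]
        Ck_on_Suc_has_derivative[OF Suc.prems(2)] Ck_on_add Suc.IH fg)
      (use Suc.prems in auto)
qed

lemmas Ck_on_mult = bounded_bilinear.Ck_on[OF bounded_bilinear_mult]
lemmas Ck_on_scaleR = bounded_bilinear.Ck_on[OF bounded_bilinear_scaleR]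
lemmas Ck_on_inner_right = Ck_on_linear_compose[OF bounded_linear_inner_left]

lemma Ck_on_minus: "open S \<Longrightarrow> Ck_on k S f \<Longrightarrow> Ck_on k S (\<lambda>x. - f x)"
  by (rule Ck_on_linear_compose[OF bounded_linear_minus[OF bounded_linear_ident]])

lemma Ck_on_diff: "open S \<Longrightarrow> Ck_on k S f \<Longrightarrow> Ck_on k S g \<Longrightarrow> Ck_on k S (\<lambda>x. f x - g x)"
  using Ck_on_add[of S k f "\<lambda>x. - g x"] Ck_on_minus[of S k g] by simp

lemma Ck_on_componentwise:
  fixes f :: "'a::real_normed_vector \<Rightarrow> 'b::euclidean_space"
  assumes "open S" "\<And>i. i \<in> Basis \<Longrightarrow> Ck_on k S (\<lambda>x. f x \<bullet> i)"
  shows "Ck_on k S f"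
proof -
  have "Ck_on k S (\<lambda>x. \<Sum>i\<in>Basis. (f x \<bullet> i) *\<^sub>R i)"
    by (intro Ck_on_sum Ck_on_scaleR Ck_on_const assms)
  then show ?thesis by (simp add: euclidean_representation)
qed

section \<open>Expansion in a basis and families of linear maps\<close>

lemma linear_expand:
  fixes M :: "'e::euclidean_space \<Rightarrow> 'b::real_vector"
  assumes "linear M"
  shows "M u = (\<Sum>i\<in>Basis. (u \<bullet> i) *\<^sub>R M i)"
proof -
  have "M u = M (\<Sum>i\<in>Basis. (u \<bullet> i) *\<^sub>R i)" by (simp add: euclidean_representation)
  also have "\<dots> = (\<Sum>i\<in>Basis. (u \<bullet> i) *\<^sub>R M i)"
    by (simp add: linear_sum[OF assms] linear_scale[OF assms])
  finally show ?thesis .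
qed

text \<open>By the chain rule the derivative of the composite applies
  \<open>frechet_derivative g (at (f x))\<close> to a direction that moves with \<open>x\<close>,
  while \<open>Ck_on\<close> speaks only of fixed directions. Expanding the moving direction in
  \<open>Basis\<close> leaves products to which the induction hypothesis, for arbitrary
  \<open>g\<close>, applies.\<close>

lemma Ck_on_compose:
  fixes f :: "'a::real_normed_vector \<Rightarrow> 'b::euclidean_space" and g :: "'b \<Rightarrow> 'c::real_normed_vector"
  assumes "open S" "open T" "f ` S \<subseteq> T" "Ck_on k S f" "Ck_on k T g"
  shows "Ck_on k S (\<lambda>x. g (f x))"
  using assms(4,5)
proof (induction k arbitrary: g)
  case 0 then show ?case using assms(3) by (auto intro: continuous_on_compose2)
next
  case (Suc k)
  let ?D = "\<lambda>x v. frechet_derivative g (at (f x)) (frechet_derivative f (at x) v)"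
  show ?case
  proof (rule Ck_on_SucI[where D="?D", OF assms(1)])
    fix x assume "x \<in> S"
    then have "((g \<circ> f) has_derivative (frechet_derivative g (at (f x)) \<circ> frechet_derivative f (at x))) (at x)"
      using assms(3) by (intro diff_chain_at Ck_on_Suc_has_derivative[OF Suc.prems(1)]
          Ck_on_Suc_has_derivative[OF Suc.prems(2)]) auto
    then show "((\<lambda>x. g (f x)) has_derivative ?D x) (at x)" by (simp add: o_def)
  next
    fix v
    have "Ck_on k S (\<lambda>x. \<Sum>i\<in>Basis. (frechet_derivative f (at x) v \<bullet> i) *\<^sub>R frechet_derivative g (at (f x)) i)"
      using Suc.prems by (intro Ck_on_sum Ck_on_scaleR Ck_on_inner_right assms(1) Suc.IH Ck_on_SucD[OF Suc.prems(1)]) auto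
    then show "Ck_on k S (\<lambda>x. ?D x v)"
    proof (rule Ck_on_cong[OF assms(1)])
      fix x assume "x \<in> S"
      then have "linear (frechet_derivative g (at (f x)))"
        using assms(3) Suc.prems by (intro linear_frechet_derivative) auto
      then show "(\<Sum>i\<in>Basis. (frechet_derivative f (at x) v \<bullet> i) *\<^sub>R frechet_derivative g (at (f x)) i) = ?D x v"
        by (metis linear_expand)
    qed
  qed
qed

lemma Ck_on_inverse:
  fixes f :: "'a::real_normed_vector \<Rightarrow> real"
  assumes "open S" "Ck_on k S f" "\<And>x. x \<in> S \<Longrightarrow> f x \<noteq> 0"
  shows "Ck_on k S (\<lambda>x. inverse (f x))"
  using assms(2)
proof (induction k)
  case 0 then show ?case using assms(3) by (auto intro: continuous_intros)
next
  case (Suc k)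
  have "Ck_on k S f" "Ck_on k S (\<lambda>x. inverse (f x))" using Suc Ck_on_SucD by blast+
  then have "Ck_on k S (\<lambda>x. - (inverse (f x) * frechet_derivative f (at x) v * inverse (f x)))" for v
    using Suc.prems by (intro Ck_on_minus Ck_on_mult assms(1)) auto
  then show ?case
    by (intro Ck_on_SucI[where D="\<lambda>x v. - (inverse (f x) * frechet_derivative f (at x) v * inverse (f x))"]
        assms(1,3) Deriv.has_derivative_inverse Ck_on_Suc_has_derivative[OF Suc.prems])
qed

text \<open>\<open>M x\<close> is known to be smooth only at fixed arguments; expanding
  \<open>a x\<close> in \<open>Basis\<close> allows the argument to move.\<close>

lemma Ck_on_linear_family:
  fixes M :: "'b::real_normed_vector \<Rightarrow> 'e::euclidean_space \<Rightarrow> 'c::real_normed_vector"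
  assumes "open S" "\<And>u. Ck_on k S (\<lambda>x. M x u)" "Ck_on k S a" "\<And>x. x \<in> S \<Longrightarrow> linear (M x)"
  shows "Ck_on k S (\<lambda>x. M x (a x))"
proof (rule Ck_on_cong[OF assms(1)])
  show "Ck_on k S (\<lambda>x. \<Sum>i\<in>Basis. (a x \<bullet> i) *\<^sub>R M x i)"
    by (intro Ck_on_sum Ck_on_scaleR Ck_on_inner_right assms)
qed (simp add: linear_expand[OF assms(4), symmetric])

lemma Ck_on_bilinear_family:
  fixes G :: "'b::real_normed_vector \<Rightarrow> 'e::euclidean_space \<Rightarrow> 'f::euclidean_space \<Rightarrow> 'c::real_normed_vector"
  assumes "open S" "\<And>u v. Ck_on k S (\<lambda>x. G x u v)" "Ck_on k S a" "Ck_on k S b"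
    "\<And>x. x \<in> S \<Longrightarrow> bilinear (G x)"
  shows "Ck_on k S (\<lambda>x. G x (a x) (b x))"
proof -
  have lin: "linear (\<lambda>u. G x u v)" "linear (G x u)" if "x \<in> S" for x u v
    using assms(5)[OF that] by (auto simp: bilinear_def)
  have "Ck_on k S (\<lambda>x. G x u (b x))" for u
    by (rule Ck_on_linear_family[OF assms(1,2,4) lin(2)])
  then show ?thesis
    by (rule Ck_on_linear_family[where M="\<lambda>x u. G x u (b x)", OF assms(1) _ assms(3) lin(1)])
qed

lemma has_derivative_linear_family:
  fixes M :: "'b::real_normed_vector \<Rightarrow> 'e::euclidean_space \<Rightarrow> 'c::real_normed_vector"
  assumes "open S" "x \<in> S" "\<And>u. (\<lambda>x. M x u) differentiable at x"
    "(a has_derivative a') (at x)" "\<And>x. x \<in> S \<Longrightarrow> linear (M x)"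
  shows "((\<lambda>x. M x (a x)) has_derivative
    (\<lambda>h. frechet_derivative (\<lambda>y. M y (a x)) (at x) h + M x (a' h))) (at x)"
proof -
  define D where "D u = frechet_derivative (\<lambda>x. M x u) (at x)" for u
  have D: "((\<lambda>x. M x u) has_derivative D u) (at x)" for u
    unfolding D_def using assms(3) frechet_derivative_works by blast
  have 1: "((\<lambda>y. \<Sum>i\<in>Basis. (a y \<bullet> i) *\<^sub>R M y i) has_derivative
      (\<lambda>h. \<Sum>i\<in>Basis. (a x \<bullet> i) *\<^sub>R D i h + (a' h \<bullet> i) *\<^sub>R M x i)) (at x)"
    by (intro has_derivative_sum has_derivative_scaleR has_derivative_inner_left assms(4) D)
  \<comment> \<open>Identifies the first half of the product rule as the derivative with the
    argument frozen at \<open>a x\<close>.\<close>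
  have "((\<lambda>y. \<Sum>i\<in>Basis. (a x \<bullet> i) *\<^sub>R M y i) has_derivative
      (\<lambda>h. \<Sum>i\<in>Basis. (a x \<bullet> i) *\<^sub>R D i h)) (at x)"
    by (intro has_derivative_sum has_derivative_scaleR_right D)
  then have "((\<lambda>y. M y (a x)) has_derivative (\<lambda>h. \<Sum>i\<in>Basis. (a x \<bullet> i) *\<^sub>R D i h)) (at x)"
    by (rule has_derivative_transform_within_open[OF _ assms(1,2)]) (metis linear_expand assms(5))
  then have Da: "D (a x) = (\<lambda>h. \<Sum>i\<in>Basis. (a x \<bullet> i) *\<^sub>R D i h)"
    using D has_derivative_unique by blast
  have "((\<lambda>y. M y (a y)) has_derivative
      (\<lambda>h. \<Sum>i\<in>Basis. (a x \<bullet> i) *\<^sub>R D i h + (a' h \<bullet> i) *\<^sub>R M x i)) (at x)"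
    by (rule has_derivative_transform_within_open[OF 1 assms(1,2)]) (metis linear_expand assms(5))
  moreover have "(\<Sum>i\<in>Basis. (a x \<bullet> i) *\<^sub>R D i h + (a' h \<bullet> i) *\<^sub>R M x i) = D (a x) h + M x (a' h)" for h
    by (simp add: Da sum.distrib linear_expand[OF assms(5)[OF assms(2)], of "a' h"])
  ultimately show ?thesis by (simp add: D_def)
qed

text \<open>Two applications of the linear case: the second slot moves while the first is frozen,
  then the first slot moves. The base point moves along \<open>y\<close>, which contributes the
  first term by the chain rule.\<close>

lemma has_derivative_bilinear_family:
  fixes G :: "'b::real_normed_vector \<Rightarrow> 'e::euclidean_space \<Rightarrow> 'f::euclidean_space \<Rightarrow> 'c::real_normed_vector"
  assumes "open S" "y s \<in> S" "\<And>u v. (\<lambda>x. G x u v) differentiable at (y s)"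
    "(y has_derivative y') (at s)" "(a has_derivative a') (at s)" "(b has_derivative b') (at s)"
    "\<And>x. x \<in> S \<Longrightarrow> bilinear (G x)"
  shows "((\<lambda>t. G (y t) (a t) (b t)) has_derivative
    (\<lambda>h. frechet_derivative (\<lambda>x. G x (a s) (b s)) (at (y s)) (y' h) + G (y s) (a' h) (b s) + G (y s) (a s) (b' h))) (at s)"
proof -
  obtain N where N: "open N" "s \<in> N" "y ` N \<subseteq> S"
    using has_derivative_continuous[OF assms(4)] assms(1,2)
    by (metis (no_types, opaque_lifting) continuous_at_open image_subset_iff)
  have Gc: "((\<lambda>t. G (y t) u v) has_derivative (\<lambda>h. frechet_derivative (\<lambda>x. G x u v) (at (y s)) (y' h))) (at s)" for u v
    using diff_chain_at[OF assms(4) frechet_derivative_works[THEN iffD1, OF assms(3)]] by (simp add: o_def)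
  have Gv: "((\<lambda>t. G (y t) u (b t)) has_derivative
      (\<lambda>h. frechet_derivative (\<lambda>x. G x u (b s)) (at (y s)) (y' h) + G (y s) u (b' h))) (at s)" for u
    using has_derivative_linear_family[OF N(1,2) _ assms(6), of "\<lambda>t v. G (y t) u v"] Gc[of u] N(3) assms(7)
    by (auto simp: differentiable_def bilinear_def frechet_derivative_at[OF Gc, symmetric])
  have Gd: "(\<lambda>t. G (y t) u (b t)) differentiable (at s)" for u
    using Gv by (auto simp: differentiable_def)
  have Gl: "linear (\<lambda>u. G (y t) u (b t))" if "t \<in> N" for t
    using assms(7) that N(3) by (auto simp: bilinear_def)
  have "((\<lambda>t. G (y t) (a t) (b t)) has_derivative
      (\<lambda>h. (frechet_derivative (\<lambda>x. G x (a s) (b s)) (at (y s)) (y' h) + G (y s) (a s) (b' h))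
        + G (y s) (a' h) (b s))) (at s)"
    using has_derivative_linear_family[OF N(1,2) Gd assms(5) Gl]
    unfolding frechet_derivative_at[OF Gv, symmetric] .
  then show ?thesis by (simp add: add_ac)
qed

text \<open>Smooth dependence of the solution of a positive definite linear system on parameters, by
  Gaussian elimination: the Schur complement is again smooth and positive definite.\<close>

lemma Ck_on_solve_gauss:
  fixes G :: "'i \<Rightarrow> 'i \<Rightarrow> 'a::real_normed_vector \<Rightarrow> real"
  assumes "finite I" "open S"
    "\<And>i j. i \<in> I \<Longrightarrow> j \<in> I \<Longrightarrow> Ck_on k S (G i j)"
    "\<And>i. i \<in> I \<Longrightarrow> Ck_on k S (K i)"
    "\<And>i j x. i \<in> I \<Longrightarrow> j \<in> I \<Longrightarrow> x \<in> S \<Longrightarrow> G i j x = G j i x"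
    "\<And>x a. x \<in> S \<Longrightarrow> \<exists>i\<in>I. a i \<noteq> 0 \<Longrightarrow> (\<Sum>i\<in>I. \<Sum>j\<in>I. a i * a j * G i j x) > 0"
    "\<And>x i. x \<in> S \<Longrightarrow> i \<in> I \<Longrightarrow> (\<Sum>j\<in>I. G i j x * y j x) = K i x"
    "i \<in> I"
  shows "Ck_on k S (y i)"
  using assms(1,3-8)
proof (induction I arbitrary: G K i rule: finite_induct)
  case (insert p I)
  note G = insert.prems(1) and K = insert.prems(2) and sym = insert.prems(3)
    and pos = insert.prems(4) and eq = insert.prems(5)
  have piv: "G p p x > 0" if "x \<in> S" for x
  proof -
    \<comment> \<open>The coordinate vector of \<open>p\<close> serves as test vector for the
      positivity of the pivot.\<close>
    have "(\<Sum>i\<in>insert p I. \<Sum>j\<in>insert p I. (if i = p then 1 else 0) * (if j = p then 1 else 0) * G i j x) > 0"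
      by (rule pos[OF that]) auto
    also have "(\<Sum>i\<in>insert p I. \<Sum>j\<in>insert p I. (if i = p then 1 else 0) * (if j = p then 1 else 0) * G i j x) = G p p x"
      using insert.hyps by (simp add: if_distrib[of "\<lambda>t. t * _"] sum.neutral mult_ac cong: if_cong)
    finally show ?thesis .
  qed
  have inv: "Ck_on k S (\<lambda>x. inverse (G p p x))"
    using piv G by (intro Ck_on_inverse assms(2)) (auto simp: less_le)
  \<comment> \<open>Eliminating the unknown \<open>y p\<close> from the equations with index in
    \<open>I\<close> leaves the system with coefficients \<open>G'\<close> and right-hand side
    \<open>K'\<close>.\<close>
  define G' where "G' i j x = G i j x - G i p x * G p j x * inverse (G p p x)" for i j x
  define K' where "K' i x = K i x - G i p x * K p x * inverse (G p p x)" for i x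
  have ck': "Ck_on k S (y i)" if "i \<in> I" for i
  proof (rule insert.IH[of G' K'])
    show "Ck_on k S (G' i j)" if "i \<in> I" "j \<in> I" for i j
      unfolding G'_def using that by (intro Ck_on_diff Ck_on_mult assms(2) inv G) auto
    show "Ck_on k S (K' i)" if "i \<in> I" for i
      unfolding K'_def using that by (intro Ck_on_diff Ck_on_mult assms(2) inv G K) auto
    show "G' i j x = G' j i x" if "i \<in> I" "j \<in> I" "x \<in> S" for i j x
      unfolding G'_def using sym[of i j x] sym[of i p x] sym[of j p x] that by simp
    show "(\<Sum>j\<in>I. G' i j x * y j x) = K' i x" if "x \<in> S" "i \<in> I" for x i
    proof -
      have 1: "(\<Sum>j\<in>I. G i j x * y j x) = K i x - G i p x * y p x"
        using eq[of x i] that insert.hyps by simp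
      have 2: "(\<Sum>j\<in>I. G p j x * y j x) = K p x - G p p x * y p x"
        using eq[of x p] that insert.hyps by simp
      have "(\<Sum>j\<in>I. G' i j x * y j x)
          = (\<Sum>j\<in>I. G i j x * y j x) - G i p x * inverse (G p p x) * (\<Sum>j\<in>I. G p j x * y j x)"
        by (simp add: G'_def sum_subtractf sum_distrib_left algebra_simps)
      then show ?thesis unfolding 1 2 K'_def using piv[OF that(1)] by (simp add: field_simps)
    qed
    show "(\<Sum>i\<in>I. \<Sum>j\<in>I. a i * a j * G' i j x) > 0" if x: "x \<in> S" and a: "\<exists>i\<in>I. a i \<noteq> 0" for x a
    proof -
      define s where "s = (\<Sum>j\<in>I. a j * G p j x)"
      \<comment> \<open>With the other coordinates fixed at those of \<open>a\<close>, this value of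
        coordinate \<open>p\<close> minimises the quadratic form, and the minimum is the form of the
        Schur complement at \<open>a\<close>. Positivity thus passes to \<open>G'\<close>.\<close>
      define b where "b = a(p := - s * inverse (G p p x))"
      have bI: "b i = a i" if "i \<in> I" for i using that insert.hyps by (auto simp: b_def)
      have bp: "b p = - s * inverse (G p p x)" by (simp add: b_def)
      have s': "(\<Sum>i\<in>I. a i * G i p x) = s"
        unfolding s_def using sym[OF _ _ x] by (intro sum.cong) auto
      have e1: "(\<Sum>i\<in>I. a i * (b p * G i p x)) = b p * s"
        by (simp add: s'[symmetric] sum_distrib_left mult_ac)
      have e2: "(\<Sum>i\<in>I. a i * (b p * G p i x)) = b p * s"
        by (simp add: s_def sum_distrib_left mult_ac)
      have "0 < (\<Sum>i\<in>insert p I. \<Sum>j\<in>insert p I. b i * b j * G i j x)"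
        using a bI by (intro pos[OF x]) auto
      also have "\<dots> = b p * b p * G p p x + b p * s + b p * s + (\<Sum>i\<in>I. \<Sum>j\<in>I. a i * a j * G i j x)"
        using insert.hyps
        by (simp add: bI sum.distrib mult_ac e1 e2 cong: sum.cong)
      also have "\<dots> = (\<Sum>i\<in>I. \<Sum>j\<in>I. a i * a j * G i j x) - s * s * inverse (G p p x)"
        unfolding bp using piv[OF x] by (simp add: field_simps)
      also have "s * s * inverse (G p p x) = (\<Sum>i\<in>I. a i * G i p x) * (\<Sum>j\<in>I. a j * G p j x) * inverse (G p p x)"
        by (simp add: s' s_def[symmetric])
      also have "\<dots> = (\<Sum>i\<in>I. \<Sum>j\<in>I. a i * a j * (G i p x * G p j x * inverse (G p p x)))"
        by (simp add: sum_product sum_distrib_right sum_distrib_left mult_ac, subst sum.swap, simp add: mult_ac)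
      finally show ?thesis by (simp add: G'_def right_diff_distrib sum_subtractf)
    qed
  qed (use that in auto)
  have "Ck_on k S (\<lambda>x. (K p x - (\<Sum>j\<in>I. G p j x * y j x)) * inverse (G p p x))"
    by (intro Ck_on_mult Ck_on_diff Ck_on_sum assms(2) inv K G ck') auto
  moreover have "(K p x - (\<Sum>j\<in>I. G p j x * y j x)) * inverse (G p p x) = y p x" if "x \<in> S" for x
    using eq[OF that, of p] insert.hyps piv[OF that] by (simp add: field_simps)
  ultimately have "Ck_on k S (y p)" by (rule Ck_on_cong[OF assms(2)])
  then show ?case using insert.prems(6) ck' by auto
qed simp

lemma bilinear_expand_real:
  fixes B :: "'e::euclidean_space \<Rightarrow> 'f::euclidean_space \<Rightarrow> real"
  assumes "bilinear B"
  shows "B u v = (\<Sum>i\<in>Basis. \<Sum>j\<in>Basis. (u \<bullet> i) * (v \<bullet> j) * B i j)"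
proof -
  have l: "linear (\<lambda>u. B u v)" "linear (B u)" for u v using assms by (auto simp: bilinear_def)
  show ?thesis
    unfolding linear_expand[OF l(1), of u] 
    by (simp add: linear_expand[OF l(2), of _ v] sum_distrib_left mult_ac)
qed

text \<open>Here \<open>y x\<close> is the vector that represents the covector \<open>K x\<close>
  with respect to \<open>G x\<close>. Christoffel symbols and horizontal lifts are both given in
  this way, so their smoothness follows without a formula for an inverse matrix.\<close>

lemma Ck_on_solve:
  fixes G :: "'a::real_normed_vector \<Rightarrow> 'e::euclidean_space \<Rightarrow> 'e \<Rightarrow> real"
  assumes "open S" "\<And>u v. Ck_on k S (\<lambda>x. G x u v)" "\<And>u. Ck_on k S (\<lambda>x. K x u)"
    "\<And>x. x \<in> S \<Longrightarrow> bilinear (G x)" "\<And>x u v. x \<in> S \<Longrightarrow> G x u v = G x v u"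
    "\<And>x u. x \<in> S \<Longrightarrow> u \<noteq> 0 \<Longrightarrow> G x u u > 0"
    "\<And>x v. x \<in> S \<Longrightarrow> G x (y x) v = K x v"
  shows "Ck_on k S y"
proof (rule Ck_on_componentwise[OF assms(1)])
  fix b :: 'e assume b: "b \<in> Basis"
  show "Ck_on k S (\<lambda>x. y x \<bullet> b)"
  proof (rule Ck_on_solve_gauss[where I=Basis and G="\<lambda>i j x. G x i j" and K="\<lambda>i x. K x i" and y="\<lambda>i x. y x \<bullet> i"])
    show "0 < (\<Sum>i\<in>Basis. \<Sum>j\<in>Basis. a i * a j * G x i j)"
      if x: "x \<in> S" and a: "\<exists>i\<in>Basis. a i \<noteq> 0" for x and a :: "'e \<Rightarrow> real"
    proof -
      define u where "u = (\<Sum>i\<in>Basis. a i *\<^sub>R i)"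
      have ui: "u \<bullet> i = a i" if "i \<in> Basis" for i using that by (simp add: u_def)
      then have "u \<noteq> 0" using a by auto
      then show ?thesis
        using assms(6)[OF x, of u] unfolding bilinear_expand_real[OF assms(4)[OF x], of u u]
        by (simp add: ui cong: sum.cong)
    qed
    show "(\<Sum>j\<in>Basis. G x i j * (y x \<bullet> j)) = K x i" if "x \<in> S" "i \<in> Basis" for x i
    proof -
      have "linear (\<lambda>u. G x u i)" using assms(4) that by (auto simp: bilinear_def)
      then have "G x (y x) i = (\<Sum>j\<in>Basis. (y x \<bullet> j) * G x j i)" using linear_expand[of "\<lambda>u. G x u i" "y x"] by simp
      then show ?thesis using assms(5,7) that by (simp add: mult_ac)
    qed
  qed (use assms b in auto)
qed

text \<open>Positivity makes the map from vectors to covectors injective, and in finite dimension it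
  is then onto.\<close>

lemma ex1_riesz:
  fixes B :: "'e::euclidean_space \<Rightarrow> 'e \<Rightarrow> real"
  assumes B: "bilinear B" and pos: "\<And>u. u \<noteq> 0 \<Longrightarrow> B u u > 0" and K: "linear K"
  shows "\<exists>!y. \<forall>w. B y w = K w"
proof -
  have l: "linear (\<lambda>u. B u v)" "linear (B u)" for u v using B by (auto simp: bilinear_def)
  define A where "A u = (\<Sum>b\<in>Basis. B u b *\<^sub>R b)" for u
  have A: "linear A"
    by (rule linearI) (simp_all add: A_def linear_add[OF l(1)] linear_scale[OF l(1)] scaleR_left.sum
        scaleR_add_left sum.distrib scaleR_sum_right)
  have inn: "A u \<bullet> w = B u w" for u w
    unfolding linear_expand[OF l(2), of u w] by (simp add: A_def inner_sum_left inner_commute[of w] mult.commute)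
  have "inj A"
    unfolding linear_injective_0[OF A] using inn pos by (metis inner_zero_left less_irrefl)
  then have surj: "surj A" using A linear_injective_imp_surjective by blast
  obtain y where y: "A y = (\<Sum>b\<in>Basis. K b *\<^sub>R b)" using surj by (metis surj_def)
  have "B y w = K w" for w
    unfolding inn[symmetric] y linear_expand[OF K, of w] by (simp add: inner_sum_left inner_commute[of w] mult.commute)
  moreover have "z = y" if "\<forall>w. B z w = K w" for z
    using that calculation \<open>inj A\<close> by (simp add: A_def inj_def)
  ultimately show ?thesis by blast
qed

section \<open>Symmetry of second derivatives\<close>

text \<open>Mean value theorem twice: for the increment in direction \<open>v\<close> as a function
  of the displacement along \<open>u\<close>, then for the resulting derivative as a function of the
  displacement along \<open>v\<close>.\<close>

lemma second_difference:
  fixes f :: "'a::real_normed_vector \<Rightarrow> real"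
  assumes "Ck_on (Suc (Suc 0)) S f" "t > 0"
    "\<And>a b. 0 \<le> a \<Longrightarrow> a \<le> t \<Longrightarrow> 0 \<le> b \<Longrightarrow> b \<le> t \<Longrightarrow> x + a *\<^sub>R u + b *\<^sub>R v \<in> S"
  shows "\<exists>a b. 0 \<le> a \<and> a \<le> t \<and> 0 \<le> b \<and> b \<le> t \<and>
    f (x + t *\<^sub>R u + t *\<^sub>R v) - f (x + t *\<^sub>R u) - f (x + t *\<^sub>R v) + f x =
      t * t * frechet_derivative (\<lambda>y. frechet_derivative f (at y) u) (at (x + a *\<^sub>R u + b *\<^sub>R v)) v"
proof -
  define D where "D y = frechet_derivative f (at y)" for y
  define DD where "DD y = frechet_derivative (\<lambda>y. D y u) (at y)" for y
  have D: "(f has_derivative D y) (at y)" if "y \<in> S" for y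
    using Ck_on_Suc_has_derivative[OF assms(1) that] by (simp add: D_def)
  have "Ck_on (Suc 0) S (\<lambda>y. D y u)"
    using assms(1) unfolding D_def Ck_on.simps(2)[of "Suc 0" S f] by blast
  then have DD: "((\<lambda>y. D y u) has_derivative DD y) (at y)" if "y \<in> S" for y
    unfolding DD_def by (rule Ck_on_Suc_has_derivative[OF _ that])
  have D': "((\<lambda>s. f (x + s *\<^sub>R u + c *\<^sub>R v)) has_real_derivative D (x + a *\<^sub>R u + c *\<^sub>R v) u) (at a)"
    if "0 \<le> a" "a \<le> t" "0 \<le> c" "c \<le> t" for a c
  proof -
    have g: "((\<lambda>s. x + s *\<^sub>R u + c *\<^sub>R v) has_derivative (\<lambda>h. h *\<^sub>R u)) (at a)"
      by (auto intro!: derivative_eq_intros)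
    from diff_chain_at[OF g D[OF assms(3)[OF that]]]
    show ?thesis
      using linear_scale[OF has_derivative_linear[OF D[OF assms(3)[OF that]]]]
      by (simp add: o_def has_field_derivative_def mult_commute_abs)
  qed
  have DD': "((\<lambda>s. D (x + a *\<^sub>R u + s *\<^sub>R v) u) has_real_derivative DD (x + a *\<^sub>R u + c *\<^sub>R v) v) (at c)"
    if "0 \<le> a" "a \<le> t" "0 \<le> c" "c \<le> t" for a c
  proof -
    have g: "((\<lambda>s. x + a *\<^sub>R u + s *\<^sub>R v) has_derivative (\<lambda>h. h *\<^sub>R v)) (at c)"
      by (auto intro!: derivative_eq_intros)
    from diff_chain_at[OF g DD[OF assms(3)[OF that]]]
    show ?thesis
      using linear_scale[OF has_derivative_linear[OF DD[OF assms(3)[OF that]]]]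
      by (simp add: o_def has_field_derivative_def mult_commute_abs)
  qed
  have "\<exists>a>0. a < t \<and> (f (x + t *\<^sub>R u + t *\<^sub>R v) - f (x + t *\<^sub>R u + 0 *\<^sub>R v)) - (f (x + 0 *\<^sub>R u + t *\<^sub>R v) - f (x + 0 *\<^sub>R u + 0 *\<^sub>R v))
      = (t - 0) * (D (x + a *\<^sub>R u + t *\<^sub>R v) u - D (x + a *\<^sub>R u + 0 *\<^sub>R v) u)"
    using assms(2) by (intro MVT2 DERIV_diff D') auto
  then obtain a where a: "a > 0" "a < t"
      "(f (x + t *\<^sub>R u + t *\<^sub>R v) - f (x + t *\<^sub>R u + 0 *\<^sub>R v)) - (f (x + 0 *\<^sub>R u + t *\<^sub>R v) - f (x + 0 *\<^sub>R u + 0 *\<^sub>R v))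
      = (t - 0) * (D (x + a *\<^sub>R u + t *\<^sub>R v) u - D (x + a *\<^sub>R u + 0 *\<^sub>R v) u)" by blast
  have "\<exists>b>0. b < t \<and> D (x + a *\<^sub>R u + t *\<^sub>R v) u - D (x + a *\<^sub>R u + 0 *\<^sub>R v) u = (t - 0) * DD (x + a *\<^sub>R u + b *\<^sub>R v) v"
    using assms(2) a by (intro MVT2 DD') auto
  then obtain b where "b > 0" "b < t" "D (x + a *\<^sub>R u + t *\<^sub>R v) u - D (x + a *\<^sub>R u + 0 *\<^sub>R v) u = (t - 0) * DD (x + a *\<^sub>R u + b *\<^sub>R v) v"
    by blast
  with a show ?thesis unfolding DD_def D_def
    by (intro exI[of _ a] exI[of _ b]) (simp add: algebra_simps)
qed

text \<open>The second difference is symmetric in \<open>u\<close> and \<open>v\<close>. Divided by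
  \<open>t * t\<close> it is a value of either mixed derivative at a point near \<open>x\<close>,
  and continuity of both forces them to agree at \<open>x\<close>.\<close>

lemma second_derivative_symmetric_real:
  fixes f :: "'a::real_normed_vector \<Rightarrow> real"
  assumes "open S" "x \<in> S" "Ck_on (Suc (Suc 0)) S f"
  shows "frechet_derivative (\<lambda>y. frechet_derivative f (at y) u) (at x) v
    = frechet_derivative (\<lambda>y. frechet_derivative f (at y) v) (at x) u"
proof (rule ccontr)
  define DD where "DD u v y = frechet_derivative (\<lambda>y. frechet_derivative f (at y) u) (at y) v" for u v y
  assume "\<not> ?thesis"
  then have ne: "DD u v x \<noteq> DD v u x" by (simp add: DD_def)
  \<comment> \<open>Half the supposed gap, so that values within \<open>e\<close> of the two mixed
    derivatives cannot coincide.\<close>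
  define e where "e = dist (DD u v x) (DD v u x) / 2"
  have e: "e > 0" using ne by (simp add: e_def)
  have cont: "continuous (at x) (DD u v)" for u v
  proof -
    have "continuous_on S (DD u v)" using assms(3) by (simp add: DD_def[abs_def])
    then show ?thesis using assms(1,2) continuous_on_eq_continuous_at by blast
  qed
  obtain d1 where d1: "d1 > 0" "\<And>y. dist y x < d1 \<Longrightarrow> dist (DD u v y) (DD u v x) < e"
    using cont[of u v] e unfolding continuous_at_eps_delta by blast
  obtain d2 where d2: "d2 > 0" "\<And>y. dist y x < d2 \<Longrightarrow> dist (DD v u y) (DD v u x) < e"
    using cont[of v u] e unfolding continuous_at_eps_delta by blast
  obtain d3 where d3: "d3 > 0" "ball x d3 \<subseteq> S" using assms(1,2) open_contains_ball by blast
  define d where "d = min d1 (min d2 d3)"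
  have d: "d > 0" using d1 d2 d3 by (simp add: d_def)
  \<comment> \<open>Small enough that the whole parallelogram with sides \<open>t\<close> times the
    vectors lies within \<open>d\<close> of \<open>x\<close>; the summand \<open>1\<close> covers
    the case that both vectors are zero.\<close>
  define t where "t = d / (2 * (1 + norm u + norm v))"
  have n: "1 + norm u + norm v > 0" by (smt (verit) norm_ge_zero)
  have t: "t > 0" using d n unfolding t_def by simp
  have near: "dist (x + a *\<^sub>R p + b *\<^sub>R q) x < d"
    if "0 \<le> a" "a \<le> t" "0 \<le> b" "b \<le> t" "norm p + norm q = norm u + norm v" for a b and p q :: 'a
  proof -
    have "dist (x + a *\<^sub>R p + b *\<^sub>R q) x \<le> norm (a *\<^sub>R p) + norm (b *\<^sub>R q)"
      using norm_triangle_ineq[of "a *\<^sub>R p" "b *\<^sub>R q"] by (simp add: dist_norm add.assoc)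
    also have "\<dots> \<le> t * norm p + t * norm q"
      using that by (intro add_mono) (auto intro: mult_right_mono)
    also have "\<dots> = t * (norm u + norm v)" using that(5) by (metis distrib_left)
    also have "\<dots> < t * (2 * (1 + norm u + norm v))"
      using t n by (intro mult_strict_left_mono) auto
    also have "\<dots> = d" using n by (simp add: t_def)
    finally show ?thesis .
  qed
  have inS: "x + a *\<^sub>R p + b *\<^sub>R q \<in> S"
    if "0 \<le> a" "a \<le> t" "0 \<le> b" "b \<le> t" "norm p + norm q = norm u + norm v" for a b and p q :: 'a
    using near[OF that] d3(2) by (auto simp: d_def dist_commute)
  obtain a b where ab: "0 \<le> a" "a \<le> t" "0 \<le> b" "b \<le> t"
      "f (x + t *\<^sub>R u + t *\<^sub>R v) - f (x + t *\<^sub>R u) - f (x + t *\<^sub>R v) + f x = t * t * DD u v (x + a *\<^sub>R u + b *\<^sub>R v)"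
    using second_difference[OF assms(3) t, of x u v] inS unfolding DD_def by blast
  obtain a' b' where ab': "0 \<le> a'" "a' \<le> t" "0 \<le> b'" "b' \<le> t"
      "f (x + t *\<^sub>R v + t *\<^sub>R u) - f (x + t *\<^sub>R v) - f (x + t *\<^sub>R u) + f x = t * t * DD v u (x + a' *\<^sub>R v + b' *\<^sub>R u)"
    using second_difference[OF assms(3) t, of x v u] inS[of _ _ v u] unfolding DD_def by (auto simp: add.commute)
  have swap: "x + t *\<^sub>R v + t *\<^sub>R u = x + t *\<^sub>R u + t *\<^sub>R v" by simp
  from ab(5) ab'(5)[unfolded swap] have "t * t * DD u v (x + a *\<^sub>R u + b *\<^sub>R v) = t * t * DD v u (x + a' *\<^sub>R v + b' *\<^sub>R u)"
    by linarith
  then have "DD u v (x + a *\<^sub>R u + b *\<^sub>R v) = DD v u (x + a' *\<^sub>R v + b' *\<^sub>R u)" using t by simp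
  moreover have "dist (DD u v (x + a *\<^sub>R u + b *\<^sub>R v)) (DD u v x) < e"
    using near[OF ab(1-4)] by (intro d1) (simp add: d_def)
  moreover have "dist (DD v u (x + a' *\<^sub>R v + b' *\<^sub>R u)) (DD v u x) < e"
    using near[OF ab'(1-4), of v u] by (intro d2) (simp add: d_def)
  ultimately show False unfolding e_def by (metis dist_triangle_half_r less_irrefl)
qed

lemma frechet_derivative_inner_left:
  assumes "f differentiable at x"
  shows "frechet_derivative (\<lambda>y. f y \<bullet> i) (at x) u = frechet_derivative f (at x) u \<bullet> i"
proof -
  have "((\<lambda>y. f y \<bullet> i) has_derivative (\<lambda>h. frechet_derivative f (at x) h \<bullet> i)) (at x)"
    using assms frechet_derivative_works by (intro has_derivative_inner_left) blast
  then show ?thesis by (metis frechet_derivative_at)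
qed

lemma second_derivative_symmetric:
  fixes f :: "'a::real_normed_vector \<Rightarrow> 'b::euclidean_space"
  assumes "open S" "x \<in> S" "Ck_on (Suc (Suc 0)) S f"
  shows "frechet_derivative (\<lambda>y. frechet_derivative f (at y) u) (at x) v
    = frechet_derivative (\<lambda>y. frechet_derivative f (at y) v) (at x) u"
proof (rule euclidean_eqI)
  fix i :: 'b
  have c: "Ck_on (Suc (Suc 0)) S (\<lambda>x. f x \<bullet> i)" by (intro Ck_on_inner_right assms)
  have D: "frechet_derivative (\<lambda>y. f y \<bullet> i) (at y) u = frechet_derivative f (at y) u \<bullet> i" if "y \<in> S" for y u
    using assms that by (intro frechet_derivative_inner_left) auto
  have dif: "(\<lambda>y. frechet_derivative f (at y) u) differentiable at x" for u
    using assms by auto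
  have "frechet_derivative (\<lambda>y. frechet_derivative (\<lambda>y. f y \<bullet> i) (at y) u) (at x) v
      = frechet_derivative (\<lambda>y. frechet_derivative f (at y) u) (at x) v \<bullet> i" for u v
  proof -
    have "frechet_derivative (\<lambda>y. frechet_derivative f (at y) u \<bullet> i) (at x)
        = frechet_derivative (\<lambda>y. frechet_derivative (\<lambda>y. f y \<bullet> i) (at y) u) (at x)"
      using assms(2) D differentiable_inner[OF dif[of u] differentiable_const, of i]
      by (intro frechet_derivative_transform_within_open[OF _ assms(1,2)]) auto
    then show ?thesis using frechet_derivative_inner_left[OF dif[of u], of i v] by simp
  qed
  then show "frechet_derivative (\<lambda>y. frechet_derivative f (at y) u) (at x) v \<bullet> i
    = frechet_derivative (\<lambda>y. frechet_derivative f (at y) v) (at x) u \<bullet> i"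
    using second_derivative_symmetric_real[OF assms(1,2) c, of u v] by metis
qed

section \<open>A smooth bump function\<close>

text \<open>The case \<open>n = 0\<close> is the usual flat function. The powers of \<open>t\<close>
  in the denominator are included because differentiation then stays within linear combinations of
  the family.\<close>

definition flat_exp :: "nat \<Rightarrow> real \<Rightarrow> real" where
  "flat_exp n t = (if t \<le> 0 then 0 else exp (- 1 / t) / t ^ n)"

text \<open>In the variable \<open>inverse t\<close> this is the domination of every power by the
  exponential.\<close>

lemma flat_exp_tendsto_0: "(flat_exp n \<longlongrightarrow> 0) (at_right 0)"
proof -
  have "((\<lambda>t. inverse t ^ n / exp (inverse t)) \<longlongrightarrow> 0) (at_right (0::real))"
    by (rule filterlim_compose[OF tendsto_power_div_exp_0 filterlim_inverse_at_top_right])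
  moreover have "\<forall>\<^sub>F t in at_right 0. inverse t ^ n / exp (inverse t) = flat_exp n t"
    unfolding eventually_at_right_field
    by (intro exI[of _ 1]) (auto simp: flat_exp_def field_simps exp_minus)
  ultimately show ?thesis by (rule Lim_transform_eventually)
qed

lemma DERIV_flat_exp:
  "(flat_exp n has_real_derivative flat_exp (n + 2) t - n * flat_exp (n + 1) t) (at t)"
proof (cases "t = 0")
  case True
  \<comment> \<open>On the right the difference quotient at \<open>0\<close> is
    \<open>flat_exp (Suc n)\<close>, so it tends to \<open>0\<close>; on the left it vanishes
    identically.\<close>
  have "((\<lambda>h. (flat_exp n (0 + h) - flat_exp n 0) / h) \<longlongrightarrow> 0) (at_right 0)"
    by (rule Lim_transform_eventually[OF flat_exp_tendsto_0[of "Suc n"]], unfold eventually_at_right_field)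
      (intro exI[of _ 1], auto simp: flat_exp_def field_simps)
  moreover have "((\<lambda>h. (flat_exp n (0 + h) - flat_exp n 0) / h) \<longlongrightarrow> 0) (at_left 0)"
    by (rule Lim_transform_eventually[OF tendsto_const], unfold eventually_at_left_field)
      (intro exI[of _ "-1"], auto simp: flat_exp_def)
  ultimately show ?thesis using True
    by (simp add: DERIV_def filterlim_split_at flat_exp_def)
next
  case False
  show ?thesis
  proof (cases "t < 0")
    case True
    have "((\<lambda>_. 0) has_real_derivative flat_exp (n + 2) t - n * flat_exp (n + 1) t) (at t)"
      using True by (simp add: flat_exp_def)
    then show ?thesis
      by (rule has_field_derivative_transform_within_open[of _ _ _ "{..<0}"]) (use True in \<open>auto simp: flat_exp_def\<close>)
  next
    case f: False
    then have t: "t > 0" using False by simp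
    have "((\<lambda>t. exp (- 1 / t) / t ^ n) has_real_derivative flat_exp (n + 2) t - n * flat_exp (n + 1) t) (at t)"
      using t by (cases n) (auto intro!: derivative_eq_intros simp: flat_exp_def field_simps power2_eq_square, metis One_nat_def power_eq_if)
    then show ?thesis
      by (rule has_field_derivative_transform_within_open[of _ _ _ "{0<..}"]) (use t in \<open>auto simp: flat_exp_def\<close>)
  qed
qed

lemma Ck_on_flat_exp: "Ck_on k UNIV (flat_exp n)"
proof (induction k arbitrary: n)
  case 0
  then show ?case by (auto intro!: continuous_at_imp_continuous_on DERIV_isCont DERIV_flat_exp)
next
  case (Suc k)
  show ?case
  proof (rule Ck_on_SucI)
    show "(flat_exp n has_derivative (\<lambda>v. (flat_exp (n + 2) t - n * flat_exp (n + 1) t) * v)) (at t)" for t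
      using DERIV_flat_exp[of n t] by (simp add: has_field_derivative_def)
    show "Ck_on k UNIV (\<lambda>t. (flat_exp (n + 2) t - n * flat_exp (n + 1) t) * v)" for v
      by (intro Ck_on_mult Ck_on_diff Ck_on_const Suc) auto
  qed auto
qed

lemma smooth_bump:
  fixes x0 :: "'e::euclidean_space"
  assumes "r > 0"
  obtains \<beta> :: "'e \<Rightarrow> real" where "smooth_on UNIV \<beta>" "\<beta> x0 > 0" "\<And>x. x \<notin> cball x0 r \<Longrightarrow> \<beta> x = 0"
proof
  \<comment> \<open>The squared distance is a polynomial, hence smooth also at the centre.\<close>
  define \<beta> where "\<beta> x = flat_exp 0 (r\<^sup>2 - (x - x0) \<bullet> (x - x0))" for x :: 'e
  have "Ck_on k UNIV (\<lambda>x. r\<^sup>2 - (x - x0) \<bullet> (x - x0))" for k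
    by (intro Ck_on_diff Ck_on_const bounded_bilinear.Ck_on[OF bounded_bilinear_inner]
        Ck_on_bounded_linear bounded_linear_ident) auto
  then show "smooth_on UNIV \<beta>"
    unfolding smooth_on_def \<beta>_def
    by (intro allI Ck_on_compose[OF open_UNIV open_UNIV _ _ Ck_on_flat_exp]) auto
  show "\<beta> x0 > 0" using assms by (simp add: \<beta>_def flat_exp_def)
  show "\<beta> x = 0" if "x \<notin> cball x0 r" for x
  proof -
    have "r \<le> norm (x - x0)" using that by (simp add: dist_norm norm_minus_commute)
    then have "r\<^sup>2 \<le> (norm (x - x0))\<^sup>2" using assms by (intro power_mono) auto
    then show ?thesis by (simp add: \<beta>_def flat_exp_def power2_norm_eq_inner)
  qed
qed

section \<open>Ordinary differential equations\<close>

text \<open>Picard iteration is a contraction of the Banach space of bounded continuous maps on the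
  whole line. The global Lipschitz bound removes any care for the domain of \<open>X\<close>, and
  clamping the time by \<open>c\<close> extends all functions from the interval to the line.\<close>

lemma picard_lipschitz:
  fixes X :: "'a::banach \<Rightarrow> 'a"
  assumes L: "\<And>x y. dist (X x) (X y) \<le> L * dist x y" "L \<ge> 0" "\<epsilon> > 0" "8 * \<epsilon> * L \<le> 1"
  shows "\<exists>z. z 0 = z0 \<and>
    (\<forall>s\<in>{-\<epsilon>..\<epsilon>}. (z has_vector_derivative X (z s)) (at s within {-\<epsilon>..\<epsilon>}))"
proof -
  have Xc: "continuous_on UNIV X"
    using lipschitz_on_continuous_on[of L UNIV X] L by (auto simp: lipschitz_on_def)
  define c where "c s = max (- \<epsilon>) (min \<epsilon> s)" for s :: real
  have c: "c s \<in> {-\<epsilon>..\<epsilon>}" for s using L(3) by (auto simp: c_def)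
  have cid: "c s = s" if "s \<in> {-\<epsilon>..\<epsilon>}" for s using that by (auto simp: c_def)
  have cc: "continuous_on UNIV c" unfolding c_def by (intro continuous_intros)
  \<comment> \<open>The integral starts at the left end of the interval, so that no signed integrals
    arise; the initial condition at time \<open>0\<close> is restored in \<open>T\<close> by
    subtracting \<open>J u 0\<close>.\<close>
  define J where "J u t = integral {-\<epsilon>..t} (\<lambda>s. X (apply_bcontfun u s))" for u :: "real \<Rightarrow>\<^sub>C 'a" and t
  have Xu: "continuous_on S (\<lambda>s. X (apply_bcontfun u s))" for u :: "real \<Rightarrow>\<^sub>C 'a" and S
    by (rule continuous_on_compose2[OF Xc]) (auto intro: continuous_on_subset)
  have J': "((\<lambda>t. J u t) has_vector_derivative X (u s)) (at s within {-\<epsilon>..\<epsilon>})" if "s \<in> {-\<epsilon>..\<epsilon>}" for u s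
    unfolding J_def by (rule integral_has_vector_derivative[OF Xu that])
  have Jc: "continuous_on {-\<epsilon>..\<epsilon>} (J u)" for u
    using J' has_vector_derivative_continuous continuous_on_eq_continuous_within by blast
  define T where "T u = (\<lambda>s. z0 + J u (c s) - J u 0)" for u
  have T: "T u \<in> bcontfun" for u
  proof -
    have "continuous_on UNIV (\<lambda>s. J u (c s))"
      by (rule continuous_on_compose2[OF Jc cc]) (use c in auto)
    then have 1: "continuous_on UNIV (T u)" unfolding T_def by (intro continuous_intros)
    have "compact ((\<lambda>t. z0 + J u t - J u 0) ` {-\<epsilon>..\<epsilon>})"
      by (intro compact_continuous_image continuous_intros Jc) auto
    moreover have "range (T u) \<subseteq> (\<lambda>t. z0 + J u t - J u 0) ` {-\<epsilon>..\<epsilon>}" using c by (auto simp: T_def)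
    ultimately have "bounded (range (T u))" using bounded_subset compact_imp_bounded by blast
    with 1 show ?thesis by (simp add: bcontfun_def)
  qed
  have ap: "apply_bcontfun (Bcontfun (T u)) = T u" for u using T Bcontfun_inverse by blast
  have Jdiff: "norm (J u t - J v t) \<le> (L * dist u v) * (2 * \<epsilon>)" if t: "t \<in> {-\<epsilon>..\<epsilon>}" for u v t
  proof -
    have "J u t - J v t = integral {-\<epsilon>..t} (\<lambda>s. X (u s) - X (v s))"
      unfolding J_def by (rule integral_diff[symmetric]; intro integrable_continuous_real Xu)
    also have "norm \<dots> \<le> (L * dist u v) * (t - (-\<epsilon>))"
    proof (rule integral_bound)
      show "continuous_on {-\<epsilon>..t} (\<lambda>s. X (u s) - X (v s))" by (intro continuous_intros Xu)
      show "norm (X (u s) - X (v s)) \<le> L * dist u v" for s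
        using L(1)[of "u s" "v s"] mult_left_mono[OF dist_bounded[of u s v] L(2)] by (simp add: dist_norm)
    qed (use t in auto)
    also have "\<dots> \<le> (L * dist u v) * (2 * \<epsilon>)" using t L(2) by (intro mult_left_mono) auto
    finally show ?thesis .
  qed
  \<comment> \<open>Two integrals over intervals of length at most \<open>2 * \<epsilon>\<close>
    give the factor \<open>4 * \<epsilon> * L\<close>, at most one half by the choice of
    \<open>\<epsilon>\<close>.\<close>
  have "\<exists>!u. Bcontfun (T u) = u"
  proof (rule banach_fix_type[of "1/2"])
    show "\<forall>u v. dist (Bcontfun (T u)) (Bcontfun (T v)) \<le> 1/2 * dist u v"
    proof (intro allI dist_bound)
      fix u v s
      have "dist (T u s) (T v s) = norm ((J u (c s) - J v (c s)) - (J u 0 - J v 0))"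
        by (simp add: T_def dist_norm algebra_simps)
      also have "\<dots> \<le> norm (J u (c s) - J v (c s)) + norm (J u 0 - J v 0)" by (rule norm_triangle_ineq4)
      also have "\<dots> \<le> (L * dist u v) * (2 * \<epsilon>) + (L * dist u v) * (2 * \<epsilon>)"
        using c L(3) by (intro add_mono Jdiff) auto
      also have "\<dots> = (8 * \<epsilon> * L) * (dist u v / 2)" by simp
      also have "\<dots> \<le> 1 * (dist u v / 2)" using L(4) by (intro mult_right_mono) auto
      finally show "dist (apply_bcontfun (Bcontfun (T u)) s) (apply_bcontfun (Bcontfun (T v)) s) \<le> 1/2 * dist u v"
        by (simp add: ap)
    qed
  qed auto
  then obtain u where "Bcontfun (T u) = u" by blast
  then have u: "apply_bcontfun u s = T u s" for s using ap by metis
  show ?thesis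
  proof (intro exI[of _ "apply_bcontfun u"] conjI ballI)
    show "u 0 = z0" unfolding u T_def using L(3) cid[of 0] by simp
    fix s assume s: "s \<in> {-\<epsilon>..\<epsilon>}"
    have "((\<lambda>t. z0 + J u t - J u 0) has_vector_derivative X (u s)) (at s within {-\<epsilon>..\<epsilon>})"
      using J'[OF s] by (auto intro!: derivative_eq_intros)
    then show "(apply_bcontfun u has_vector_derivative X (u s)) (at s within {-\<epsilon>..\<epsilon>})"
      by (rule has_vector_derivative_transform[OF s, rotated]) (auto simp: u T_def cid)
  qed
qed

lemma onorm_le_sum_Basis:
  fixes f :: "'a::euclidean_space \<Rightarrow> 'b::real_normed_vector"
  assumes "linear f"
  shows "onorm f \<le> (\<Sum>b\<in>Basis. norm (f b))"
proof (rule onorm_le)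
  fix x
  have "norm (f x) \<le> (\<Sum>b\<in>Basis. norm ((x \<bullet> b) *\<^sub>R f b))"
    unfolding linear_expand[OF assms, of x] by (rule norm_sum)
  also have "\<dots> \<le> (\<Sum>b\<in>Basis. norm (f b) * norm x)"
    by (intro sum_mono) (auto simp: mult.commute[of "norm (f _)"] intro!: mult_right_mono Basis_le_norm)
  finally show "norm (f x) \<le> (\<Sum>b\<in>Basis. norm (f b)) * norm x" by (simp add: sum_distrib_right)
qed

text \<open>On a closed ball \<open>X\<close> is bounded and Lipschitz. Composing it with the
  nearest-point projection makes it globally Lipschitz without changing it on the ball, and for a
  short time the solution cannot leave the ball, so it solves the original equation.\<close>

lemma ode_local_solution:
  fixes X :: "'a::euclidean_space \<Rightarrow> 'a"
  assumes "open S" "z0 \<in> S" "Ck_on (Suc 0) S X"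
  shows "\<exists>\<epsilon>>0. \<exists>z. z 0 = z0 \<and>
    (\<forall>s\<in>{-\<epsilon><..<\<epsilon>}. z s \<in> S \<and> (z has_vector_derivative X (z s)) (at s))"
proof -
  obtain r where r: "r > 0" "cball z0 r \<subseteq> S" using assms(1,2) open_contains_cball by blast
  define C where "C = cball z0 r"
  have C: "convex C" "closed C" "C \<noteq> {}" "compact C" using r(1) by (auto simp: C_def)
  define D where "D y = frechet_derivative X (at y)" for y
  have D: "(X has_derivative D y) (at y)" if "y \<in> C" for y
    using Ck_on_Suc_has_derivative[OF assms(3)] that r(2) by (auto simp: D_def C_def)
  have "\<exists>B. \<forall>y\<in>C. norm (D y b) \<le> B" for b
  proof -
    have "continuous_on C (\<lambda>y. D y b)"
      using assms(3) r(2) by (auto simp: D_def C_def intro: continuous_on_subset)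
    then have "bounded ((\<lambda>y. D y b) ` C)" using C(4) compact_continuous_image compact_imp_bounded by blast
    then show ?thesis by (auto simp: bounded_iff)
  qed
  then obtain B where B: "\<And>b y. y \<in> C \<Longrightarrow> norm (D y b) \<le> B b" by metis
  define L where "L = (\<Sum>b\<in>Basis. B b)"
  have on: "onorm (D y) \<le> L" if "y \<in> C" for y
    using onorm_le_sum_Basis[OF has_derivative_linear[OF D[OF that]]] sum_mono[of Basis "\<lambda>b. norm (D y b)" B] B[OF that]
    unfolding L_def by force
  have "z0 \<in> C" using r(1) by (simp add: C_def)
  have L0: "L \<ge> 0"
    using on[OF \<open>z0 \<in> C\<close>] onorm_pos_le[OF has_derivative_bounded_linear[OF D[OF \<open>z0 \<in> C\<close>]]] by linarith
  have Lip: "norm (X x - X y) \<le> L * norm (x - y)" if "x \<in> C" "y \<in> C" for x y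
    by (rule differentiable_bound[OF C(1) _ on that]) (auto intro: has_derivative_at_withinI D)
  define Y where "Y x = X (closest_point C x)" for x
  have clC: "closest_point C x \<in> C" for x using C closest_point_in_set by blast
  have YL: "dist (Y x) (Y y) \<le> L * dist x y" for x y
  proof -
    have "dist (Y x) (Y y) \<le> L * dist (closest_point C x) (closest_point C y)"
      using Lip[OF clC clC] by (simp add: Y_def dist_norm)
    also have "\<dots> \<le> L * dist x y" using closest_point_lipschitz[OF C(1-3)] L0 by (intro mult_left_mono)
    finally show ?thesis .
  qed
  have "continuous_on C X"
    using D by (auto intro!: continuous_at_imp_continuous_on has_derivative_continuous)
  then have "bounded (X ` C)" using C(4) compact_continuous_image compact_imp_bounded by blast
  then obtain M where M: "M > 0" "\<And>y. y \<in> C \<Longrightarrow> norm (X y) \<le> M" by (auto simp: bounded_pos)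
  \<comment> \<open>At speed at most \<open>M\<close> the ball is not left before time
    \<open>r / M\<close>; the other bound serves the contraction, with \<open>L + 1\<close> because
    \<open>L\<close> may be \<open>0\<close>.\<close>
  define \<epsilon> where "\<epsilon> = min (r / M) (1 / (8 * (L + 1)))"
  have e: "\<epsilon> > 0" "\<epsilon> * M \<le> r" "8 * \<epsilon> * L \<le> 1"
  proof -
    show "\<epsilon> > 0" using r(1) M(1) L0 by (simp add: \<epsilon>_def)
    have "\<epsilon> * M \<le> r / M * M" using M(1) by (intro mult_right_mono) (auto simp: \<epsilon>_def)
    then show "\<epsilon> * M \<le> r" using M(1) by simp
    have "\<epsilon> * (8 * (L + 1)) \<le> 1 / (8 * (L + 1)) * (8 * (L + 1))" using L0 by (intro mult_right_mono) (auto simp: \<epsilon>_def)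
    then have "\<epsilon> * (8 * (L + 1)) \<le> 1" using L0 by simp
    then show "8 * \<epsilon> * L \<le> 1" using \<open>\<epsilon> > 0\<close> by (simp add: algebra_simps)
  qed
  obtain z where z: "z 0 = z0" "\<And>s. s \<in> {-\<epsilon>..\<epsilon>} \<Longrightarrow> (z has_vector_derivative Y (z s)) (at s within {-\<epsilon>..\<epsilon>})"
    using picard_lipschitz[OF YL L0 e(1,3), of z0] by blast
  have zC: "z s \<in> C" if s: "s \<in> {-\<epsilon>..\<epsilon>}" for s
  proof -
    have "norm (z s - z 0) \<le> M * norm (s - 0)"
    proof (rule differentiable_bound[of "{-\<epsilon>..\<epsilon>}"])
      show "(z has_derivative (\<lambda>h. h *\<^sub>R Y (z t))) (at t within {-\<epsilon>..\<epsilon>})" if "t \<in> {-\<epsilon>..\<epsilon>}" for t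
        using z(2)[OF that] by (simp add: has_vector_derivative_def)
      show "onorm (\<lambda>h. h *\<^sub>R Y (z t)) \<le> M" for t
        using mult_right_mono[OF M(2)[OF clC[of "z t"]] abs_ge_zero]
        by (intro onorm_le) (simp add: Y_def mult.commute)
    qed (use s e(1) in auto)
    also have "\<dots> \<le> M * \<epsilon>" using s M(1) by (intro mult_left_mono) auto
    finally show ?thesis using e(2) z(1) by (simp add: C_def dist_norm norm_minus_commute mult.commute)
  qed
  show ?thesis
  proof (intro exI[of _ \<epsilon>] conjI e(1) exI[of _ z] z(1) ballI)
    fix s assume s: "s \<in> {-\<epsilon><..<\<epsilon>}"
    show "z s \<in> S" using zC[of s] s r(2) by (auto simp: C_def)
    have "Y (z s) = X (z s)" using closest_point_self[OF zC[of s]] s by (simp add: Y_def)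
    moreover have "(z has_vector_derivative Y (z s)) (at s within {-\<epsilon><..<\<epsilon>})"
      by (rule has_vector_derivative_within_subset[OF z(2)]) (use s in auto)
    ultimately show "(z has_vector_derivative X (z s)) (at s)"
      using s by (metis has_vector_derivative_within_open open_greaterThanLessThan)
  qed
qed

text \<open>Bootstrapping: a solution of class \<open>k\<close> makes \<open>X (z s)\<close>, the
  derivative of \<open>z\<close>, of class \<open>k\<close> as well.\<close>

lemma ode_solution_smooth:
  fixes X :: "'a::euclidean_space \<Rightarrow> 'a"
  assumes "open I" "open S" "smooth_on S X"
    "\<And>s. s \<in> I \<Longrightarrow> z s \<in> S \<and> (z has_vector_derivative X (z s)) (at s)"
  shows "smooth_on I z"
proof -
  have "Ck_on k I z" for k
  proof (induction k)
    case 0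
    then show ?case using assms(4)
      by (auto intro!: continuous_at_imp_continuous_on has_vector_derivative_continuous)
  next
    case (Suc k)
    have "Ck_on k I (\<lambda>s. X (z s))"
      using assms by (intro Ck_on_compose[OF assms(1,2) _ Suc]) (auto simp: smooth_on_def)
    then show ?case
      using assms(1,4) by (intro Ck_on_SucI[where D="\<lambda>s h. h *\<^sub>R X (z s)"] Ck_on_scaleR Ck_on_const)
        (auto simp: has_vector_derivative_def)
  qed
  then show ?thesis by (simp add: smooth_on_def)
qed

section \<open>Metrics in coordinates\<close>

definition metric_on :: "'e::euclidean_space set \<Rightarrow> ('e \<Rightarrow> 'e \<Rightarrow> 'e \<Rightarrow> real) \<Rightarrow> bool" where
  "metric_on U G \<longleftrightarrow> open U \<and>
     (\<forall>x\<in>U. bilinear (G x) \<and> (\<forall>u v. G x u v = G x v u) \<and> (\<forall>u. u \<noteq> 0 \<longrightarrow> G x u u > 0)) \<and>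
     (\<forall>u v. smooth_on U (\<lambda>x. G x u v))"

text \<open>The description in \<open>levi_civita_coeff\<close> with the coordinate metric as a
  parameter, so that the theory can be developed on an open set of a Euclidean space.\<close>

definition christoffel :: "('e::euclidean_space \<Rightarrow> 'e \<Rightarrow> 'e \<Rightarrow> real) \<Rightarrow> 'e \<Rightarrow> 'e \<Rightarrow> 'e \<Rightarrow> 'e" where
  "christoffel G x = (THE \<Gamma>. bilinear \<Gamma> \<and> (\<forall>u v. \<Gamma> u v = \<Gamma> v u) \<and>
     (\<forall>u v w. frechet_derivative (\<lambda>y. G y v w) (at x) u = G x (\<Gamma> u v) w + G x v (\<Gamma> u w)))"

definition dmetric :: "('e::euclidean_space \<Rightarrow> 'e \<Rightarrow> 'e \<Rightarrow> real) \<Rightarrow> 'e \<Rightarrow> 'e \<Rightarrow> 'e \<Rightarrow> 'e \<Rightarrow> real" where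
  "dmetric G x u v w = frechet_derivative (\<lambda>y. G y v w) (at x) u"

text \<open>The right-hand side of the Koszul formula for coordinate fields, whose brackets vanish:
  the Christoffel symbols with the upper index lowered.\<close>

definition koszul :: "('e::euclidean_space \<Rightarrow> 'e \<Rightarrow> 'e \<Rightarrow> real) \<Rightarrow> 'e \<Rightarrow> 'e \<Rightarrow> 'e \<Rightarrow> 'e \<Rightarrow> real" where
  "koszul G x u v w = (dmetric G x u v w + dmetric G x v u w - dmetric G x w u v) / 2"

lemma smooth_on_differentiable: "smooth_on S f \<Longrightarrow> x \<in> S \<Longrightarrow> f differentiable at x"
  unfolding smooth_on_def by (metis Ck_on.simps(2))

lemma smooth_on_has_derivative:
  "smooth_on S f \<Longrightarrow> x \<in> S \<Longrightarrow> (f has_derivative frechet_derivative f (at x)) (at x)"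
  using smooth_on_differentiable frechet_derivative_works by blast

lemma smooth_on_frechet_derivative:
  "smooth_on S f \<Longrightarrow> smooth_on S (\<lambda>x. frechet_derivative f (at x) v)"
  unfolding smooth_on_def by (metis Ck_on.simps(2))

lemma smooth_on_subset: "smooth_on S f \<Longrightarrow> T \<subseteq> S \<Longrightarrow> smooth_on T f"
  unfolding smooth_on_def using Ck_on_subset by blast

context
  fixes U :: "'e::euclidean_space set" and G
  assumes G: "metric_on U G"
begin

lemma metric_on_open: "open U"
  using G by (simp add: metric_on_def)

lemma metric_on_smooth: "smooth_on U (\<lambda>x. G x u v)"
  using G by (simp add: metric_on_def)

lemma metric_on_bilinear: "x \<in> U \<Longrightarrow> bilinear (G x)"
  and metric_on_sym: "x \<in> U \<Longrightarrow> G x u v = G x v u"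
  and metric_on_pos: "x \<in> U \<Longrightarrow> u \<noteq> 0 \<Longrightarrow> G x u u > 0"
  using G by (auto simp: metric_on_def)

lemma metric_on_differentiable: "x \<in> U \<Longrightarrow> (\<lambda>x. G x u v) differentiable (at x)"
  by (rule smooth_on_differentiable[OF metric_on_smooth])

lemma metric_on_linear: "x \<in> U \<Longrightarrow> linear (G x u)" "x \<in> U \<Longrightarrow> linear (\<lambda>u. G x u v)"
  using metric_on_bilinear by (auto simp: bilinear_def)

lemma metric_on_eqI:
  assumes "x \<in> U" "\<And>w. G x u w = G x v w"
  shows "u = v"
proof (rule ccontr)
  assume "u \<noteq> v"
  then have "G x (u - v) (u - v) > 0" by (intro metric_on_pos assms(1)) auto
  then show False using linear_diff[OF metric_on_linear(2)[OF assms(1)]] assms(2) by simp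
qed

lemma dmetric_has_derivative: "x \<in> U \<Longrightarrow> ((\<lambda>y. G y v w) has_derivative (\<lambda>u. dmetric G x u v w)) (at x)"
  unfolding dmetric_def using metric_on_differentiable frechet_derivative_works by blast

lemma dmetric_eqI:
  assumes "x \<in> U" "(f has_derivative f') (at x)" "\<And>y. y \<in> U \<Longrightarrow> f y = G y v w"
  shows "dmetric G x u v w = f' u"
  using has_derivative_unique[OF dmetric_has_derivative[OF assms(1)]
      has_derivative_transform_within_open[OF assms(2) metric_on_open assms(1) assms(3)]]
  by metis

lemma dmetric_sym: "x \<in> U \<Longrightarrow> dmetric G x u v w = dmetric G x u w v"
  by (rule dmetric_eqI[OF _ dmetric_has_derivative]) (auto intro: metric_on_sym)

lemma dmetric_linear1: "x \<in> U \<Longrightarrow> linear (\<lambda>u. dmetric G x u v w)"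
  by (rule has_derivative_linear[OF dmetric_has_derivative])

lemma dmetric_linear2: "x \<in> U \<Longrightarrow> linear (\<lambda>v. dmetric G x u v w)"
proof (rule linearI)
  fix v v' assume x: "x \<in> U"
  show "dmetric G x u (v + v') w = dmetric G x u v w + dmetric G x u v' w"
    by (rule dmetric_eqI[OF x has_derivative_add[OF dmetric_has_derivative[OF x] dmetric_has_derivative[OF x]]])
      (use linear_add[OF metric_on_linear(2)] in auto)
next
  fix v r assume x: "x \<in> U"
  show "dmetric G x u (r *\<^sub>R v) w = r *\<^sub>R dmetric G x u v w"
    by (rule dmetric_eqI[OF x has_derivative_scaleR_right[OF dmetric_has_derivative[OF x]]])
      (use linear_scale[OF metric_on_linear(2)] in auto)
qed

lemma dmetric_linear3: "x \<in> U \<Longrightarrow> linear (\<lambda>w. dmetric G x u v w)"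
  using dmetric_linear2[of x u v] dmetric_sym[of x u v] by simp

lemma koszul_linear:
  assumes "x \<in> U"
  shows "linear (\<lambda>u. koszul G x u v w)" "linear (\<lambda>v. koszul G x u v w)" "linear (\<lambda>w. koszul G x u v w)"
  unfolding koszul_def
  by (rule linearI; simp add: linear_add[OF dmetric_linear1] linear_add[OF dmetric_linear2]
      linear_add[OF dmetric_linear3] linear_scale[OF dmetric_linear1] linear_scale[OF dmetric_linear2]
      linear_scale[OF dmetric_linear3] assms add_divide_distrib diff_divide_distrib algebra_simps)+

text \<open>Symmetry and compatibility, with the three arguments permuted, force the Koszul formula,
  which gives uniqueness. Conversely, the vector that represents the Koszul expression has both
  properties.\<close>

lemma christoffel_ex1:
  assumes x: "x \<in> U"
  shows "\<exists>!\<Gamma>. bilinear \<Gamma> \<and> (\<forall>u v. \<Gamma> u v = \<Gamma> v u) \<and>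
     (\<forall>u v w. frechet_derivative (\<lambda>y. G y v w) (at x) u = G x (\<Gamma> u v) w + G x v (\<Gamma> u w))"
proof -
  have "\<exists>y. \<forall>w. G x y w = koszul G x u v w" for u v
    using ex1_riesz[OF metric_on_bilinear[OF x] metric_on_pos[OF x] koszul_linear(3)[OF x]] by blast
  then obtain \<Gamma> where \<Gamma>: "\<And>u v w. G x (\<Gamma> u v) w = koszul G x u v w" by metis
  note lin = linear_add[OF metric_on_linear(2)[OF x]] linear_scale[OF metric_on_linear(2)[OF x]]
  note klin = linear_add[OF koszul_linear(1)[OF x]] linear_scale[OF koszul_linear(1)[OF x]]
    linear_add[OF koszul_linear(2)[OF x]] linear_scale[OF koszul_linear(2)[OF x]]
  have bil: "bilinear \<Gamma>"
    unfolding bilinear_def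
    by (intro conjI allI linearI; rule metric_on_eqI[OF x]) (simp_all add: \<Gamma> lin klin)
  have sym: "\<Gamma> u v = \<Gamma> v u" for u v
    by (rule metric_on_eqI[OF x]) (simp add: \<Gamma>, simp add: koszul_def dmetric_sym[OF x])
  have compat: "frechet_derivative (\<lambda>y. G y v w) (at x) u = G x (\<Gamma> u v) w + G x v (\<Gamma> u w)" for u v w
    unfolding metric_on_sym[OF x, of v] \<Gamma> koszul_def dmetric_def[symmetric]
    using dmetric_sym[OF x, of u v w] dmetric_sym[OF x, of v w u] dmetric_sym[OF x, of w v u] by (simp add: field_simps)
  show ?thesis
  proof (rule ex1I)
    show "bilinear \<Gamma> \<and> (\<forall>u v. \<Gamma> u v = \<Gamma> v u) \<and>
     (\<forall>u v w. frechet_derivative (\<lambda>y. G y v w) (at x) u = G x (\<Gamma> u v) w + G x v (\<Gamma> u w))"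
      using bil sym compat by blast
    fix \<Delta>
    assume d: "bilinear \<Delta> \<and> (\<forall>u v. \<Delta> u v = \<Delta> v u) \<and>
     (\<forall>u v w. frechet_derivative (\<lambda>y. G y v w) (at x) u = G x (\<Delta> u v) w + G x v (\<Delta> u w))"
    have "G x (\<Delta> u v) w = koszul G x u v w" for u v w
    proof -
      have d': "\<Delta> u v = \<Delta> v u" "dmetric G x u v w = G x (\<Delta> u v) w + G x v (\<Delta> u w)" for u v w
        using d by (auto simp: dmetric_def)
      show ?thesis
        unfolding koszul_def d'(2) d'(1)[of v u] d'(1)[of w u] d'(1)[of w v]
        using metric_on_sym[OF x, of v "\<Delta> u w"] metric_on_sym[OF x, of u "\<Delta> v w"] by simp
    qed
    then show "\<Delta> = \<Gamma>" using \<Gamma> by (intro ext metric_on_eqI[OF x]) simp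
  qed
qed

lemma
  assumes x: "x \<in> U"
  shows christoffel_bilinear: "bilinear (christoffel G x)"
    and christoffel_sym: "christoffel G x u v = christoffel G x v u"
    and christoffel_compat:
      "dmetric G x u v w = G x (christoffel G x u v) w + G x v (christoffel G x u w)"
  using theI'[OF christoffel_ex1[OF x]] unfolding christoffel_def[symmetric] dmetric_def by blast+

lemma christoffel_scale: "x \<in> U \<Longrightarrow> christoffel G x (r *\<^sub>R u) v = r *\<^sub>R christoffel G x u v"
  using christoffel_bilinear[of x] linear_scale[of "\<lambda>u. christoffel G x u v" r u] by (simp add: bilinear_def)

lemma christoffel_koszul:
  assumes x: "x \<in> U"
  shows "G x (christoffel G x u v) w = koszul G x u v w"
  unfolding koszul_def christoffel_compat[OF x] christoffel_sym[OF x, of v u]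
    christoffel_sym[OF x, of w u] christoffel_sym[OF x, of w v]
  using metric_on_sym[OF x, of v "christoffel G x u w"] metric_on_sym[OF x, of u "christoffel G x v w"]
  by simp

lemma christoffel_smooth: "smooth_on U (\<lambda>x. christoffel G x u v)"
  unfolding smooth_on_def
proof
  fix k
  have D: "Ck_on k U (\<lambda>x. dmetric G x a b c)" for a b c
    using smooth_on_frechet_derivative[OF metric_on_smooth] by (simp add: dmetric_def smooth_on_def)
  show "Ck_on k U (\<lambda>x. christoffel G x u v)"
  proof (rule Ck_on_solve[of U k G "\<lambda>x w. (dmetric G x u v w + dmetric G x v u w - dmetric G x w u v) * (1/2)"])
    show "Ck_on k U (\<lambda>x. (dmetric G x u v w + dmetric G x v u w - dmetric G x w u v) * (1/2))" for w
      by (intro Ck_on_mult Ck_on_diff Ck_on_add Ck_on_const D metric_on_open)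
    show "Ck_on k U (\<lambda>x. G x a b)" for a b using metric_on_smooth by (simp add: smooth_on_def)
  qed (auto intro: metric_on_open metric_on_bilinear metric_on_sym metric_on_pos
      simp: christoffel_koszul koszul_def)
qed

end

lemma has_derivative_metric:
  assumes "metric_on U G" "y s \<in> U"
    "(y has_derivative y') (at s)" "(a has_derivative a') (at s)" "(b has_derivative b') (at s)"
  shows "((\<lambda>t. G (y t) (a t) (b t)) has_derivative
    (\<lambda>h. dmetric G (y s) (y' h) (a s) (b s) + G (y s) (a' h) (b s) + G (y s) (a s) (b' h))) (at s)"
  unfolding dmetric_def
  by (rule has_derivative_bilinear_family[OF metric_on_open[OF assms(1)] assms(2)
      metric_on_differentiable[OF assms(1,2)] assms(3-5) metric_on_bilinear[OF assms(1)]])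

section \<open>Geodesics in coordinates\<close>

text \<open>The geodesic equation as a first order system: the velocity \<open>w\<close> is a
  separate unknown, as Picard iteration requires.\<close>

definition geodesic_in ::
  "'e::euclidean_space set \<Rightarrow> ('e \<Rightarrow> 'e \<Rightarrow> 'e \<Rightarrow> real) \<Rightarrow> real set \<Rightarrow> (real \<Rightarrow> 'e) \<Rightarrow> (real \<Rightarrow> 'e) \<Rightarrow> bool" where
  "geodesic_in U G I y w \<longleftrightarrow> (\<forall>s\<in>I. y s \<in> U \<and> (y has_vector_derivative w s) (at s) \<and>
     (w has_vector_derivative - christoffel G (y s) (w s) (w s)) (at s))"

lemma Ck_on_Pair:
  fixes f :: "'a::real_normed_vector \<Rightarrow> 'b::euclidean_space" and g :: "'a \<Rightarrow> 'c::euclidean_space"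
  assumes "open S" "Ck_on k S f" "Ck_on k S g"
  shows "Ck_on k S (\<lambda>x. (f x, g x))"
proof -
  have "bounded_linear (\<lambda>a::'b. (a, 0::'c))" "bounded_linear (\<lambda>b::'c. (0::'b, b))"
    by (intro bounded_linear_Pair bounded_linear_ident bounded_linear_zero)+
  then have "Ck_on k S (\<lambda>x. (f x, 0) + (0, g x))"
    by (intro Ck_on_add assms(1) Ck_on_linear_compose[of "\<lambda>a::'b. (a, 0::'c)"]
        Ck_on_linear_compose[of "\<lambda>b::'c. (0::'b, b)"] assms)
  then show ?thesis by simp
qed

lemma geodesic_exists:
  assumes G: "metric_on U G" and x: "x \<in> U"
  shows "\<exists>\<epsilon>>0. \<exists>y w. y 0 = x \<and> w 0 = u \<and> geodesic_in U G {-\<epsilon><..<\<epsilon>} y w \<and> smooth_on {-\<epsilon><..<\<epsilon>} y"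
proof -
  \<comment> \<open>The geodesic spray, a vector field on the space \<open>S\<close> of positions
    and velocities.\<close>
  define X where "X z = (snd z, - christoffel G (fst z) (snd z) (snd z))" for z :: "'a \<times> 'a"
  define S where "S = U \<times> (UNIV :: 'a set)"
  have S: "open S" using metric_on_open[OF G] by (simp add: S_def open_Times)
  have X: "smooth_on S X"
    unfolding smooth_on_def
  proof
    fix k
    have fs: "Ck_on k S fst" "Ck_on k S snd"
      by (intro Ck_on_bounded_linear S bounded_linear_fst bounded_linear_snd)+
    have "Ck_on k S (\<lambda>z. christoffel G (fst z) a b)" for a b
      by (rule Ck_on_compose[OF S metric_on_open[OF G] _ fs(1)])
        (use christoffel_smooth[OF G] in \<open>auto simp: smooth_on_def S_def\<close>)
    then have "Ck_on k S (\<lambda>z. christoffel G (fst z) (snd z) (snd z))"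
      by (rule Ck_on_bilinear_family[where G="\<lambda>z. christoffel G (fst z)", OF S _ fs(2) fs(2)])
        (use christoffel_bilinear[OF G] in \<open>auto simp: S_def\<close>)
    then show "Ck_on k S X"
      unfolding X_def by (intro Ck_on_Pair S fs(2) Ck_on_minus)
  qed
  then have X1: "Ck_on (Suc 0) S X" unfolding smooth_on_def by blast
  have xu: "(x, u) \<in> S" using x by (simp add: S_def)
  obtain \<epsilon> z where e: "\<epsilon> > 0" and z0: "z 0 = (x, u)"
    and z: "\<And>s. s \<in> {-\<epsilon><..<\<epsilon>} \<Longrightarrow> z s \<in> S \<and> (z has_vector_derivative X (z s)) (at s)"
    using ode_local_solution[OF S xu X1] by metis
  have smz: "smooth_on {-\<epsilon><..<\<epsilon>} z" by (rule ode_solution_smooth[OF _ S X z]) auto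
  have d: "((\<lambda>s. fst (z s)) has_vector_derivative fst (X (z s))) (at s)"
    "((\<lambda>s. snd (z s)) has_vector_derivative snd (X (z s))) (at s)" if "s \<in> {-\<epsilon><..<\<epsilon>}" for s
    using z[OF that] bounded_linear.has_vector_derivative[OF bounded_linear_fst]
      bounded_linear.has_vector_derivative[OF bounded_linear_snd] by blast+
  have geo: "geodesic_in U G {-\<epsilon><..<\<epsilon>} (\<lambda>s. fst (z s)) (\<lambda>s. snd (z s))"
    unfolding geodesic_in_def using z d by (auto simp: X_def S_def mem_Times_iff)
  have sm: "smooth_on {-\<epsilon><..<\<epsilon>} (\<lambda>s. fst (z s))"
    using smz by (auto simp: smooth_on_def intro: Ck_on_linear_compose[OF bounded_linear_fst])
  show ?thesis
    by (rule exI[of _ \<epsilon>], rule conjI[OF e], rule exI[of _ "\<lambda>s. fst (z s)"],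
        rule exI[of _ "\<lambda>s. snd (z s)"]) (simp add: z0 geo sm)
qed

text \<open>Compatibility of the connection with \<open>G\<close> turns the derivative of the metric
  into two terms that cancel those coming from the acceleration.\<close>

lemma geodesic_in_speed_has_derivative:
  assumes G: "metric_on U G" and "geodesic_in U G I y w" "s \<in> I"
  shows "((\<lambda>s. G (y s) (w s) (w s)) has_derivative (\<lambda>h. 0)) (at s)"
proof -
  have y: "y s \<in> U" "(y has_derivative (\<lambda>h. h *\<^sub>R w s)) (at s)"
    and w: "(w has_derivative (\<lambda>h. h *\<^sub>R - christoffel G (y s) (w s) (w s))) (at s)"
    using assms(2,3) by (auto simp: geodesic_in_def has_vector_derivative_def)
  note lin = linear_scale[OF dmetric_linear1[OF G y(1)]] linear_scale[OF metric_on_linear(1)[OF G y(1)]]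
    linear_scale[OF metric_on_linear(2)[OF G y(1)]] linear_neg[OF metric_on_linear(1)[OF G y(1)]]
    linear_neg[OF metric_on_linear(2)[OF G y(1)]]
  show ?thesis
    using has_derivative_metric[OF G y(1) y(2) w w]
    by (simp add: lin christoffel_compat[OF G y(1)] christoffel_scale[OF G y(1)])
qed

lemma geodesic_in_speed_constant:
  assumes "metric_on U G" "geodesic_in U G I y w" "convex I" "s \<in> I" "t \<in> I"
  shows "G (y s) (w s) (w s) = G (y t) (w t) (w t)"
  using has_derivative_zero_constant[OF assms(3), of "\<lambda>s. G (y s) (w s) (w s)"]
    has_derivative_at_withinI[OF geodesic_in_speed_has_derivative[OF assms(1,2)]] assms(4,5) by metis

section \<open>Riemannian submersions in coordinates\<close>

text \<open>\<open>A\<close> is the adjoint of \<open>L\<close> for \<open>B\<close> and the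
  standard inner product, so its values are \<open>B\<close>-orthogonal to the kernel of
  \<open>L\<close>. Since \<open>L\<close> is onto, \<open>L\<close> after \<open>A\<close> is
  injective, hence bijective, and \<open>A\<close> supplies the orthogonal vector with the same
  image as \<open>w\<close>.\<close>

lemma ex_orthogonal_decomposition:
  fixes B :: "'e::euclidean_space \<Rightarrow> 'e \<Rightarrow> real" and L :: "'e \<Rightarrow> 'k::euclidean_space"
  assumes B: "bilinear B" "\<And>u v. B u v = B v u" "\<And>u. u \<noteq> 0 \<Longrightarrow> B u u > 0" and L: "linear L" "surj L"
  shows "\<exists>h. (\<forall>v. L v = 0 \<longrightarrow> B h v = 0) \<and> L (w - h) = 0"
proof -
  have "linear (\<lambda>w. y \<bullet> L w)" for y
    using linear_compose[OF L(1) bounded_linear.linear[OF bounded_linear_inner_right[of y]]]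
    by (simp add: o_def)
  then have "\<exists>z. \<forall>w. B z w = y \<bullet> L w" for y
    using ex1_riesz[OF B(1,3)] by blast
  then obtain A where A: "\<And>y w. B (A y) w = y \<bullet> L w" by metis
  have l: "linear (\<lambda>u. B u v)" for v using B(1) by (simp add: bilinear_def)
  have eqI: "u = v" if "\<And>w. B u w = B v w" for u v
  proof (rule ccontr)
    assume "u \<noteq> v"
    then have "B (u - v) (u - v) > 0" by (intro B(3)) auto
    then show False using that linear_diff[OF l] by simp
  qed
  have "linear A"
    by (intro linearI eqI) (simp_all add: A linear_add[OF l] linear_scale[OF l] inner_add_left)
  then have LA: "linear (\<lambda>y. L (A y))" using linear_compose[OF _ L(1)] by (simp add: o_def)
  have "inj (\<lambda>y. L (A y))"
    unfolding linear_injective_0[OF LA]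
  proof (intro allI impI)
    fix y assume "L (A y) = 0"
    then have "B (A y) (A y) = 0" by (simp add: A)
    then have "A y = 0" using B(3) by (metis less_irrefl)
    then have "y \<bullet> L w = 0" for w using A[of y w] linear_0[OF l] by simp
    then show "y = 0" using L(2) by (metis inner_eq_zero_iff surjD)
  qed
  then have "surj (\<lambda>y. L (A y))" using LA linear_injective_imp_surjective by blast
  then obtain y where "L w = L (A y)" by (metis surjD)
  then show ?thesis
    using A by (intro exI[of _ "A y"]) (simp add: linear_diff[OF L(1)])
qed

section \<open>A Riemannian submersion between open sets of Euclidean spaces\<close>

locale local_submersion =
  fixes U :: "'e::euclidean_space set" and G :: "'e \<Rightarrow> 'e \<Rightarrow> 'e \<Rightarrow> real"
    and T :: "'k::euclidean_space set" and H :: "'k \<Rightarrow> 'k \<Rightarrow> 'k \<Rightarrow> real"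
    and P :: "'e \<Rightarrow> 'k"
  assumes G: "metric_on U G" and H: "metric_on T H"
    and P: "smooth_on U P" "P ` U \<subseteq> T"
    and surj_dP: "x \<in> U \<Longrightarrow> surj (frechet_derivative P (at x))"
    and isometry: "x \<in> U \<Longrightarrow> (\<And>v. frechet_derivative P (at x) v = 0 \<Longrightarrow> G x u v = 0) \<Longrightarrow>
      H (P x) (frechet_derivative P (at x) u) (frechet_derivative P (at x) u) = G x u u"
begin

definition dP :: "'e \<Rightarrow> 'e \<Rightarrow> 'k" where "dP x = frechet_derivative P (at x)"

definition hor :: "'e \<Rightarrow> 'e \<Rightarrow> bool" where "hor x u \<longleftrightarrow> (\<forall>v. dP x v = 0 \<longrightarrow> G x u v = 0)"

text \<open>The horizontal part of \<open>v\<close>. It is described by linear equations with smooth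
  coefficients rather than as a projection, so that \<open>Ck_on_solve\<close> yields its smoothness
  in \<open>x\<close>.\<close>

definition hlift :: "'e \<Rightarrow> 'e \<Rightarrow> 'e" where
  "hlift x v = (THE y. \<forall>w. G x y w = H (P x) (dP x v) (dP x w))"

text \<open>The second derivative of \<open>P\<close> corrected by the connection of \<open>G\<close>: on vertical vectors it is
  minus the image under \<open>dP\<close> of the second fundamental form of the fibre.\<close>

definition sff :: "'e \<Rightarrow> 'e \<Rightarrow> 'e \<Rightarrow> 'k" where
  "sff x u v = frechet_derivative (\<lambda>y. dP y v) (at x) u - dP x (christoffel G x u v)"

lemma open_U: "open U" by (rule metric_on_open[OF G])

lemma P_in: "x \<in> U \<Longrightarrow> P x \<in> T" using P(2) by blast

lemma P_has_derivative: "x \<in> U \<Longrightarrow> (P has_derivative dP x) (at x)"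
  unfolding dP_def by (rule smooth_on_has_derivative[OF P(1)])

lemma dP_linear: "x \<in> U \<Longrightarrow> linear (dP x)"
  by (rule has_derivative_linear[OF P_has_derivative])

lemma dP_smooth: "smooth_on U (\<lambda>x. dP x v)"
  unfolding dP_def by (rule smooth_on_frechet_derivative[OF P(1)])

lemma dP_differentiable: "x \<in> U \<Longrightarrow> (\<lambda>x. dP x v) differentiable at x"
  by (rule smooth_on_differentiable[OF dP_smooth])

lemma hor_isometry: "x \<in> U \<Longrightarrow> hor x u \<Longrightarrow> H (P x) (dP x u) (dP x u) = G x u u"
  using isometry by (auto simp: hor_def dP_def)

lemma hor_add: "x \<in> U \<Longrightarrow> hor x u \<Longrightarrow> hor x v \<Longrightarrow> hor x (u + v)"
  by (simp add: hor_def linear_add[OF metric_on_linear(2)[OF G]])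

lemma ex_hor:
  assumes x: "x \<in> U"
  shows "\<exists>h. hor x h \<and> dP x h = dP x w"
  using ex_orthogonal_decomposition[OF metric_on_bilinear[OF G x] metric_on_sym[OF G x]
      metric_on_pos[OF G x] dP_linear[OF x] surj_dP[OF x, folded dP_def], of w] linear_diff[OF dP_linear[OF x]]
  by (auto simp: hor_def)

text \<open>Preservation of lengths is polarised on horizontal pairs; an arbitrary \<open>w\<close>
  is then replaced by the horizontal vector with the same image, which differs from it by a vertical
  vector.\<close>

lemma hor_inner:
  assumes x: "x \<in> U" and u: "hor x u"
  shows "G x u w = H (P x) (dP x u) (dP x w)"
proof -
  obtain h where h: "hor x h" "dP x h = dP x w" using ex_hor[OF x] by blast
  note Gl = linear_add[OF metric_on_linear(1)[OF G x]] linear_add[OF metric_on_linear(2)[OF G x]]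
  note Hl = linear_add[OF metric_on_linear(1)[OF H P_in[OF x]]] linear_add[OF metric_on_linear(2)[OF H P_in[OF x]]]
  have "H (P x) (dP x (u + h)) (dP x (u + h)) = G x (u + h) (u + h)"
    by (rule hor_isometry[OF x hor_add[OF x u h(1)]])
  then have "H (P x) (dP x u) (dP x h) = G x u h"
    using hor_isometry[OF x u] hor_isometry[OF x h(1)] metric_on_sym[OF G x, of h u]
      metric_on_sym[OF H P_in[OF x], of "dP x h" "dP x u"]
    by (simp add: Gl Hl linear_add[OF dP_linear[OF x]])
  moreover have "G x u (w - h) = 0"
    using u h(2) linear_diff[OF dP_linear[OF x]] by (simp add: hor_def)
  ultimately show ?thesis using h(2) linear_diff[OF metric_on_linear(1)[OF G x]] by simp
qed

lemma hlift_inner: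
  assumes x: "x \<in> U"
  shows "G x (hlift x v) w = H (P x) (dP x v) (dP x w)"
proof -
  have "linear (\<lambda>w. H (P x) (dP x v) (dP x w))"
    using linear_compose[OF dP_linear[OF x] metric_on_linear(1)[OF H P_in[OF x]]] by (simp add: o_def)
  from theI'[OF ex1_riesz[OF metric_on_bilinear[OF G x] metric_on_pos[OF G x] this]]
  show ?thesis unfolding hlift_def by blast
qed

lemma hlift:
  assumes x: "x \<in> U"
  shows "hor x (hlift x v)" "dP x (hlift x v) = dP x v"
proof -
  obtain h where h: "hor x h" "dP x h = dP x v" using ex_hor[OF x] by blast
  have "hlift x v = h"
    by (rule metric_on_eqI[OF G x]) (simp add: hlift_inner[OF x] hor_inner[OF x h(1)] h(2))
  then show "hor x (hlift x v)" "dP x (hlift x v) = dP x v" using h by auto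
qed

lemma hlift_smooth: "smooth_on U (\<lambda>x. hlift x v)"
  unfolding smooth_on_def
proof
  fix k
  have "Ck_on k U (\<lambda>x. H (P x) a b)" for a b
    by (rule Ck_on_compose[OF open_U metric_on_open[OF H] P(2)])
      (use P metric_on_smooth[OF H] in \<open>auto simp: smooth_on_def\<close>)
  then have K: "Ck_on k U (\<lambda>x. H (P x) (dP x v) (dP x w))" for w
    by (rule Ck_on_bilinear_family[where G="\<lambda>x. H (P x)", OF open_U])
      (use dP_smooth metric_on_bilinear[OF H P_in] in \<open>auto simp: smooth_on_def\<close>)
  have "Ck_on k U (\<lambda>x. G x a b)" for a b using metric_on_smooth[OF G] by (simp add: smooth_on_def)
  then show "Ck_on k U (\<lambda>x. hlift x v)"
    by (rule Ck_on_solve[where G=G, OF open_U _ K metric_on_bilinear[OF G] metric_on_sym[OF G]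
          metric_on_pos[OF G] hlift_inner])
qed

text \<open>The last two terms are together \<open>dP\<close> of the covariant derivative of
  \<open>V\<close> in direction \<open>h\<close>. Thus \<open>sff\<close> is the covariant
  derivative of \<open>dP\<close>, taken with the flat connection on the target.\<close>

lemma dP_field_has_derivative:
  assumes "x \<in> U" "(V has_derivative V') (at x)"
  shows "((\<lambda>y. dP y (V y)) has_derivative
    (\<lambda>h. sff x h (V x) + dP x (christoffel G x h (V x)) + dP x (V' h))) (at x)"
  using has_derivative_linear_family[OF open_U assms(1) dP_differentiable[OF assms(1)] assms(2) dP_linear]
  by (simp add: sff_def)

text \<open>The same product rule along a curve. If the curve is a geodesic and \<open>w\<close> its
  velocity, the two \<open>dP\<close> terms cancel and only \<open>sff\<close> remains.\<close>

lemma dP_curve_has_derivative: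
  assumes "y s \<in> U" "(y has_derivative y') (at s)" "(w has_derivative w') (at s)"
  shows "((\<lambda>t. dP (y t) (w t)) has_derivative
    (\<lambda>h. sff (y s) (y' h) (w s) + dP (y s) (christoffel G (y s) (y' h) (w s)) + dP (y s) (w' h))) (at s)"
proof -
  obtain N where N: "open N" "s \<in> N" "y ` N \<subseteq> U"
    using has_derivative_continuous[OF assms(2)] assms(1) open_U
    by (metis (no_types, opaque_lifting) continuous_at_open image_subset_iff)
  have c: "((\<lambda>t. dP (y t) v) has_derivative (\<lambda>h. frechet_derivative (\<lambda>x. dP x v) (at (y s)) (y' h))) (at s)" for v
    using diff_chain_at[OF assms(2) frechet_derivative_works[THEN iffD1, OF dP_differentiable[OF assms(1)]]]
    by (simp add: o_def)
  have d: "(\<lambda>t. dP (y t) v) differentiable at s" for v using c by (auto simp: differentiable_def)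
  have l: "linear (dP (y t))" if "t \<in> N" for t using dP_linear N(3) that by blast
  show ?thesis
    using has_derivative_linear_family[where M="\<lambda>t. dP (y t)", OF N(1,2) d assms(3) l]
    unfolding frechet_derivative_at[OF c, symmetric] sff_def by simp
qed

lemma dP_second_linear:
  assumes x: "x \<in> U"
  shows "linear (\<lambda>u. frechet_derivative (\<lambda>y. dP y v) (at x) u)"
  by (rule linear_frechet_derivative[OF dP_differentiable[OF x]])

text \<open>Second derivatives commute and the connection is torsion-free.\<close>

lemma sff_sym:
  assumes x: "x \<in> U"
  shows "sff x u v = sff x v u"
proof -
  have "Ck_on (Suc (Suc 0)) U P" using P(1) unfolding smooth_on_def by blast
  from second_derivative_symmetric[OF open_U x this]
  show ?thesis by (simp add: sff_def dP_def christoffel_sym[OF G x, of u])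
qed

lemma sff_linear:
  assumes x: "x \<in> U"
  shows "linear (\<lambda>u. sff x u v)" "linear (sff x u)"
proof -
  have "linear (\<lambda>u. christoffel G x u v)" for v
    using christoffel_bilinear[OF G x] by (simp add: bilinear_def)
  from linear_compose[OF this dP_linear[OF x]]
  show 1: "linear (\<lambda>u. sff x u v)" for v
    unfolding sff_def by (intro linear_compose_sub dP_second_linear[OF x]) (simp add: o_def)
  have "sff x u = (\<lambda>v. sff x v u)" using sff_sym[OF x] by blast
  then show "linear (sff x u)" using 1 by simp
qed

text \<open>With \<open>r = exp F\<close> the displayed function is \<open>r\<^sup>2 sin\<^sup>2 \<theta>\<close> times the squared speed, which is
  constant along geodesics; unlike the angle it is manifestly differentiable.\<close>

definition clairaut_local :: "('e \<Rightarrow> real) \<Rightarrow> bool" where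
  "clairaut_local F \<longleftrightarrow> (\<forall>\<epsilon>>0. \<forall>y w. geodesic_in U G {-\<epsilon><..<\<epsilon>} y w \<longrightarrow> smooth_on {-\<epsilon><..<\<epsilon>} y \<longrightarrow> w 0 \<noteq> 0 \<longrightarrow>
     (\<lambda>s. exp (2 * F (y s)) * (G (y s) (w s) (w s) - H (P (y s)) (dP (y s) (w s)) (dP (y s) (w s))))
       constant_on {-\<epsilon><..<\<epsilon>})"

text \<open>The conserved quantity is differentiated at time \<open>0\<close> along the geodesic
  with initial velocity \<open>u\<close>. The squared speed contributes nothing, the projected
  velocity changes at the rate \<open>sff x u u\<close>, and the common exponential factor
  cancels.\<close>

lemma clairaut_derivative:
  assumes cl: "clairaut_local F" and x: "x \<in> U" and F: "(F has_derivative F') (at x)" and u: "u \<noteq> 0"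
  shows "2 * F' u * (G x u u - H (P x) (dP x u) (dP x u)) =
    dmetric H (P x) (dP x u) (dP x u) (dP x u) + 2 * H (P x) (sff x u u) (dP x u)"
proof -
  obtain \<epsilon> y w where e: "\<epsilon> > 0" and y0: "y 0 = x" "w 0 = u"
    and geo: "geodesic_in U G {-\<epsilon><..<\<epsilon>} y w" and sm: "smooth_on {-\<epsilon><..<\<epsilon>} y"
    using geodesic_exists[OF G x] by blast
  have 0: "0 \<in> {-\<epsilon><..<\<epsilon>}" using e by simp
  have y: "(y has_derivative (\<lambda>h. h *\<^sub>R u)) (at 0)"
    and w: "(w has_derivative (\<lambda>h. h *\<^sub>R - christoffel G x u u)) (at 0)"
    using geo 0 y0 by (auto simp: geodesic_in_def has_vector_derivative_def)
  note Hs = linear_scale[OF dmetric_linear1[OF H P_in[OF x]]] linear_scale[OF metric_on_linear(1)[OF H P_in[OF x]]]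
    linear_scale[OF metric_on_linear(2)[OF H P_in[OF x]]] linear_scale[OF dP_linear[OF x]]
    linear_neg[OF dP_linear[OF x]] linear_scale[OF sff_linear(1)[OF x]]
  have q: "((\<lambda>t. dP (y t) (w t)) has_derivative (\<lambda>h. h *\<^sub>R sff x u u)) (at 0)"
    using dP_curve_has_derivative[of y 0, OF _ y w] x y0
    by (simp add: christoffel_scale[OF G x] Hs)
  have p: "((\<lambda>t. P (y t)) has_derivative (\<lambda>h. h *\<^sub>R dP x u)) (at 0)"
    using diff_chain_at[of y _ 0 P "dP x", OF y] P_has_derivative[OF x] y0
    by (simp add: o_def Hs)
  define K where "K = dmetric H (P x) (dP x u) (dP x u) (dP x u) + 2 * H (P x) (sff x u u) (dP x u)"
  have Hd: "((\<lambda>t. H (P (y t)) (dP (y t) (w t)) (dP (y t) (w t))) has_derivative (\<lambda>h. h * K)) (at 0)"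
    using has_derivative_metric[OF H, of "\<lambda>t. P (y t)" 0, OF _ p q q] P_in[OF x] y0
      metric_on_sym[OF H P_in[OF x], of "dP x u" "sff x u u"]
    by (simp add: K_def Hs algebra_simps)
  have Gd: "((\<lambda>t. G (y t) (w t) (w t)) has_derivative (\<lambda>h. 0)) (at 0)"
    by (rule geodesic_in_speed_has_derivative[OF G geo 0])
  have Fd: "((\<lambda>t. F (y t)) has_derivative (\<lambda>h. h * F' u)) (at 0)"
    using diff_chain_at[of y _ 0 F F', OF y] F y0 linear_scale[OF has_derivative_linear[OF F]]
    by (simp add: o_def)
  have ed: "((\<lambda>t. exp (2 * F (y t))) has_derivative (\<lambda>h. exp (2 * F x) * (2 * (h * F' u)))) (at 0)"
    using has_derivative_exp[OF has_derivative_mult_right[OF Fd, of 2]] y0 by (simp add: mult_ac)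
  define E where "E s = exp (2 * F (y s)) * (G (y s) (w s) (w s) - H (P (y s)) (dP (y s) (w s)) (dP (y s) (w s)))" for s
  have "((\<lambda>t. exp (2 * F (y t)) * (G (y t) (w t) (w t) - H (P (y t)) (dP (y t) (w t)) (dP (y t) (w t)))) has_derivative
     (\<lambda>h. exp (2 * F (y 0)) * (0 - h * K) + (exp (2 * F x) * (2 * (h * F' u)))
        * (G (y 0) (w 0) (w 0) - H (P (y 0)) (dP (y 0) (w 0)) (dP (y 0) (w 0))))) (at 0)"
    by (intro has_derivative_mult ed has_derivative_diff Gd Hd)
  then have E1: "(E has_derivative (\<lambda>h. exp (2 * F x) * (0 - h * K) + (exp (2 * F x) * (2 * (h * F' u)))
        * (G x u u - H (P x) (dP x u) (dP x u)))) (at 0)"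
    unfolding E_def[abs_def] y0 .
  have "E constant_on {-\<epsilon><..<\<epsilon>}"
    unfolding E_def[abs_def]
    by (rule cl[unfolded clairaut_local_def, rule_format, OF e geo sm]) (use u y0 in simp)
  then obtain c where "\<And>s. s \<in> {-\<epsilon><..<\<epsilon>} \<Longrightarrow> E s = c" by (auto simp: constant_on_def)
  then have "(E has_derivative (\<lambda>h. 0)) (at 0)"
    by (intro has_derivative_transform_within_open[OF has_derivative_const[of c] _ 0]) auto
  from has_derivative_unique[OF E1 this, THEN fun_cong, of 1]
  have "exp (2 * F x) * (2 * F' u * (G x u u - H (P x) (dP x u) (dP x u)) - K) = 0"
    by (simp add: algebra_simps)
  then show ?thesis by (simp add: K_def)
qed

text \<open>The fibres are totally umbilical: apply the previous lemma to \<open>v + e u\<close> and compare the coefficients of \<open>e\<close>.\<close>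

lemma clairaut_umbilic_diag:
  assumes cl: "clairaut_local F" and x: "x \<in> U" and F: "(F has_derivative F') (at x)"
    and v: "dP x v = 0" and u: "hor x u"
  shows "F' u * G x v v = H (P x) (sff x v v) (dP x u)"
proof (cases "v = 0")
  case True
  then show ?thesis
    using linear_0[OF metric_on_linear(1)[OF G x]] linear_0[OF sff_linear(2)[OF x]]
      linear_0[OF metric_on_linear(2)[OF H P_in[OF x]]] by simp
next
  case False
  note Gl = linear_add[OF metric_on_linear(1)[OF G x]] linear_add[OF metric_on_linear(2)[OF G x]]
    linear_scale[OF metric_on_linear(1)[OF G x]] linear_scale[OF metric_on_linear(2)[OF G x]]
  note Hl = linear_add[OF metric_on_linear(1)[OF H P_in[OF x]]] linear_add[OF metric_on_linear(2)[OF H P_in[OF x]]]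
    linear_scale[OF metric_on_linear(1)[OF H P_in[OF x]]] linear_scale[OF metric_on_linear(2)[OF H P_in[OF x]]]
    linear_scale[OF dmetric_linear1[OF H P_in[OF x]]] linear_scale[OF dmetric_linear2[OF H P_in[OF x]]]
    linear_scale[OF dmetric_linear3[OF H P_in[OF x]]]
  note Sl = linear_add[OF sff_linear(1)[OF x]] linear_add[OF sff_linear(2)[OF x]]
    linear_scale[OF sff_linear(1)[OF x]] linear_scale[OF sff_linear(2)[OF x]]
  note Fl = linear_add[OF has_derivative_linear[OF F]] linear_scale[OF has_derivative_linear[OF F]]
  have G0: "G x u v = 0" "G x v u = 0" using u v metric_on_sym[OF G x, of v u] by (auto simp: hor_def)
  define K where "K = dmetric H (P x) (dP x u) (dP x u) (dP x u)"
  have eq: "2 * (F' v + e * F' u) * G x v v = e * e * e * K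
      + 2 * e * H (P x) (sff x v v) (dP x u) + 2 * e * e * (H (P x) (sff x v u) (dP x u) + H (P x) (sff x u v) (dP x u))
      + 2 * e * e * e * H (P x) (sff x u u) (dP x u)" for e
  proof -
    \<comment> \<open>The Clairaut identity is available for nonzero velocities only; since
      \<open>u\<close> and \<open>v\<close> are orthogonal, \<open>v \<noteq> 0\<close>
      suffices.\<close>
    have "G x (v + e *\<^sub>R u) v \<noteq> 0"
      using metric_on_pos[OF G x False] G0 by (simp add: Gl)
    then have nz: "v + e *\<^sub>R u \<noteq> 0" using linear_0[OF metric_on_linear(2)[OF G x]] by metis
    have dPe: "dP x (v + e *\<^sub>R u) = e *\<^sub>R dP x u"
      by (simp add: v linear_add[OF dP_linear[OF x]] linear_scale[OF dP_linear[OF x]])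
    \<comment> \<open>The vertical part of the velocity is \<open>v\<close> for every
      \<open>e\<close>, so the left-hand side of the identity is affine in \<open>e\<close>; the
      right-hand side is a cubic without constant term.\<close>
    have "G x (v + e *\<^sub>R u) (v + e *\<^sub>R u) - H (P x) (e *\<^sub>R dP x u) (e *\<^sub>R dP x u) = G x v v"
      using hor_isometry[OF x u] G0 by (simp add: Gl Hl)
    with clairaut_derivative[OF cl x F nz]
    have "2 * F' (v + e *\<^sub>R u) * G x v v = dmetric H (P x) (e *\<^sub>R dP x u) (e *\<^sub>R dP x u) (e *\<^sub>R dP x u)
        + 2 * H (P x) (sff x (v + e *\<^sub>R u) (v + e *\<^sub>R u)) (e *\<^sub>R dP x u)"
      unfolding dPe by simp
    then show ?thesis by (simp add: Fl Hl Sl K_def algebra_simps)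
  qed
  \<comment> \<open>The odd part, evaluated at \<open>1\<close> and \<open>2\<close>, already
    separates the linear from the cubic coefficient.\<close>
  have poly: "b = c" if "\<And>e. 2 * (a + e * b) = e * e * e * k + 2 * e * c + 2 * e * e * d + 2 * e * e * e * m"
    for a b c d k m :: real
    using that[of 1] that[of "-1"] that[of 2] that[of "-2"] by simp
  show ?thesis
    by (rule poly[of "F' v * G x v v" _ K _ "H (P x) (sff x v u) (dP x u) + H (P x) (sff x u v) (dP x u)"
            "H (P x) (sff x u u) (dP x u)"])
      (use eq in \<open>simp add: distrib_right mult.assoc\<close>)
qed

text \<open>Polarisation, both sides being symmetric in \<open>v\<close> and
  \<open>w\<close>.\<close>

lemma clairaut_umbilic:
  assumes cl: "clairaut_local F" and x: "x \<in> U" and F: "(F has_derivative F') (at x)"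
    and v: "dP x v = 0" and w: "dP x w = 0" and u: "hor x u"
  shows "F' u * G x v w = H (P x) (sff x v w) (dP x u)"
proof -
  note Gl = linear_add[OF metric_on_linear(1)[OF G x]] linear_add[OF metric_on_linear(2)[OF G x]]
  note Hl = linear_add[OF metric_on_linear(2)[OF H P_in[OF x]]]
  note Sl = linear_add[OF sff_linear(1)[OF x]] linear_add[OF sff_linear(2)[OF x]]
  have "dP x (v + w) = 0" using v w by (simp add: linear_add[OF dP_linear[OF x]])
  from clairaut_umbilic_diag[OF cl x F this u] clairaut_umbilic_diag[OF cl x F v u]
    clairaut_umbilic_diag[OF cl x F w u]
  show ?thesis
    using metric_on_sym[OF G x, of w v] sff_sym[OF x, of w v] by (simp add: Gl Hl Sl algebra_simps)
qed

end

text \<open>The nearly Kaehler identity is asked only at the base point \<open>x0\<close>: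
  \<open>nabla\<close> is evaluated in the chart chosen at each point, so its coordinate form is at
  hand where that choice is the chart in use. Smoothness, linearity and anti-invariance of
  \<open>\<Phi>\<close> are asked on all of \<open>U\<close>, because fields built with
  \<open>\<Phi>\<close> are differentiated at \<open>x0\<close>.\<close>

locale local_anti_invariant = local_submersion +
  fixes \<Phi> :: "'a \<Rightarrow> 'a \<Rightarrow> 'a" and x0 :: 'a
  assumes x0: "x0 \<in> U"
    and Phi_linear: "x \<in> U \<Longrightarrow> linear (\<Phi> x)"
    and Phi_smooth: "smooth_on U (\<lambda>x. \<Phi> x u)"
    and Phi_Phi: "x \<in> U \<Longrightarrow> \<Phi> x (\<Phi> x u) = - u"
    and Phi_isometry: "x \<in> U \<Longrightarrow> G x (\<Phi> x u) (\<Phi> x v) = G x u v"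
    and Phi_hor: "x \<in> U \<Longrightarrow> dP x v = 0 \<Longrightarrow> hor x (\<Phi> x v)"
    and nearly_kaehler: "frechet_derivative (\<lambda>y. \<Phi> y v) (at x0) v
      + christoffel G x0 v (\<Phi> x0 v) - \<Phi> x0 (christoffel G x0 v v) = 0"
begin

text \<open>The identity \<open>(\<nabla>\<^sub>V \<phi>) V = 0\<close> paired with a vertical vector. The field \<open>V\<close> is the vertical part
  of the constant field \<open>v\<close>.\<close>

lemma sff_Phi:
  assumes v: "dP x0 v = 0" and w: "dP x0 w = 0"
  shows "H (P x0) (sff x0 v v) (dP x0 (\<Phi> x0 w)) = H (P x0) (dP x0 (\<Phi> x0 v)) (sff x0 v w)"
proof -
  define V where "V y = v - hlift y v" for y
  define V' where "V' = (\<lambda>h. - frechet_derivative (\<lambda>y. hlift y v) (at x0) h)"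
  have Vd: "(V has_derivative V') (at x0)"
    unfolding V_def V'_def
    using has_derivative_diff[OF has_derivative_const smooth_on_has_derivative[OF hlift_smooth x0]] by simp
  \<comment> \<open>\<open>v\<close> is vertical at \<open>x0\<close>, so the field \<open>V\<close>
    takes the value \<open>v\<close> there.\<close>
  have "hlift x0 v = 0"
    by (rule metric_on_eqI[OF G x0]) (simp add: hlift_inner[OF x0] v linear_0[OF metric_on_linear(2)[OF H P_in[OF x0]]]
        linear_0[OF metric_on_linear(2)[OF G x0]])
  then have V0: "V x0 = v" by (simp add: V_def)
  have Vv: "dP y (V y) = 0" if "y \<in> U" for y
    by (simp add: V_def linear_diff[OF dP_linear[OF that]] hlift(2)[OF that])
  \<comment> \<open>\<open>V\<close> is vertical on all of \<open>U\<close>. Differentiating this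
    along \<open>v\<close> shows that \<open>dP\<close> of the covariant derivative of
    \<open>V\<close> is \<open>- sff x0 v v\<close>.\<close>
  have "((\<lambda>y. dP y (V y)) has_derivative (\<lambda>h. 0)) (at x0)"
    by (rule has_derivative_transform_within_open[OF has_derivative_const open_U x0]) (simp add: Vv)
  from has_derivative_unique[OF dP_field_has_derivative[OF x0 Vd] this, THEN fun_cong, of v]
  have dPV: "sff x0 v v + dP x0 (christoffel G x0 v v) + dP x0 (V' v) = 0" by (simp add: V0)
  define Z where "Z y = \<Phi> y (V y)" for y
  define Z' where "Z' = (\<lambda>h. frechet_derivative (\<lambda>y. \<Phi> y v) (at x0) h + \<Phi> x0 (V' h))"
  have Zd: "(Z has_derivative Z') (at x0)"
    using has_derivative_linear_family[OF open_U x0 smooth_on_differentiable[OF Phi_smooth x0] Vd Phi_linear]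
    unfolding Z_def Z'_def V0 by simp
  have Z0: "Z x0 = \<Phi> x0 v" by (simp add: Z_def V0)
  \<comment> \<open>\<open>Z\<close> is horizontal, so its product with \<open>w\<close> can be
    taken in either metric; the two expressions are differentiated along \<open>v\<close> and
    compared. The vector \<open>w\<close> is kept constant and need be vertical only at
    \<open>x0\<close>, which is how \<open>sff x0 v w\<close> enters.\<close>
  have GZ: "G y (Z y) w = H (P y) (dP y (Z y)) (dP y w)" if "y \<in> U" for y
    using hor_inner[OF that Phi_hor[OF that Vv[OF that]]] by (simp add: Z_def)
  have lhs: "((\<lambda>y. G y (Z y) w) has_derivative
      (\<lambda>h. dmetric G x0 h (\<Phi> x0 v) w + G x0 (Z' h) w + G x0 (\<Phi> x0 v) 0)) (at x0)"
    using has_derivative_metric[OF G, of "\<lambda>y. y" x0, OF x0 has_derivative_ident Zd has_derivative_const] Z0 by simp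
  have rhs: "((\<lambda>y. H (P y) (dP y (Z y)) (dP y w)) has_derivative
      (\<lambda>h. dmetric H (P x0) (dP x0 h) (dP x0 (\<Phi> x0 v)) (dP x0 w)
        + H (P x0) (sff x0 h (\<Phi> x0 v) + dP x0 (christoffel G x0 h (\<Phi> x0 v)) + dP x0 (Z' h)) (dP x0 w)
        + H (P x0) (dP x0 (\<Phi> x0 v)) (sff x0 h w + dP x0 (christoffel G x0 h w) + dP x0 0))) (at x0)"
    using has_derivative_metric[OF H P_in[OF x0] P_has_derivative[OF x0]
        dP_field_has_derivative[OF x0 Zd] dP_field_has_derivative[OF x0 has_derivative_const[of w]]] Z0 by simp
  have lhs': "((\<lambda>y. G y (Z y) w) has_derivative
      (\<lambda>h. dmetric H (P x0) (dP x0 h) (dP x0 (\<Phi> x0 v)) (dP x0 w)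
        + H (P x0) (sff x0 h (\<Phi> x0 v) + dP x0 (christoffel G x0 h (\<Phi> x0 v)) + dP x0 (Z' h)) (dP x0 w)
        + H (P x0) (dP x0 (\<Phi> x0 v)) (sff x0 h w + dP x0 (christoffel G x0 h w) + dP x0 0))) (at x0)"
    by (rule has_derivative_transform_within_open[OF rhs open_U x0]) (simp add: GZ)
  note zero = linear_0[OF metric_on_linear(1)[OF G x0]] linear_0[OF metric_on_linear(1)[OF H P_in[OF x0]]]
    linear_0[OF dP_linear[OF x0]] linear_0[OF dmetric_linear1[OF H P_in[OF x0]]]
  have hPv: "hor x0 (\<Phi> x0 v)" and hPw: "hor x0 (\<Phi> x0 w)" using Phi_hor x0 v w by auto
  from has_derivative_unique[OF lhs lhs', THEN fun_cong, of v]
  have "dmetric G x0 v (\<Phi> x0 v) w + G x0 (Z' v) w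
      = H (P x0) (dP x0 (\<Phi> x0 v)) (sff x0 v w + dP x0 (christoffel G x0 v w))"
    by (simp add: v w zero)
  then have 1: "G x0 (christoffel G x0 v (\<Phi> x0 v) + Z' v) w = H (P x0) (dP x0 (\<Phi> x0 v)) (sff x0 v w)"
    unfolding christoffel_compat[OF G x0]
    by (simp add: hor_inner[OF x0 hPv] linear_add[OF metric_on_linear(2)[OF G x0]]
        linear_add[OF metric_on_linear(1)[OF H P_in[OF x0]]])
  \<comment> \<open>The covariant derivative of \<open>V\<close> along \<open>v\<close> at
    \<open>x0\<close>. By the nearly Kaehler identity its image under \<open>\<Phi>\<close> is the
    covariant derivative of \<open>Z\<close>.\<close>
  define a where "a = christoffel G x0 v v + V' v"
  have "christoffel G x0 v (\<Phi> x0 v) + Z' v = \<Phi> x0 a"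
    using nearly_kaehler[of v] by (simp add: a_def Z'_def linear_add[OF Phi_linear[OF x0]] algebra_simps)
  with 1 have "G x0 (\<Phi> x0 a) w = H (P x0) (dP x0 (\<Phi> x0 v)) (sff x0 v w)" by simp
  \<comment> \<open>\<open>\<Phi>\<close> is skew for \<open>G\<close>, being an isometry whose
    square is minus the identity.\<close>
  moreover have "G x0 (\<Phi> x0 a) w = - G x0 (\<Phi> x0 w) a"
    using Phi_isometry[OF x0, of "\<Phi> x0 a" w] metric_on_sym[OF G x0, of a "\<Phi> x0 w"]
    by (simp add: Phi_Phi[OF x0] linear_neg[OF metric_on_linear(2)[OF G x0]])
  moreover have "G x0 (\<Phi> x0 w) a = H (P x0) (dP x0 (\<Phi> x0 w)) (dP x0 a)" by (rule hor_inner[OF x0 hPw])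
  moreover have "dP x0 a = - sff x0 v v"
    using dPV by (simp add: a_def linear_add[OF dP_linear[OF x0]] eq_neg_iff_add_eq_0 algebra_simps)
  ultimately show ?thesis
    using metric_on_sym[OF H P_in[OF x0], of "sff x0 v v"]
    by (simp add: linear_neg[OF metric_on_linear(1)[OF H P_in[OF x0]]])
qed

text \<open>Umbilicity for \<open>v\<close> with itself, the exchange of \<open>v\<close> and
  \<open>X\<close> by \<open>sff_Phi\<close>, and umbilicity for \<open>v\<close> with
  \<open>X\<close> together yield |X|^2 |v|^2 = G(X, v)^2. This is equality in the Cauchy-Schwarz
  inequality, impossible for orthogonal nonzero vectors.\<close>

lemma gradient_vanishes:
  assumes cl: "clairaut_local F" and F: "(F has_derivative F') (at x0)"
    and X: "dP x0 X = 0" and grad: "\<And>u. F' u = G x0 (\<Phi> x0 X) u"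
    and v: "dP x0 v = 0" "v \<noteq> 0" "G x0 X v = 0"
  shows "X = 0"
proof -
  have hv: "hor x0 (\<Phi> x0 v)" and hX: "hor x0 (\<Phi> x0 X)" using Phi_hor x0 v X by auto
  have "G x0 X X * G x0 v v = H (P x0) (sff x0 v v) (dP x0 (\<Phi> x0 X))"
    using clairaut_umbilic[OF cl x0 F v(1) v(1) hX] by (simp add: grad Phi_isometry[OF x0])
  also have "\<dots> = H (P x0) (sff x0 v X) (dP x0 (\<Phi> x0 v))"
    using sff_Phi[OF v(1) X] metric_on_sym[OF H P_in[OF x0]] by simp
  also have "\<dots> = G x0 X v * G x0 v X"
    using clairaut_umbilic[OF cl x0 F v(1) X hv] by (simp add: grad Phi_isometry[OF x0])
  finally have "G x0 X X * G x0 v v = 0" using v(3) by simp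
  then show ?thesis
    using metric_on_pos[OF G x0 v(2)] metric_on_pos[OF G x0, of X] by (metis less_irrefl mult_eq_0_iff)
qed

end

section \<open>Charts and tangent vectors\<close>

definition jac :: "('m, 'e::euclidean_space) chart \<Rightarrow> ('m, 'e) chart \<Rightarrow> 'm \<Rightarrow> 'e \<Rightarrow> 'e" where
  "jac c c' p = frechet_derivative (cmap c' \<circ> cinv c) (at (cmap c p))"

context
  fixes A :: "('m::{t2_space,second_countable_topology}, 'e::euclidean_space) chart set"
  assumes A: "smooth_atlas A"
begin

lemma chart_open: "c \<in> A \<Longrightarrow> open (cdom c)" "c \<in> A \<Longrightarrow> open (crange c)"
  and chart_homeomorphism: "c \<in> A \<Longrightarrow> homeomorphism (cdom c) (crange c) (cmap c) (cinv c)"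
  and transition_smooth: "c \<in> A \<Longrightarrow> c' \<in> A \<Longrightarrow> smooth_on (cmap c ` (cdom c \<inter> cdom c')) (cmap c' \<circ> cinv c)"
  and chart_cover: "\<exists>c\<in>A. p \<in> cdom c"
  using A unfolding smooth_atlas_def by blast+

lemma chart_at: "chart_at A p \<in> A" "p \<in> cdom (chart_at A p)"
  unfolding chart_at_def using someI_ex[of "\<lambda>c. c \<in> A \<and> p \<in> cdom c"] chart_cover[of p] by blast+

lemma cinv_cmap: "c \<in> A \<Longrightarrow> p \<in> cdom c \<Longrightarrow> cinv c (cmap c p) = p"
  by (rule homeomorphism_apply1[OF chart_homeomorphism])

lemma cmap_cinv: "x \<in> crange c \<Longrightarrow> cmap c (cinv c x) = x"
  by (rule f_inv_into_f)

lemma cinv_in: "x \<in> crange c \<Longrightarrow> cinv c x \<in> cdom c"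
  by (rule inv_into_into)

lemma cinv_continuous: "c \<in> A \<Longrightarrow> continuous_on (crange c) (cinv c)"
  using chart_homeomorphism unfolding homeomorphism_def by blast

lemma chart_image_eq: "c \<in> A \<Longrightarrow> cmap c ` (cdom c \<inter> W) = {x \<in> crange c. cinv c x \<in> W}"
  using cinv_cmap cmap_cinv cinv_in by (auto simp: image_iff)

lemma chart_image_open: "c \<in> A \<Longrightarrow> open W \<Longrightarrow> open (cmap c ` (cdom c \<inter> W))"
  unfolding chart_image_eq
  using continuous_open_preimage[OF cinv_continuous chart_open(2), of c W]
  by (simp add: vimage_def Int_def)

lemma transition_has_derivative:
  assumes "c \<in> A" "c' \<in> A" "p \<in> cdom c" "p \<in> cdom c'"
  shows "((cmap c' \<circ> cinv c) has_derivative jac c c' p) (at (cmap c p))"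
  unfolding jac_def by (rule smooth_on_has_derivative[OF transition_smooth]) (use assms in auto)

lemma jac_linear: "c \<in> A \<Longrightarrow> c' \<in> A \<Longrightarrow> p \<in> cdom c \<Longrightarrow> p \<in> cdom c' \<Longrightarrow> linear (jac c c' p)"
  by (rule has_derivative_linear[OF transition_has_derivative])

text \<open>The chain rule through the transition map; the two expressions of \<open>F\<close> agree
  on the overlap of the charts, which is open. Taking a third coordinate map for \<open>F\<close>
  gives the cocycle identity.\<close>

lemma chart_change_has_derivative:
  assumes "c \<in> A" "c' \<in> A" "p \<in> cdom c" "p \<in> cdom c'"
    and F: "((F \<circ> cinv c') has_derivative F') (at (cmap c' p))"
  shows "((F \<circ> cinv c) has_derivative (F' \<circ> jac c c' p)) (at (cmap c p))"
proof -
  have "((F \<circ> cinv c') has_derivative F') (at ((cmap c' \<circ> cinv c) (cmap c p)))"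
    using F cinv_cmap assms by simp
  then have "((F \<circ> cinv c') \<circ> (cmap c' \<circ> cinv c) has_derivative (F' \<circ> jac c c' p)) (at (cmap c p))"
    by (intro diff_chain_at transition_has_derivative assms)
  then show ?thesis
  proof (rule has_derivative_transform_within_open[OF _ chart_image_open[OF assms(1) chart_open(1)[OF assms(2)]]])
    show "((F \<circ> cinv c') \<circ> (cmap c' \<circ> cinv c)) x = (F \<circ> cinv c) x" if "x \<in> cmap c ` (cdom c \<inter> cdom c')" for x
      using that cinv_cmap assms by auto
  qed (use assms in auto)
qed

lemma jac_cocycle:
  assumes "c \<in> A" "c' \<in> A" "c'' \<in> A" "p \<in> cdom c" "p \<in> cdom c'" "p \<in> cdom c''"
  shows "jac c' c'' p (jac c c' p u) = jac c c'' p u"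
  using has_derivative_unique[OF chart_change_has_derivative[OF assms(1,2,4,5) transition_has_derivative[OF assms(2,3,5,6)]]
      transition_has_derivative[OF assms(1,3,4,6)]]
  by (metis comp_apply)

lemma jac_self:
  assumes "c \<in> A" "p \<in> cdom c"
  shows "jac c c p u = u"
proof -
  have "((cmap c \<circ> cinv c) has_derivative (\<lambda>x. x)) (at (cmap c p))"
    by (rule has_derivative_transform_within_open[OF has_derivative_ident chart_open(2)[OF assms(1)]])
      (use assms cinv_cmap in auto)
  then show ?thesis using has_derivative_unique[OF transition_has_derivative[OF assms(1,1,2,2)]] by metis
qed

lemma coord_vec_eq: "coord_vec A c p u = (\<lambda>c'. if c' \<in> A \<and> p \<in> cdom c' then jac c c' p u else 0)"
  by (intro ext) (simp add: coord_vec_def jac_def)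

lemma coord_vec_self: "c \<in> A \<Longrightarrow> p \<in> cdom c \<Longrightarrow> coord_vec A c p u c = u"
  by (simp add: coord_vec_eq jac_self)

lemma coord_vec_tangent: "c \<in> A \<Longrightarrow> p \<in> cdom c \<Longrightarrow> coord_vec A c p u \<in> tangent_space A p"
  unfolding tangent_space_def by (simp add: coord_vec_eq jac_cocycle jac_def[symmetric])

lemma tangent_jac: "v \<in> tangent_space A p \<Longrightarrow> c \<in> A \<Longrightarrow> c' \<in> A \<Longrightarrow> p \<in> cdom c \<Longrightarrow> p \<in> cdom c' \<Longrightarrow>
    v c' = jac c c' p (v c)"
  unfolding tangent_space_def jac_def by blast

lemma coord_vec_of_tangent:
  assumes "v \<in> tangent_space A p" "c \<in> A" "p \<in> cdom c"
  shows "coord_vec A c p (v c) = v"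
proof
  fix c'
  show "coord_vec A c p (v c) c' = v c'"
  proof (cases "c' \<in> A \<and> p \<in> cdom c'")
    case True
    then show ?thesis using tangent_jac[OF assms(1,2) _ assms(3)] by (simp add: coord_vec_eq)
  next
    case False
    then have "v c' = 0" using assms(1) unfolding tangent_space_def by blast
    then show ?thesis using False by (auto simp: coord_vec_eq)
  qed
qed

lemma coord_vec_linear:
  assumes "c \<in> A" "p \<in> cdom c"
  shows "linear (coord_vec A c p)"
  by (intro linearI ext)
    (auto simp: coord_vec_eq scaleR_fun_def linear_add[OF jac_linear] linear_scale[OF jac_linear] assms)

lemma tangent_space_eq:
  assumes c: "c \<in> A" "p \<in> cdom c"
  shows "tangent_space A p = range (coord_vec A c p)"
proof (intro equalityI subsetI)
  fix v assume "v \<in> tangent_space A p"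
  then show "v \<in> range (coord_vec A c p)"
    by (intro range_eqI[of _ _ "v c"]) (simp add: coord_vec_of_tangent[OF _ c])
next
  fix v assume "v \<in> range (coord_vec A c p)"
  then obtain u where "v = coord_vec A c p u" by blast
  then show "v \<in> tangent_space A p" using coord_vec_tangent[OF c] by simp
qed

lemma tangent_eqI:
  assumes "c \<in> A" "p \<in> cdom c" "u \<in> tangent_space A p" "v \<in> tangent_space A p" "u c = v c"
  shows "u = v"
  using coord_vec_of_tangent[OF assms(3,1,2)] coord_vec_of_tangent[OF assms(4,1,2)] assms(5) by metis

lemma zero_tangent: "0 \<in> tangent_space A p"
  using coord_vec_tangent[OF chart_at, of p 0] linear_0[OF coord_vec_linear[OF chart_at]] by simp

lemma diff_tangent: "u \<in> tangent_space A p \<Longrightarrow> v \<in> tangent_space A p \<Longrightarrow> u - v \<in> tangent_space A p"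
  unfolding tangent_space_eq[OF chart_at]
  by (auto simp: linear_diff[OF coord_vec_linear[OF chart_at], symmetric])

text \<open>Frees derivatives taken in the arbitrarily chosen \<open>chart_at\<close> from that
  choice.\<close>

lemma chart_change_frechet_derivative:
  assumes "c \<in> A" "c' \<in> A" "p \<in> cdom c" "p \<in> cdom c'" "v \<in> tangent_space A p"
    and "(F \<circ> cinv c') differentiable at (cmap c' p)"
  shows "frechet_derivative (F \<circ> cinv c) (at (cmap c p)) (v c)
    = frechet_derivative (F \<circ> cinv c') (at (cmap c' p)) (v c')"
proof -
  have "((F \<circ> cinv c) has_derivative (frechet_derivative (F \<circ> cinv c') (at (cmap c' p)) \<circ> jac c c' p)) (at (cmap c p))"
    using assms frechet_derivative_works by (intro chart_change_has_derivative) auto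
  then show ?thesis
    using frechet_derivative_at[symmetric] tangent_jac[OF assms(5,1,2,3,4)] by fastforce
qed

subsection \<open>The metric in a chart\<close>

context
  fixes g assumes g: "riemannian_metric A g"
begin

lemma
  assumes "u \<in> tangent_space A p" "v \<in> tangent_space A p" "w \<in> tangent_space A p"
  shows metric_sym: "g p u v = g p v u"
    and metric_add: "g p (u + v) w = g p u w + g p v w"
    and metric_scale: "g p (a *\<^sub>R u) w = a * g p u w"
    and metric_pos: "u \<noteq> 0 \<Longrightarrow> g p u u > 0"
  using g assms unfolding riemannian_metric_def by blast+

lemma metric_coord_eq:
  assumes "c \<in> A" "p \<in> cdom c" "u \<in> tangent_space A p" "v \<in> tangent_space A p"
  shows "g p u v = metric_coord A g c (cmap c p) (u c) (v c)"
  using assms by (simp add: metric_coord_def cinv_cmap coord_vec_of_tangent)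

lemma metric_coord_metric_on:
  assumes c: "c \<in> A"
  shows "metric_on (crange c) (metric_coord A g c)"
  unfolding metric_on_def
proof (intro conjI ballI allI impI)
  show "open (crange c)" by (rule chart_open(2)[OF c])
  show "smooth_on (crange c) (\<lambda>x. metric_coord A g c x u v)" for u v
    using g c by (auto simp: riemannian_metric_def)
  fix x assume x: "x \<in> crange c"
  note p = cinv_in[OF x]
  note t = coord_vec_tangent[OF c p]
  note l = linear_add[OF coord_vec_linear[OF c p]] linear_scale[OF coord_vec_linear[OF c p]]
  show sym: "metric_coord A g c x u v = metric_coord A g c x v u" for u v
    unfolding metric_coord_def by (rule metric_sym[OF t t t])
  have lin: "linear (\<lambda>u. metric_coord A g c x u v)" for v
    by (rule linearI) (simp_all add: metric_coord_def l metric_add[OF t t t] metric_scale[OF t t t])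
  have "linear (metric_coord A g c x u)" for u
    using lin[of u] sym[of u] by presburger
  then show "bilinear (metric_coord A g c x)" using lin by (simp add: bilinear_def)
  show "metric_coord A g c x u u > 0" if "u \<noteq> 0" for u
    unfolding metric_coord_def
  proof (rule metric_pos[OF t t t])
    show "coord_vec A c (cinv c x) u \<noteq> 0" using coord_vec_self[OF c p, of u] that by auto
  qed
qed

lemma levi_civita_coeff_eq: "levi_civita_coeff A g c x = christoffel (metric_coord A g c) x"
  unfolding levi_civita_coeff_def christoffel_def ..

lemma metric_zero_left: "v \<in> tangent_space A p \<Longrightarrow> g p 0 v = 0"
  using metric_scale[of 0 p v v 0] zero_tangent by simp

text \<open>The description in \<open>grad\<close> has a unique solution because the metric
  represents the differential of \<open>f\<close>. This is carried out in
  \<open>chart_at A p\<close>, the chart in which \<open>dir_deriv\<close> is evaluated.\<close>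

lemma grad_props:
  assumes f: "smooth_fun A f"
  shows "grad A g f p \<in> tangent_space A p"
    "v \<in> tangent_space A p \<Longrightarrow> g p (grad A g f p) v = dir_deriv A p v f"
proof -
  define c where "c = chart_at A p"
  have c: "c \<in> A" "p \<in> cdom c" unfolding c_def by (rule chart_at)+
  have x: "cmap c p \<in> crange c" using c by simp
  note G = metric_coord_metric_on[OF c(1)]
  define F' where "F' = frechet_derivative (f \<circ> cinv c) (at (cmap c p))"
  have "(f \<circ> cinv c) differentiable (at (cmap c p))"
    by (rule smooth_on_differentiable[OF _ x]) (use f c in \<open>auto simp: smooth_fun_def\<close>)
  then have "linear F'" unfolding F'_def by (rule linear_frechet_derivative)
  from ex1_riesz[OF metric_on_bilinear[OF G x] metric_on_pos[OF G x] this]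
  obtain y where y: "\<And>w. metric_coord A g c (cmap c p) y w = F' w" by blast
  have dd: "dir_deriv A p v f = F' (v c)" for v
    by (simp add: dir_deriv_def c_def[symmetric] Let_def F'_def)
  define Y where "Y = coord_vec A c p y"
  have Y: "Y \<in> tangent_space A p" "Y c = y"
    unfolding Y_def by (rule coord_vec_tangent[OF c], rule coord_vec_self[OF c])
  have Yg: "g p Y v = dir_deriv A p v f" if "v \<in> tangent_space A p" for v
    by (simp add: metric_coord_eq[OF c Y(1) that] Y(2) y dd)
  have "\<exists>!u. u \<in> tangent_space A p \<and> (\<forall>v\<in>tangent_space A p. g p u v = dir_deriv A p v f)"
  proof (rule ex1I[of _ Y])
    show "Y \<in> tangent_space A p \<and> (\<forall>v\<in>tangent_space A p. g p Y v = dir_deriv A p v f)" using Y Yg by blast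
    fix Z assume Z: "Z \<in> tangent_space A p \<and> (\<forall>v\<in>tangent_space A p. g p Z v = dir_deriv A p v f)"
    have "metric_coord A g c (cmap c p) (Z c) w = metric_coord A g c (cmap c p) (Y c) w" for w
      using Z Yg[OF coord_vec_tangent[OF c]] metric_coord_eq[OF c _ coord_vec_tangent[OF c], of Z w]
        metric_coord_eq[OF c Y(1) coord_vec_tangent[OF c], of w] coord_vec_tangent[OF c, of w]
      by (simp add: coord_vec_self[OF c])
    then have "Z c = Y c" by (rule metric_on_eqI[OF G x])
    then show "Z = Y" using tangent_eqI[OF c _ Y(1)] Z by blast
  qed
  from theI'[OF this]
  show "grad A g f p \<in> tangent_space A p"
    "v \<in> tangent_space A p \<Longrightarrow> g p (grad A g f p) v = dir_deriv A p v f"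
    unfolding grad_def[symmetric] by auto
qed

subsection \<open>Geodesics given in a chart\<close>

text \<open>Smoothness and velocity have to be known in all charts, so both are transported from
  \<open>c\<close> by the transition maps; for the geodesic equation the chart \<open>c\<close>
  alone is enough.\<close>

lemma
  assumes c: "c \<in> A" and U: "U \<subseteq> crange c" "open U" and geo: "geodesic_in U (metric_coord A g c) I y w"
    and I: "open I" "is_interval I" and sm: "smooth_on I y"
  shows geodesic_of_coord: "geodesic A g I (\<lambda>s. cinv c (y s))"
    and velocity_of_coord: "s \<in> I \<Longrightarrow>
      velocity A (\<lambda>s. cinv c (y s)) s = coord_vec A c (cinv c (y s)) (w s)"
proof -
  define h where "h s = cinv c (y s)" for s
  have y: "y s \<in> crange c" "(y has_vector_derivative w s) (at s)"
      "(w has_vector_derivative - christoffel (metric_coord A g c) (y s) (w s) (w s)) (at s)" if "s \<in> I" for s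
    using geo U that by (auto simp: geodesic_in_def)
  have hc: "h s \<in> cdom c" "cmap c (h s) = y s" if "s \<in> I" for s
    unfolding h_def by (rule cinv_in[OF y(1)[OF that]], rule cmap_cinv[OF y(1)[OF that]])
  have "continuous_on I y"
    using sm unfolding smooth_on_def by (metis Ck_on.simps(1))
  then have cont: "continuous_on I h"
    unfolding h_def by (rule continuous_on_compose2[OF cinv_continuous[OF c]]) (use y in auto)
  have opn: "open {s \<in> I. h s \<in> W}" if "open W" for W
    using continuous_open_preimage[OF cont I(1) that] by (simp add: vimage_def Int_def)
  have smooth: "smooth_on {s \<in> I. h s \<in> cdom c'} (cmap c' \<circ> h)" if c': "c' \<in> A" for c'
    unfolding smooth_on_def
  proof
    fix k
    have "Ck_on k {s \<in> I. h s \<in> cdom c'} (\<lambda>s. (cmap c' \<circ> cinv c) (y s))"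
    proof (rule Ck_on_compose[where f=y and g="cmap c' \<circ> cinv c", OF opn[OF chart_open(1)[OF c']] chart_image_open[OF c chart_open(1)[OF c']]])
      show "Ck_on k {s \<in> I. h s \<in> cdom c'} y"
        using sm by (auto simp: smooth_on_def intro: Ck_on_subset)
      show "Ck_on k (cmap c ` (cdom c \<inter> cdom c')) (cmap c' \<circ> cinv c)"
        using transition_smooth[OF c c'] by (simp add: smooth_on_def)
      show "y ` {s \<in> I. h s \<in> cdom c'} \<subseteq> cmap c ` (cdom c \<inter> cdom c')"
        unfolding chart_image_eq[OF c] using y(1) by (auto simp: h_def)
    qed
    then show "Ck_on k {s \<in> I. h s \<in> cdom c'} (cmap c' \<circ> h)" by (simp add: o_def h_def)
  qed
  have vel: "velocity A h s = coord_vec A c (h s) (w s)" if s: "s \<in> I" for s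
  proof
    fix c'
    have "((cmap c' \<circ> cinv c) \<circ> y has_vector_derivative jac c c' (h s) (w s)) (at s)"
      if c': "c' \<in> A" "h s \<in> cdom c'"
    proof -
      have tr: "((cmap c' \<circ> cinv c) has_derivative jac c c' (h s)) (at (y s))"
        using transition_has_derivative[OF c c'(1) hc(1)[OF s] c'(2)] hc(2)[OF s] by simp
      show ?thesis
        using diff_chain_at[OF y(2)[OF s, unfolded has_vector_derivative_def] tr]
          linear_scale[OF jac_linear[OF c c'(1) hc(1)[OF s] c'(2)]]
        by (simp add: has_vector_derivative_def o_def)
    qed
    then have "vector_derivative (cmap c' \<circ> h) (at s) = jac c c' (h s) (w s)"
      if "c' \<in> A" "h s \<in> cdom c'"
      using that by (simp add: vector_derivative_at o_def h_def)
    then show "velocity A h s c' = coord_vec A c (h s) (w s) c'"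
      by (simp add: velocity_def coord_vec_eq)
  qed
  then show "s \<in> I \<Longrightarrow> velocity A (\<lambda>s. cinv c (y s)) s = coord_vec A c (cinv c (y s)) (w s)"
    by (simp add: h_def[abs_def])
  have velc: "velocity A h s c = w s" if "s \<in> I" for s
    by (simp add: vel[OF that] coord_vec_self[OF c hc(1)[OF that]])
  have "geodesic A g I h"
    unfolding geodesic_def smooth_curve_def
  proof (intro conjI ballI I cont smooth)
    fix s assume s: "s \<in> I"
    have "((\<lambda>t. velocity A h t c) has_vector_derivative
        - christoffel (metric_coord A g c) (y s) (w s) (w s)) (at s)"
      by (rule has_vector_derivative_transform_within_open[OF y(3)[OF s] I(1) s]) (simp add: velc)
    then have "vector_derivative (\<lambda>t. velocity A h t c) (at s) +
        levi_civita_coeff A g c (cmap c (h s)) (velocity A h s c) (velocity A h s c) = 0"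
      by (simp add: vector_derivative_at levi_civita_coeff_eq hc(2)[OF s] velc[OF s])
    then show "\<exists>c\<in>A. h s \<in> cdom c \<and> vector_derivative (\<lambda>t. velocity A h t c) (at s) +
        levi_civita_coeff A g c (cmap c (h s)) (velocity A h s c) (velocity A h s c) = 0"
      using c hc(1)[OF s] by blast
  qed
  then show "geodesic A g I (\<lambda>s. cinv c (y s))" by (simp add: h_def[abs_def])
qed

end

subsection \<open>Global vector fields with a prescribed value\<close>

text \<open>A coordinate field is cut off by a bump function and extended by zero. Its value at
  \<open>p\<close> is a positive multiple of \<open>u\<close>, a factor that can be divided out of
  tensorial identities.\<close>

lemma ex_vector_field:
  assumes c: "c \<in> A" and p: "p \<in> cdom c"
  shows "\<exists>E \<beta>. vector_field A E \<and> smooth_on UNIV \<beta> \<and> \<beta> (cmap c p) > 0 \<and>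
    (\<forall>q\<in>cdom c. E q = coord_vec A c q (\<beta> (cmap c q) *\<^sub>R u))"
proof -
  have "cmap c p \<in> crange c" using p by simp
  then obtain r where r: "r > 0" "cball (cmap c p) r \<subseteq> crange c"
    using chart_open(2)[OF c] open_contains_cball by blast
  define K where "K = cball (cmap c p) r"
  obtain \<beta> :: "'e \<Rightarrow> real" where b: "smooth_on UNIV \<beta>" "\<beta> (cmap c p) > 0" "\<And>x. x \<notin> K \<Longrightarrow> \<beta> x = 0"
    using smooth_bump[OF r(1), of "cmap c p"] unfolding K_def by blast
  have "compact (cinv c ` K)"
    using r(2) by (intro compact_continuous_image continuous_on_subset[OF cinv_continuous[OF c]]) (auto simp: K_def)
  \<comment> \<open>A compact set is closed because the manifold is Hausdorff, so the field vanishes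
    on an open set that covers the manifold together with the domain of \<open>c\<close>.\<close>
  then have K: "open (- (cinv c ` K))" using compact_imp_closed by blast
  have Kd: "cinv c ` K \<subseteq> cdom c" using r(2) cinv_in[of _ c] unfolding K_def by blast
  define E where "E q = (if q \<in> cdom c then coord_vec A c q (\<beta> (cmap c q) *\<^sub>R u) else 0)" for q
  have E0: "E q = 0" if "q \<notin> cinv c ` K" for q
  proof (cases "q \<in> cdom c")
    case True
    then have "cmap c q \<notin> K" using that cinv_cmap[OF c True] by (metis image_eqI)
    then show ?thesis using b(3) linear_0[OF coord_vec_linear[OF c True]] True by (simp add: E_def)
  qed (simp add: E_def)
  have "smooth_on (crange c') (\<lambda>x. E (cinv c' x) c')" if c': "c' \<in> A" for c'
    unfolding smooth_on_def
  proof (intro allI Ck_on_local)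
    fix k x assume x: "x \<in> crange c'"
    \<comment> \<open>On \<open>W1\<close> the field is a smooth expression in the transition maps,
      on \<open>W2\<close> it is zero; both sets are open and together they cover the range of
      \<open>c'\<close>.\<close>
    define W1 where "W1 = cmap c' ` (cdom c' \<inter> cdom c)"
    define W2 where "W2 = cmap c' ` (cdom c' \<inter> - (cinv c ` K))"
    have W: "open W1" "open W2"
      unfolding W1_def W2_def by (rule chart_image_open[OF c' chart_open(1)[OF c]], rule chart_image_open[OF c' K])
    show "\<exists>N. open N \<and> x \<in> N \<and> Ck_on k N (\<lambda>x. E (cinv c' x) c')"
    proof (cases "x \<in> W1")
      case True
      have \<tau>: "Ck_on k W1 (cmap c \<circ> cinv c')"
        using transition_smooth[OF c' c] by (simp add: smooth_on_def W1_def)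
      have "Ck_on k W1 (\<lambda>y. \<beta> ((cmap c \<circ> cinv c') y))"
        by (rule Ck_on_compose[where f="cmap c \<circ> cinv c'" and g=\<beta>, OF W(1) open_UNIV _ \<tau>]) (use b in \<open>auto simp: smooth_on_def\<close>)
      moreover have "Ck_on k W1 (\<lambda>y. (\<lambda>z. frechet_derivative (cmap c' \<circ> cinv c) (at z) u) ((cmap c \<circ> cinv c') y))"
      proof (rule Ck_on_compose[where f="cmap c \<circ> cinv c'" and
            g="\<lambda>z. frechet_derivative (cmap c' \<circ> cinv c) (at z) u", OF W(1) chart_image_open[OF c chart_open(1)[OF c']] _ \<tau>])
        show "(cmap c \<circ> cinv c') ` W1 \<subseteq> cmap c ` (cdom c \<inter> cdom c')"
          using cinv_cmap[OF c'] by (auto simp: W1_def)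
        show "Ck_on k (cmap c ` (cdom c \<inter> cdom c')) (\<lambda>z. frechet_derivative (cmap c' \<circ> cinv c) (at z) u)"
          using smooth_on_frechet_derivative[OF transition_smooth[OF c c']] by (simp add: smooth_on_def)
      qed
      ultimately have "Ck_on k W1 (\<lambda>y. \<beta> ((cmap c \<circ> cinv c') y) *\<^sub>R
          (\<lambda>z. frechet_derivative (cmap c' \<circ> cinv c) (at z) u) ((cmap c \<circ> cinv c') y))"
        by (intro Ck_on_scaleR W)
      then have "Ck_on k W1 (\<lambda>x. E (cinv c' x) c')"
      proof (rule Ck_on_cong[OF W(1)])
        fix y assume "y \<in> W1"
        then have y: "cinv c' y \<in> cdom c'" "cinv c' y \<in> cdom c"
          using cinv_cmap[OF c'] by (auto simp: W1_def)
        show "\<beta> ((cmap c \<circ> cinv c') y) *\<^sub>R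
          (\<lambda>z. frechet_derivative (cmap c' \<circ> cinv c) (at z) u) ((cmap c \<circ> cinv c') y) = E (cinv c' y) c'"
          using y c' linear_scale[OF jac_linear[OF c c' y(2,1)]] by (simp add: E_def coord_vec_eq jac_def)
      qed
      then show ?thesis using W True by blast
    next
      case False
      then have "x \<in> W2" using x Kd unfolding W1_def W2_def by blast
      moreover have "Ck_on k W2 (\<lambda>x. E (cinv c' x) c')"
        by (rule Ck_on_cong[OF W(2) Ck_on_const[OF W(2)]]) (use cinv_cmap[OF c'] E0 in \<open>auto simp: W2_def\<close>)
      ultimately show ?thesis using W by blast
    qed
  qed
  moreover have "E q \<in> tangent_space A q" for q
    using coord_vec_tangent[OF c] zero_tangent by (simp add: E_def)
  ultimately have "vector_field A E" by (simp add: vector_field_def)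
  then show ?thesis using b by (intro exI[of _ E] exI[of _ \<beta>]) (simp add: E_def)
qed

end

section \<open>Submersions in charts\<close>

lemma metric_on_subset: "metric_on U G \<Longrightarrow> open V \<Longrightarrow> V \<subseteq> U \<Longrightarrow> metric_on V G"
  unfolding metric_on_def by (meson smooth_on_subset subsetD)

lemma differential_coord:
  assumes A: "smooth_atlas A" and \<pi>: "smooth_map A B \<pi>"
    and c: "c \<in> A" "p \<in> cdom c" and d: "d \<in> B" "\<pi> p \<in> cdom d" and v: "v \<in> tangent_space A p"
  shows "differential A B \<pi> p v d = frechet_derivative (cmap d \<circ> \<pi> \<circ> cinv c) (at (cmap c p)) (v c)"
proof -
  have sm: "smooth_on (cmap c ` (cdom c \<inter> \<pi> -` cdom d)) ((cmap d \<circ> \<pi>) \<circ> cinv c)"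
    using \<pi> c d by (simp add: smooth_map_def)
  have "((cmap d \<circ> \<pi>) \<circ> cinv c) differentiable (at (cmap c p))"
    by (rule smooth_on_differentiable[OF sm]) (use c d in auto)
  from chart_change_frechet_derivative[OF A chart_at(1)[OF A] c(1) chart_at(2)[OF A] c(2) v this]
  show ?thesis using d by (simp add: differential_def Let_def)
qed

section \<open>A Riemannian submersion read in one chart of each manifold\<close>

locale submersion_charts =
  fixes A :: "('m::{t2_space,second_countable_topology}, 'e::euclidean_space) chart set"
    and g :: "('m, 'e) metric"
    and B :: "('n::{t2_space,second_countable_topology}, 'k::euclidean_space) chart set"
    and gN :: "('n, 'k) metric" and \<pi> :: "'m \<Rightarrow> 'n"
    and c :: "('m, 'e) chart" and d :: "('n, 'k) chart"
  assumes sub: "riemannian_submersion A g B gN \<pi>" and c: "c \<in> A" and d: "d \<in> B"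
begin

definition U :: "'e set" where "U = cmap c ` (cdom c \<inter> \<pi> -` cdom d)"
definition P :: "'e \<Rightarrow> 'k" where "P = cmap d \<circ> \<pi> \<circ> cinv c"

lemma A: "smooth_atlas A" and B: "smooth_atlas B"
  and g: "riemannian_metric A g" and gN: "riemannian_metric B gN"
  and \<pi>_smooth: "smooth_map A B \<pi>"
  and differential_image: "differential A B \<pi> p ` tangent_space A p = tangent_space B (\<pi> p)"
  and differential_isometry: "u \<in> horizontal A g B \<pi> p \<Longrightarrow>
    tnorm gN (\<pi> p) (differential A B \<pi> p u) = tnorm g p u"
  using sub unfolding riemannian_submersion_def riemannian_manifold_def by blast+

lemma U_iff: "x \<in> U \<longleftrightarrow> x \<in> crange c \<and> \<pi> (cinv c x) \<in> cdom d"
  unfolding U_def chart_image_eq[OF A c] by simp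

lemma U_open: "open U"
proof -
  have "continuous_on UNIV \<pi>" using \<pi>_smooth by (simp add: smooth_map_def)
  then have "open (\<pi> -` cdom d)"
    using continuous_open_preimage[OF _ open_UNIV chart_open(1)[OF B d]] by simp
  then show ?thesis unfolding U_def by (rule chart_image_open[OF A c])
qed

lemma U_point:
  assumes "x \<in> U"
  shows "x \<in> crange c" "cinv c x \<in> cdom c" "cmap c (cinv c x) = x" "\<pi> (cinv c x) \<in> cdom d"
    "P x = cmap d (\<pi> (cinv c x))"
  using assms cinv_in[OF A, of x c] cmap_cinv[OF A, of x c] unfolding U_iff P_def by auto

lemma P_smooth: "smooth_on U P"
  unfolding U_def P_def using \<pi>_smooth c d by (simp add: smooth_map_def)

lemma differential_P:
  assumes x: "x \<in> U" and v: "v \<in> tangent_space A (cinv c x)"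
  shows "differential A B \<pi> (cinv c x) v d = frechet_derivative P (at x) (v c)"
  using differential_coord[OF A \<pi>_smooth c U_point(2)[OF x] d U_point(4)[OF x] v]
  by (simp add: U_point(3)[OF x] P_def)

lemma differential_tangent: "v \<in> tangent_space A p \<Longrightarrow> differential A B \<pi> p v \<in> tangent_space B (\<pi> p)"
  using differential_image by blast

text \<open>A tangent vector of \<open>N\<close> vanishes as soon as its representation in the
  single chart \<open>d\<close> does.\<close>

lemma vertical_iff:
  assumes x: "x \<in> U"
  shows "v \<in> vertical A B \<pi> (cinv c x) \<longleftrightarrow>
    v \<in> tangent_space A (cinv c x) \<and> frechet_derivative P (at x) (v c) = 0"
proof (cases "v \<in> tangent_space A (cinv c x)")
  case True
  have "differential A B \<pi> (cinv c x) v = 0 \<longleftrightarrow> differential A B \<pi> (cinv c x) v d = 0"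
    using tangent_eqI[OF B d U_point(4)[OF x] differential_tangent[OF True] zero_tangent[OF B]] by auto
  then show ?thesis using True differential_P[OF x True] by (simp add: vertical_def)
qed (simp add: vertical_def)

lemma coord_vertical_iff:
  assumes x: "x \<in> U"
  shows "coord_vec A c (cinv c x) u \<in> vertical A B \<pi> (cinv c x) \<longleftrightarrow> frechet_derivative P (at x) u = 0"
  by (simp add: vertical_iff[OF x] coord_vec_tangent[OF A c U_point(2)[OF x]] coord_vec_self[OF A c U_point(2)[OF x]])

lemma metric_coord_at:
  assumes x: "x \<in> U" and "u \<in> tangent_space A (cinv c x)" "v \<in> tangent_space A (cinv c x)"
  shows "g (cinv c x) u v = metric_coord A g c x (u c) (v c)"
  using metric_coord_eq[OF A g c U_point(2)[OF x] assms(2,3)] by (simp add: U_point(3)[OF x])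

lemma horizontal_iff:
  assumes x: "x \<in> U"
  shows "v \<in> horizontal A g B \<pi> (cinv c x) \<longleftrightarrow> v \<in> tangent_space A (cinv c x) \<and>
    (\<forall>u. frechet_derivative P (at x) u = 0 \<longrightarrow> metric_coord A g c x (v c) u = 0)"
proof (cases "v \<in> tangent_space A (cinv c x)")
  case True
  note p = c U_point(2)[OF x]
  have "(\<forall>w\<in>vertical A B \<pi> (cinv c x). g (cinv c x) v w = 0) \<longleftrightarrow>
    (\<forall>u. frechet_derivative P (at x) u = 0 \<longrightarrow> metric_coord A g c x (v c) u = 0)"
  proof (intro iffI ballI allI impI)
    fix u assume h: "\<forall>w\<in>vertical A B \<pi> (cinv c x). g (cinv c x) v w = 0" "frechet_derivative P (at x) u = 0"
    then have "g (cinv c x) v (coord_vec A c (cinv c x) u) = 0" using coord_vertical_iff[OF x] by blast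
    then show "metric_coord A g c x (v c) u = 0"
      by (simp add: metric_coord_at[OF x True coord_vec_tangent[OF A p]] coord_vec_self[OF A p])
  next
    fix w assume "\<forall>u. frechet_derivative P (at x) u = 0 \<longrightarrow> metric_coord A g c x (v c) u = 0"
      "w \<in> vertical A B \<pi> (cinv c x)"
    then show "g (cinv c x) v w = 0"
      using vertical_iff[OF x, of w] metric_coord_at[OF x True, of w] by simp
  qed
  then show ?thesis using True by (simp add: horizontal_def)
qed (simp add: horizontal_def)

lemma differential_norm:
  assumes x: "x \<in> U" and v: "v \<in> tangent_space A (cinv c x)"
  shows "gN (\<pi> (cinv c x)) (differential A B \<pi> (cinv c x) v) (differential A B \<pi> (cinv c x) v)
    = metric_coord B gN d (P x) (frechet_derivative P (at x) (v c)) (frechet_derivative P (at x) (v c))"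
  using metric_coord_eq[OF B gN d U_point(4)[OF x] differential_tangent[OF v] differential_tangent[OF v]]
  by (simp add: differential_P[OF x v] U_point(5)[OF x])

sublocale local_submersion U "metric_coord A g c" "crange d" "metric_coord B gN d" P
proof
  show "metric_on U (metric_coord A g c)"
    by (rule metric_on_subset[OF metric_coord_metric_on[OF A g c] U_open]) (use U_iff in blast)
  show "metric_on (crange d) (metric_coord B gN d)"
    by (rule metric_coord_metric_on[OF B gN d])
  show "smooth_on U P" by (rule P_smooth)
  show "P ` U \<subseteq> crange d" using U_point(4,5) by auto
next
  fix x assume x: "x \<in> U"
  note p = c U_point(2)[OF x]
  show "surj (frechet_derivative P (at x))"
    unfolding surj_def
  proof
    fix k
    have "coord_vec B d (\<pi> (cinv c x)) k \<in> tangent_space B (\<pi> (cinv c x))"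
      by (rule coord_vec_tangent[OF B d U_point(4)[OF x]])
    then obtain v where v: "v \<in> tangent_space A (cinv c x)"
        "coord_vec B d (\<pi> (cinv c x)) k = differential A B \<pi> (cinv c x) v"
      using differential_image[of "cinv c x"] by blast
    have "k = frechet_derivative P (at x) (v c)"
      using differential_P[OF x v(1)] coord_vec_self[OF B d U_point(4)[OF x], of k] v(2) by simp
    then show "\<exists>y. k = frechet_derivative P (at x) y" by blast
  qed
  fix u assume u: "\<And>v. frechet_derivative P (at x) v = 0 \<Longrightarrow> metric_coord A g c x u v = 0"
  define v where "v = coord_vec A c (cinv c x) u"
  have v: "v \<in> tangent_space A (cinv c x)" "v c = u"
    unfolding v_def by (rule coord_vec_tangent[OF A p], rule coord_vec_self[OF A p])
  have "v \<in> horizontal A g B \<pi> (cinv c x)" using u v by (simp add: horizontal_iff[OF x])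
  from differential_isometry[OF this]
  show "metric_coord B gN d (P x) (frechet_derivative P (at x) u) (frechet_derivative P (at x) u)
      = metric_coord A g c x u u"
    by (simp add: tnorm_def differential_norm[OF x v(1)] metric_coord_at[OF x v(1) v(1)] v(2))
qed

lemma horizontal_hor:
  assumes "x \<in> U"
  shows "v \<in> horizontal A g B \<pi> (cinv c x) \<longleftrightarrow> v \<in> tangent_space A (cinv c x) \<and> hor x (v c)"
  by (simp add: horizontal_iff[OF assms] hor_def dP_def)

lemma hor_proj_coord:
  assumes x: "x \<in> U" and v: "v \<in> tangent_space A (cinv c x)"
  shows "hor_proj A g B \<pi> (cinv c x) v = coord_vec A c (cinv c x) (hlift x (v c))"
  unfolding hor_proj_def
proof (rule the_equality)
  note p = c U_point(2)[OF x]
  note l = linear_diff[OF dP_linear[OF x]]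
  define h where "h = coord_vec A c (cinv c x) (hlift x (v c))"
  have h: "h \<in> tangent_space A (cinv c x)" "h c = hlift x (v c)"
    unfolding h_def by (rule coord_vec_tangent[OF A p], rule coord_vec_self[OF A p])
  show "h \<in> horizontal A g B \<pi> (cinv c x) \<and> v - h \<in> vertical A B \<pi> (cinv c x)"
    using h hlift[OF x] diff_tangent[OF A v h(1)]
    by (simp add: horizontal_hor[OF x] vertical_iff[OF x] dP_def[symmetric] l)
  fix u assume u: "u \<in> horizontal A g B \<pi> (cinv c x) \<and> v - u \<in> vertical A B \<pi> (cinv c x)"
  then have ut: "u \<in> tangent_space A (cinv c x)" "hor x (u c)" by (auto simp: horizontal_hor[OF x])
  have "dP x (u c) = dP x (v c)"
    using u by (simp add: vertical_iff[OF x] dP_def[symmetric] l)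
  then have "u c = h c"
    by (intro metric_on_eqI[OF G x]) (simp add: hor_inner[OF x ut(2)] h(2) hlift_inner[OF x])
  then show "u = h" by (rule tangent_eqI[OF A p ut(1) h(1)])
qed

text \<open>Here \<open>b\<close> is the squared length of \<open>v\<close>, \<open>a\<close> that
  of its horizontal part, measured in the target, and \<open>b - a\<close> that of its vertical
  part. Hence \<open>0 \<le> a\<close> and \<open>a \<le> b\<close>, the argument of
  \<open>arccos\<close> is in range, and the square of the sine is rational in \<open>a\<close> and
  \<open>b\<close>.\<close>

lemma sin_hor_angle:
  assumes x: "x \<in> U" and v: "v \<in> tangent_space A (cinv c x)" "v c \<noteq> 0"
  defines "a \<equiv> metric_coord B gN d (P x) (dP x (v c)) (dP x (v c))"
    and "b \<equiv> metric_coord A g c x (v c) (v c)"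
  shows "(sin (hor_angle A g B \<pi> (cinv c x) v))\<^sup>2 = (b - a) / b" "b > 0"
proof -
  note p = c U_point(2)[OF x]
  note t = coord_vec_tangent[OF A p]
  define h where "h = hlift x (v c)"
  have h: "hor x h" "dP x h = dP x (v c)" unfolding h_def by (rule hlift[OF x])+
  have hh: "metric_coord A g c x h h = a" using hor_isometry[OF x h(1)] h(2) by (simp add: a_def)
  have nonneg: "metric_coord A g c x u u \<ge> 0" for u
    using metric_on_pos[OF G x, of u] linear_0[OF metric_on_linear(1)[OF G x]] by (cases "u = 0") (auto intro: less_imp_le)
  show b: "b > 0" unfolding b_def by (rule metric_on_pos[OF G x v(2)])
  have hv: "metric_coord A g c x h (v c) = a"
    using hor_inner[OF x h(1), of "v c"] h(2) by (simp add: a_def)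
  have "metric_coord A g c x (v c - h) (v c - h) = b - a"
    using metric_on_sym[OF G x, of "v c" h]
    by (simp add: linear_diff[OF metric_on_linear(1)[OF G x]] linear_diff[OF metric_on_linear(2)[OF G x]] hh hv b_def)
  then have ab: "a \<ge> 0" "a \<le> b" using nonneg[of h] nonneg[of "v c - h"] hh by auto
  have cos: "tnorm g (cinv c x) (hor_proj A g B \<pi> (cinv c x) v) / tnorm g (cinv c x) v = sqrt (a / b)"
    unfolding hor_proj_coord[OF x v(1)] tnorm_def metric_coord_at[OF x v(1) v(1)] metric_coord_at[OF x t t]
    by (simp add: coord_vec_self[OF A p] h_def[symmetric] hh b_def real_sqrt_divide)
  have "0 \<le> sqrt (a / b)" "sqrt (a / b) \<le> 1" using ab b by (auto simp: field_simps)
  then have "sin (hor_angle A g B \<pi> (cinv c x) v) = sqrt (1 - (sqrt (a / b))\<^sup>2)"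
    unfolding hor_angle_def cos by (intro sin_arccos) linarith+
  then show "(sin (hor_angle A g B \<pi> (cinv c x) v))\<^sup>2 = (b - a) / b"
    using ab b by (simp add: field_simps)
qed

text \<open>If \<open>k\<close> is the Clairaut constant and \<open>b\<close> the constant squared
  speed, the local expression equals \<open>k\<^sup>2 * b\<close>. Constancy of the speed also keeps
  the velocity nonzero, as the formula for the angle requires.\<close>

lemma clairaut_local_of_clairaut:
  assumes cl: "clairaut_submersion A g B gN \<pi> (\<lambda>p. exp (f p))"
  shows "clairaut_local (f \<circ> cinv c)"
  unfolding clairaut_local_def
proof (intro allI impI)
  fix \<epsilon> y w
  assume e: "\<epsilon> > 0" and geo: "geodesic_in U (metric_coord A g c) {-\<epsilon><..<\<epsilon>} y w"
    and sm: "smooth_on {-\<epsilon><..<\<epsilon>} y" and w0: "w 0 \<noteq> (0::'e)"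
  define I where "I = {-\<epsilon><..<\<epsilon>}"
  have I: "open I" "is_interval I" "convex I" "0 \<in> I"
    using e by (auto simp: I_def is_interval_convex_1)
  have yU: "y s \<in> U" if "s \<in> I" for s using geo that by (simp add: geodesic_in_def I_def)
  have Uc: "U \<subseteq> crange c" using U_iff by blast
  note geo' = geo[folded I_def] and sm' = sm[folded I_def]
  define h where "h s = cinv c (y s)" for s
  have gh: "geodesic A g I h"
    using geodesic_of_coord[OF A g c Uc U_open geo' I(1,2) sm'] by (simp add: h_def[abs_def])
  have vel: "velocity A h s = coord_vec A c (h s) (w s)" if "s \<in> I" for s
    using velocity_of_coord[OF A g c Uc U_open geo' I(1,2) sm' that] by (simp add: h_def[abs_def])
  obtain k where k: "\<And>s. s \<in> I \<Longrightarrow> exp (f (h s)) * sin (hor_angle A g B \<pi> (h s) (velocity A h s)) = k"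
    using cl gh unfolding clairaut_submersion_def constant_on_def by blast
  define b where "b = metric_coord A g c (y 0) (w 0) (w 0)"
  have b: "metric_coord A g c (y s) (w s) (w s) = b" if "s \<in> I" for s
    unfolding b_def by (rule geodesic_in_speed_constant[OF G geo' I(3) that I(4)])
  have b0: "b > 0" unfolding b_def by (rule metric_on_pos[OF G yU[OF I(4)] w0])
  have "exp (2 * (f \<circ> cinv c) (y s)) * (metric_coord A g c (y s) (w s) (w s) -
      metric_coord B gN d (P (y s)) (dP (y s) (w s)) (dP (y s) (w s))) = k\<^sup>2 * b" if s: "s \<in> I" for s
  proof -
    note p = c U_point(2)[OF yU[OF s]]
    have "w s \<noteq> 0"
      using b[OF s] b0 linear_0[OF metric_on_linear(1)[OF G yU[OF s]]] by force
    then have *: "(sin (hor_angle A g B \<pi> (h s) (velocity A h s)))\<^sup>2 =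
      (b - metric_coord B gN d (P (y s)) (dP (y s) (w s)) (dP (y s) (w s))) / b"
      using sin_hor_angle(1)[OF yU[OF s] coord_vec_tangent[OF A p], of "w s"]
      by (simp add: vel[OF s] h_def coord_vec_self[OF A p] b[OF s])
    have "k\<^sup>2 = exp (2 * f (h s)) * (sin (hor_angle A g B \<pi> (h s) (velocity A h s)))\<^sup>2"
      unfolding k[OF s, symmetric] by (simp add: power_mult_distrib exp_double)
    then show ?thesis
      unfolding * using b0 by (simp add: b[OF s] h_def)
  qed
  then show "(\<lambda>s. exp (2 * (f \<circ> cinv c) (y s)) * (metric_coord A g c (y s) (w s) (w s) -
      metric_coord B gN d (P (y s)) (dP (y s) (w s)) (dP (y s) (w s)))) constant_on {-\<epsilon><..<\<epsilon>}"
    unfolding constant_on_def I_def by blast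
qed

lemma vertical_eq: "x \<in> U \<Longrightarrow> vertical A B \<pi> (cinv c x) = coord_vec A c (cinv c x) ` {u. dP x u = 0}"
  using coord_vertical_iff[of x] vertical_iff[of x] coord_vec_of_tangent[OF A _ c U_point(2)[of x]]
  by (auto simp: dP_def image_iff) metis

end

section \<open>Dimensions and orthogonal vectors in kernels\<close>

lemma dim_kernel_surj:
  fixes L :: "'e::euclidean_space \<Rightarrow> 'k::euclidean_space"
  assumes L: "linear L" "surj L"
  shows "dim {u. L u = 0} + DIM('k) = DIM('e)"
proof -
  \<comment> \<open>The domain is the direct sum of the kernel of \<open>L\<close> and the image of
    a right inverse.\<close>
  obtain R where R: "linear R" "L \<circ> R = id" using linear_surjective_right_inverse[OF L] by blast
  have LR: "L (R y) = y" for y using R(2) by (metis comp_apply id_apply)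
  have "inj R" using LR by (metis injI)
  have "dim (range R) = DIM('k)" using dim_image_eq[OF R(1), of UNIV] \<open>inj R\<close> by (simp add: span_UNIV)
  moreover have "{u. L u = 0} \<inter> range R = {0}" using LR linear_0[OF R(1)] linear_0[OF L(1)] by auto
  moreover have "{x + y |x y. x \<in> {u. L u = 0} \<and> y \<in> range R} = UNIV"
  proof -
    have "u \<in> {x + y |x y. x \<in> {u. L u = 0} \<and> y \<in> range R}" for u
    proof -
      have "u = (u - R (L u)) + R (L u)" "L (u - R (L u)) = 0"
        using LR linear_diff[OF L(1)] by auto
      then show ?thesis by blast
    qed
    then show ?thesis by blast
  qed
  ultimately show ?thesis
    using dim_sums_Int[OF linear_subspace_kernel[OF L(1)] linear_subspace_image[OF R(1) subspace_UNIV]] by simp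
qed

text \<open>The target is a mere real vector space, since tangent vectors are functions on charts; a
  maximal independent subset of \<open>S\<close> is carried over.\<close>

lemma dim_linear_image_inj:
  fixes L :: "'e::euclidean_space \<Rightarrow> 'v::real_vector"
  assumes L: "linear L" "inj L"
  shows "dim (L ` S) = dim S"
proof -
  obtain K where K: "K \<subseteq> S" "independent K" "S \<subseteq> span K" "card K = dim S" using basis_exists by blast
  have "independent (L ` K)"
    by (rule linear_independent_injective_image[OF L(1) K(2) inj_on_subset[OF L(2)]]) simp
  moreover have "span (L ` K) = span (L ` S)"
    using K linear_span_image[OF L(1)] span_mono by (metis span_span subset_antisym)
  ultimately have "dim (L ` S) = card (L ` K)" using dim_eq_card by blast
  also have "\<dots> = card K" using L(2) by (metis card_image inj_on_subset subset_UNIV)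
  finally show ?thesis using K(4) by simp
qed

lemma ex_orthogonal_vector:
  fixes B :: "'e::euclidean_space \<Rightarrow> 'e \<Rightarrow> real"
  assumes "bilinear B" "subspace S" "dim S \<ge> 2"
  shows "\<exists>v\<in>S. v \<noteq> 0 \<and> B u v = 0"
proof -
  obtain K where K: "K \<subseteq> S" "independent K" "card K = dim S" using basis_exists[of S] by metis
  have "\<not> card K \<le> Suc 0" using K(3) assms(3) by simp
  then obtain a b where ab: "a \<in> K" "b \<in> K" "a \<noteq> b"
    using card_le_Suc0_iff_eq[OF finiteI_independent[OF K(2)]] by blast
  have l: "linear (B u)" using assms(1) by (simp add: bilinear_def)
  \<comment> \<open>In the plane of two independent vectors the functional \<open>B u\<close> has a
    nonzero zero, and this is an explicit one.\<close>
  define v where "v = (if B u a = 0 then a else B u b *\<^sub>R a - B u a *\<^sub>R b)"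
  have "v \<in> S"
    using ab K(1) assms(2) by (auto simp: v_def intro!: subspace_diff subspace_scale)
  moreover have "B u v = 0"
    by (simp add: v_def linear_diff[OF l] linear_scale[OF l])
  moreover have "v \<noteq> 0"
  proof (cases "B u a = 0")
    case True
    then show ?thesis using ab(1) K(2) dependent_zero by (auto simp: v_def)
  next
    case False
    have "b \<notin> span {a}"
    proof -
      have "{a} \<subseteq> K - {b}" using ab by blast
      then have "span {a} \<subseteq> span (K - {b})" by (rule span_mono)
      then show ?thesis using K(2) ab(2) unfolding dependent_def by blast
    qed
    moreover have "b \<in> span {a}" if "B u b *\<^sub>R a = B u a *\<^sub>R b"
    proof -
      have "b = inverse (B u a) *\<^sub>R (B u b *\<^sub>R a)"
        unfolding that using False by simp
      then show ?thesis by (metis span_base span_scale singletonI)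
    qed
    ultimately show ?thesis using False by (auto simp: v_def)
  qed
  ultimately show ?thesis by blast
qed

section \<open>Nearly Kaehler manifolds in a chart\<close>

lemma nabla_chart:
  assumes A: "smooth_atlas A" and c: "c = chart_at A p"
  shows "nabla A g E F p c = frechet_derivative (\<lambda>y. F (cinv c y) c) (at (cmap c p)) (E p c)
     + levi_civita_coeff A g c (cmap c p) (E p c) (F p c)"
    "nabla A g E F p \<in> tangent_space A p"
  using coord_vec_self[OF A chart_at[OF A]] coord_vec_tangent[OF A chart_at[OF A]]
  by (simp_all add: nabla_def c Let_def)

context
  fixes A :: "('m::{t2_space,second_countable_topology}, 'e::euclidean_space) chart set"
    and \<phi> g
  assumes nk: "nearly_kaehler A \<phi> g"
begin

lemma nk_atlas: "smooth_atlas A" and nk_metric: "riemannian_metric A g"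
  and phi_tangent: "u \<in> tangent_space A p \<Longrightarrow> \<phi> p u \<in> tangent_space A p"
  and phi_add: "u \<in> tangent_space A p \<Longrightarrow> v \<in> tangent_space A p \<Longrightarrow> \<phi> p (u + v) = \<phi> p u + \<phi> p v"
  and phi_scale: "u \<in> tangent_space A p \<Longrightarrow> \<phi> p (a *\<^sub>R u) = a *\<^sub>R \<phi> p u"
  and phi_phi: "u \<in> tangent_space A p \<Longrightarrow> \<phi> p (\<phi> p u) = - u"
  and phi_isometry: "u \<in> tangent_space A p \<Longrightarrow> v \<in> tangent_space A p \<Longrightarrow> g p (\<phi> p u) (\<phi> p v) = g p u v"
  and phi_smooth: "c \<in> A \<Longrightarrow> smooth_on (crange c) (\<lambda>x. \<phi> (cinv c x) (coord_vec A c (cinv c x) w) c)"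
  using nk unfolding nearly_kaehler_def almost_hermitian_def riemannian_manifold_def by blast+

definition phi_coord :: "('m, 'e) chart \<Rightarrow> 'e \<Rightarrow> 'e \<Rightarrow> 'e" where
  "phi_coord c x u = \<phi> (cinv c x) (coord_vec A c (cinv c x) u) c"

lemma phi_coord_linear:
  assumes c: "c \<in> A" "x \<in> crange c"
  shows "linear (phi_coord c x)"
proof -
  note p = c(1) cinv_in[OF nk_atlas c(2)]
  note l = linear_add[OF coord_vec_linear[OF nk_atlas p]] linear_scale[OF coord_vec_linear[OF nk_atlas p]]
  note t = coord_vec_tangent[OF nk_atlas p]
  have sa: "(r *\<^sub>R v) c = r *\<^sub>R v c" for r and v :: "('m, 'e) tvec" by (simp add: scaleR_fun_def)
  show ?thesis
    by (rule linearI) (simp_all add: phi_coord_def l phi_add[OF t t] phi_scale[OF t] sa)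
qed

lemma phi_coord_eq:
  assumes c: "c \<in> A" "p \<in> cdom c" and v: "v \<in> tangent_space A p"
  shows "\<phi> p v c = phi_coord c (cmap c p) (v c)"
  by (simp add: phi_coord_def cinv_cmap[OF nk_atlas c] coord_vec_of_tangent[OF nk_atlas v c])

lemma phi_coord_vec:
  assumes c: "c \<in> A" "p \<in> cdom c"
  shows "\<phi> p (coord_vec A c p u) = coord_vec A c p (phi_coord c (cmap c p) u)"
proof -
  note t = coord_vec_tangent[OF nk_atlas c]
  have "\<phi> p (coord_vec A c p u) c = phi_coord c (cmap c p) u"
    by (simp add: phi_coord_eq[OF c t] coord_vec_self[OF nk_atlas c])
  then show ?thesis using coord_vec_of_tangent[OF nk_atlas phi_tangent[OF t, of u] c] by simp
qed

text \<open>\<open>u\<close> is extended to a global field \<open>E\<close> that is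
  \<open>\<beta>\<close> times a constant field in the chart, and the nearly Kaehler identity is
  applied with both fields equal to \<open>E\<close>. The assumption on \<open>c\<close> matches the
  chart in which \<open>nabla\<close> is evaluated at \<open>p\<close>.\<close>

lemma nearly_kaehler_coord:
  assumes c: "c = chart_at A p" and x0: "x0 = cmap c p"
  shows "frechet_derivative (\<lambda>y. phi_coord c y u) (at x0) u
    + christoffel (metric_coord A g c) x0 u (phi_coord c x0 u)
    - phi_coord c x0 (christoffel (metric_coord A g c) x0 u u) = 0"
proof -
  have cA: "c \<in> A" "p \<in> cdom c" unfolding c by (rule chart_at[OF nk_atlas])+
  have xr: "x0 \<in> crange c" using cA x0 by simp
  obtain E \<beta> where E: "vector_field A E" and b: "smooth_on UNIV \<beta>" "\<beta> (cmap c p) > 0"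
    and Ec: "\<And>q. q \<in> cdom c \<Longrightarrow> E q = coord_vec A c q (\<beta> (cmap c q) *\<^sub>R u)"
    using ex_vector_field[OF nk_atlas cA, of u] by blast
  have Et: "E q \<in> tangent_space A q" for q using E by (simp add: vector_field_def)
  define k where "k = \<beta> x0"
  have k: "k > 0" using b(2) x0 by (simp add: k_def)
  define \<beta>' where "\<beta>' = frechet_derivative \<beta> (at x0)"
  have b': "(\<beta> has_derivative \<beta>') (at x0)"
    unfolding \<beta>'_def by (rule smooth_on_has_derivative[OF b(1)]) simp
  note lin = phi_coord_linear[OF cA(1) xr]
  define \<Gamma> where "\<Gamma> = christoffel (metric_coord A g c) x0"
  have bil: "bilinear \<Gamma>"
    unfolding \<Gamma>_def by (rule christoffel_bilinear[OF metric_coord_metric_on[OF nk_atlas nk_metric cA(1)] xr])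
  have \<Gamma>s: "\<Gamma> (r *\<^sub>R a) b = r *\<^sub>R \<Gamma> a b" "\<Gamma> a (r *\<^sub>R b) = r *\<^sub>R \<Gamma> a b" for r a b
    using bil by (simp_all add: bilinear_def linear_scale linear_scale[of "\<lambda>a. \<Gamma> a b"])
  have Epc: "E p c = k *\<^sub>R u"
    by (simp add: Ec[OF cA(2)] coord_vec_self[OF nk_atlas cA] k_def x0)
  have phiEpc: "\<phi> p (E p) c = k *\<^sub>R phi_coord c x0 u"
    by (simp add: phi_coord_eq[OF cA Et] Epc x0[symmetric] linear_scale[OF lin])
  have E1: "E (cinv c y) c = \<beta> y *\<^sub>R u" if "y \<in> crange c" for y
    using cinv_in[OF nk_atlas that] cmap_cinv[OF nk_atlas that] cA(1)
    by (simp add: Ec coord_vec_self[OF nk_atlas])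
  have E2: "\<phi> (cinv c y) (E (cinv c y)) c = \<beta> y *\<^sub>R phi_coord c y u" if "y \<in> crange c" for y
    using cmap_cinv[OF nk_atlas that] linear_scale[OF phi_coord_linear[OF cA(1) that]] E1[OF that]
    by (simp add: phi_coord_eq[OF cA(1) cinv_in[OF nk_atlas that] Et])
  define D where "D = frechet_derivative (\<lambda>y. phi_coord c y u) (at x0)"
  have D: "((\<lambda>y. phi_coord c y u) has_derivative D) (at x0)"
    unfolding D_def phi_coord_def by (rule smooth_on_has_derivative[OF phi_smooth[OF cA(1)] xr])
  have Dl: "linear D" by (rule has_derivative_linear[OF D])
  have "((\<lambda>y. E (cinv c y) c) has_derivative (\<lambda>h. \<beta>' h *\<^sub>R u)) (at x0)"
    by (rule has_derivative_transform_within_open[OF has_derivative_scaleR_left[OF b'] chart_open(2)[OF nk_atlas cA(1)] xr])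
      (simp add: E1)
  then have F1: "frechet_derivative (\<lambda>y. E (cinv c y) c) (at x0) = (\<lambda>h. \<beta>' h *\<^sub>R u)"
    by (rule frechet_derivative_at[symmetric])
  have "((\<lambda>y. \<phi> (cinv c y) (E (cinv c y)) c) has_derivative (\<lambda>h. k *\<^sub>R D h + \<beta>' h *\<^sub>R phi_coord c x0 u)) (at x0)"
    unfolding k_def
    by (rule has_derivative_transform_within_open[OF has_derivative_scaleR[OF b' D] chart_open(2)[OF nk_atlas cA(1)] xr])
      (simp add: E2)
  then have F2: "frechet_derivative (\<lambda>y. \<phi> (cinv c y) (E (cinv c y)) c) (at x0) = (\<lambda>h. k *\<^sub>R D h + \<beta>' h *\<^sub>R phi_coord c x0 u)"
    by (rule frechet_derivative_at[symmetric])
  have lc: "levi_civita_coeff A g c x0 = \<Gamma>"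
    by (simp add: \<Gamma>_def levi_civita_coeff_eq[OF nk_atlas nk_metric])
  have N1: "nabla A g E E p c = \<beta>' (k *\<^sub>R u) *\<^sub>R u + (k * k) *\<^sub>R \<Gamma> u u"
    using nabla_chart(1)[OF nk_atlas c, where g=g and E=E and F=E] unfolding lc x0[symmetric] F1 Epc
    by (simp add: \<Gamma>s)
  have N2: "nabla A g E (\<lambda>q. \<phi> q (E q)) p c = (k * k) *\<^sub>R D u + \<beta>' (k *\<^sub>R u) *\<^sub>R phi_coord c x0 u
      + (k * k) *\<^sub>R \<Gamma> u (phi_coord c x0 u)"
    using nabla_chart(1)[OF nk_atlas c, where g=g and E=E and F="\<lambda>q. \<phi> q (E q)"]
    unfolding lc x0[symmetric] F2 Epc phiEpc
    by (simp add: \<Gamma>s linear_scale[OF Dl])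
  have "nabla_endo A g \<phi> E E p + nabla_endo A g \<phi> E E p = 0"
    using nk E unfolding nearly_kaehler_def by blast
  then have "nabla_endo A g \<phi> E E p c + nabla_endo A g \<phi> E E p c = 0"
    by (metis plus_fun_apply zero_fun_apply)
  then have "nabla_endo A g \<phi> E E p c = 0"
    by (metis scaleR_2 scaleR_eq_0_iff zero_neq_numeral)
  then have "nabla A g E (\<lambda>q. \<phi> q (E q)) p c - \<phi> p (nabla A g E E p) c = 0"
    by (simp add: nabla_endo_def)
  \<comment> \<open>The derivative of \<open>\<beta>\<close> occurs in both terms with the factor
    \<open>phi_coord c x0 u\<close> and cancels; what remains is the claim times
    \<open>k * k\<close>.\<close>
  then have "(k * k) *\<^sub>R (D u + \<Gamma> u (phi_coord c x0 u) - phi_coord c x0 (\<Gamma> u u)) = 0"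
    unfolding phi_coord_eq[OF cA nabla_chart(2)[OF nk_atlas c]] N1 N2 x0[symmetric]
    by (simp add: linear_add[OF lin] linear_scale[OF lin] algebra_simps)
  then show ?thesis using k by (simp add: D_def \<Gamma>_def)
qed

end

theorem theorem3p4:
  fixes A :: "('m::{t2_space,second_countable_topology}, 'e::euclidean_space) chart set"
    and \<phi> :: "'m \<Rightarrow> ('m, 'e) tvec \<Rightarrow> ('m, 'e) tvec"
    and g :: "('m, 'e) metric"
    and B :: "('n::{t2_space,second_countable_topology}, 'k::euclidean_space) chart set"
    and g\<^sub>n :: "('n, 'k) metric"
    and \<pi> :: "'m \<Rightarrow> 'n"
    and f :: "'m \<Rightarrow> real"
  assumes "nearly_kaehler A \<phi> g"
    and "riemannian_manifold B g\<^sub>n"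
    and "smooth_fun A f"
    and "clairaut_submersion A g B g\<^sub>n \<pi> (\<lambda>p. exp (f p))"
    and "anti_invariant A \<phi> g B \<pi>"
    and "\<And>p. grad A g f p \<in> \<phi> p ` vertical A B \<pi> p"
  shows "constant_on_phi_vertical A \<phi> g B \<pi> f \<or> fibres_of_dim A B \<pi> 1"
proof -
  note nk = assms(1) and f = assms(3) and cl = assms(4) and ai = assms(5) and gr = assms(6)
  note A = nk_atlas[OF nk] and g = nk_metric[OF nk]
  have sub: "riemannian_submersion A g B g\<^sub>n \<pi>" using cl by (simp add: clairaut_submersion_def)
  then have dims: "DIM('k) < DIM('e)" and B: "smooth_atlas B"
    by (simp_all add: riemannian_submersion_def riemannian_manifold_def)
  \<comment> \<open>Both facts are proved together because they use the same pair of charts around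
    \<open>p\<close> and its image.\<close>
  have dim: "dim (vertical A B \<pi> p) + DIM('k) = DIM('e)"
    and main: "DIM('e) - DIM('k) \<ge> 2 \<Longrightarrow> grad A g f p = 0" for p
  proof -
    define c where "c = chart_at A p"
    define d where "d = chart_at B (\<pi> p)"
    define x0 where "x0 = cmap c p"
    have cp: "c \<in> A" "p \<in> cdom c" unfolding c_def by (rule chart_at[OF A])+
    have dp: "d \<in> B" "\<pi> p \<in> cdom d" unfolding d_def by (rule chart_at[OF B])+
    interpret submersion_charts A g B g\<^sub>n \<pi> c d by unfold_locales (use sub cp dp in auto)
    have p: "cinv c x0 = p" unfolding x0_def by (rule cinv_cmap[OF A cp])
    have x0: "x0 \<in> U" unfolding U_iff p using cp dp by (simp add: x0_def)
    have ker: "dim {u. dP x0 u = 0} + DIM('k) = DIM('e)"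
      by (rule dim_kernel_surj[OF dP_linear[OF x0]]) (use surj_dP[OF x0] in \<open>simp add: dP_def\<close>)
    \<comment> \<open>A tangent vector is determined by its representation in \<open>c\<close>, so
      the dimension can be counted in coordinates.\<close>
    have inj: "inj (coord_vec A c p)"
      by (rule injI) (metis coord_vec_self[OF A cp])
    show "dim (vertical A B \<pi> p) + DIM('k) = DIM('e)"
      using vertical_eq[OF x0] dim_linear_image_inj[OF coord_vec_linear[OF A cp] inj] ker by (simp add: p)
    assume "DIM('e) - DIM('k) \<ge> 2"
    then have ker2: "dim {u. dP x0 u = 0} \<ge> 2" using ker by simp
    define \<Phi> where "\<Phi> = phi_coord A \<phi> c"
    have coord: "\<phi> (cinv c x) (coord_vec A c (cinv c x) u) = coord_vec A c (cinv c x) (\<Phi> x u)" if "x \<in> U" for x u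
      using phi_coord_vec[OF nk cp(1) U_point(2)[OF that], of u] by (simp add: \<Phi>_def U_point(3)[OF that])
    have \<Phi>_linear: "linear (\<Phi> x)" if "x \<in> U" for x
      unfolding \<Phi>_def by (rule phi_coord_linear[OF nk cp(1) U_point(1)[OF that]])
    interpret local_anti_invariant U "metric_coord A g c" "crange d" "metric_coord B g\<^sub>n d" P \<Phi> x0
    proof
      show "x0 \<in> U" by (rule x0)
      show "\<Phi> x (u + v) = \<Phi> x u + \<Phi> x v" "\<Phi> x (r *\<^sub>R u) = r *\<^sub>R \<Phi> x u" if "x \<in> U" for x u v r
        using linear_add[OF \<Phi>_linear[OF that]] linear_scale[OF \<Phi>_linear[OF that]] by auto
      show "smooth_on U (\<lambda>x. \<Phi> x u)" for u
        unfolding \<Phi>_def phi_coord_def[OF nk]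
        by (rule smooth_on_subset[OF phi_smooth[OF nk cp(1)]]) (use U_iff in blast)
      show "frechet_derivative (\<lambda>y. \<Phi> y v) (at x0) v + christoffel (metric_coord A g c) x0 v (\<Phi> x0 v)
          - \<Phi> x0 (christoffel (metric_coord A g c) x0 v v) = 0" for v
        unfolding \<Phi>_def by (rule nearly_kaehler_coord[OF nk c_def x0_def])
    next
      fix x u assume x: "x \<in> U"
      note q = cp(1) U_point(2)[OF x]
      note t = coord_vec_tangent[OF A q] and self = coord_vec_self[OF A q]
      have "coord_vec A c (cinv c x) (\<Phi> x (\<Phi> x u)) = - coord_vec A c (cinv c x) u"
        using phi_phi[OF nk t, of u] by (simp add: coord[OF x])
      then show "\<Phi> x (\<Phi> x u) = - u" by (metis self uminus_apply)
      show "metric_coord A g c x (\<Phi> x u) (\<Phi> x v) = metric_coord A g c x u v" for v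
        using phi_isometry[OF nk t t, of u v] by (simp add: coord[OF x] metric_coord_at[OF x t t] self)
      assume "dP x u = 0"
      then have "coord_vec A c (cinv c x) u \<in> vertical A B \<pi> (cinv c x)"
        by (simp add: coord_vertical_iff[OF x] dP_def)
      then have "coord_vec A c (cinv c x) (\<Phi> x u) \<in> horizontal A g B \<pi> (cinv c x)"
        using ai coord[OF x, of u] unfolding anti_invariant_def by (metis image_subset_iff)
      then show "hor x (\<Phi> x u)" by (simp add: horizontal_hor[OF x] self)
    qed
    obtain X where X: "X \<in> vertical A B \<pi> p" "grad A g f p = \<phi> p X" using gr by blast
    have Xt: "X \<in> tangent_space A p" "dP x0 (X c) = 0"
      using X(1) vertical_iff[OF x0, of X] by (auto simp: p dP_def)
    have "\<phi> p X c = \<Phi> x0 (X c)" unfolding \<Phi>_def x0_def by (rule phi_coord_eq[OF nk cp Xt(1)])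
    define F' where "F' = frechet_derivative (f \<circ> cinv c) (at x0)"
    have F: "((f \<circ> cinv c) has_derivative F') (at x0)"
      unfolding F'_def by (rule smooth_on_has_derivative[OF _ U_point(1)[OF x0]])
        (use f cp in \<open>auto simp: smooth_fun_def\<close>)
    have gF: "F' u = metric_coord A g c x0 (\<Phi> x0 (X c)) u" for u
    proof -
      note t = coord_vec_tangent[OF A cp, of u]
      have "F' u = dir_deriv A p (coord_vec A c p u) f"
        by (simp add: dir_deriv_def c_def[symmetric] Let_def F'_def x0_def coord_vec_self[OF A cp])
      also have "\<dots> = g p (\<phi> p X) (coord_vec A c p u)"
        using grad_props(2)[OF A g f t] X(2) by simp
      also have "\<dots> = metric_coord A g c x0 (\<Phi> x0 (X c)) u"
        using metric_coord_eq[OF A g cp phi_tangent[OF nk Xt(1)] t] \<open>\<phi> p X c = \<Phi> x0 (X c)\<close>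
        by (simp add: x0_def coord_vec_self[OF A cp])
      finally show ?thesis .
    qed
    have "subspace {u. dP x0 u = 0}" by (rule linear_subspace_kernel[OF dP_linear[OF x0]])
    from ex_orthogonal_vector[OF metric_on_bilinear[OF G x0] this ker2, of "X c"]
    obtain v where "dP x0 v = 0" "v \<noteq> 0" "metric_coord A g c x0 (X c) v = 0" by blast
    from gradient_vanishes[OF clairaut_local_of_clairaut[OF cl] F Xt(2) gF this]
    have "X c = 0" .
    then have "X = 0" using tangent_eqI[OF A cp Xt(1) zero_tangent[OF A]] by simp
    then show "grad A g f p = 0"
      using X(2) phi_scale[OF nk zero_tangent[OF A], of p 0] by simp
  qed
  show ?thesis
  proof (cases "DIM('e) - DIM('k) \<ge> 2")
    case True
    have "g p (grad A g f p) (\<phi> p (V p)) = 0" if "vertical_field A B \<pi> V" for V p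
    proof -
      have "V p \<in> tangent_space A p" using that by (simp add: vertical_field_def vertical_def)
      then show ?thesis unfolding main[OF True] by (intro metric_zero_left[OF A g] phi_tangent[OF nk])
    qed
    then show ?thesis by (simp add: constant_on_phi_vertical_def)
  next
    case False
    \<comment> \<open>The strict inequality \<open>dims\<close> excludes dimension
      \<open>0\<close>.\<close>
    then have "dim (vertical A B \<pi> p) = 1" for p using dim[of p] dims by simp
    then show ?thesis by (simp add: fibres_of_dim_def)
  qed
qed

end
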